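(* Let $X$ be a smooth Hausdorff paracompact manifold. Then the sheaf $\Omega\to\mathcal{G}^\infty(\Omega)$ ($\Omega$ open in $X$) of algebras of generalized functions is a supple sheaf. That is: for every open set $U\subseteq X$, every $f\in\mathcal{G}^\infty(U)$, and all closed sets $Z_1,Z_2$ of $X$ with $\operatorname{supp} f=Z_1\cup Z_2$, there exist $f_1,f_2\in\mathcal{G}^\infty(U)$ such that $\operatorname{supp} f_1\subseteq Z_1$, $\operatorname{supp} f_2\subseteq Z_2$ and $f=f_1+f_2$.
   Context: Functions are scalar valued (real or complex, fixed throughout). $K\subset\subset\Omega$ means that $K$ is a compact subset of $\Omega$. All $O$-estimates are for $\varepsilon\to 0$. Let $\Omega$ be an open subset of $X$, regarded as a manifold. Let $\mathcal{E}(\Omega)=(C^\infty(\Omega))^{(0,1)}$ be the set of all nets $(u_\varepsilon)_{\varepsilon\in(0,1)}$ of smooth functions on $\Omega$, and let $\mathcal{P}(\Omega)$ be the space of linear differential operators (with smooth coefficients) acting on smooth functions on $\Omega$. Moderate nets: $\mathcal{E}_M(\Omega)$ is the set of $(u_\varepsilon)_\varepsilon\in\mathcal{E}(\Omega)$ such that for every $K\subset\subset\Omega$ and every $P\in\mathcal{P}(\Omega)$ there is $N\in\mathbb{N}$ with $\sup_{p\in K}|Pu_\varepsilon(p)|=O(\varepsilon^{-N})$. Negligible nets: $\mathcal{N}(\Omega)$ is the set of $(u_\varepsilon)_\varepsilon\in\mathcal{E}_M(\Omega)$ such that for every $K\subset\subset\Omega$ and every $m\in\mathbb{N}$, $\sup_{p\in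 K}|u_\varepsilon(p)|=O(\varepsilon^{m})$. $\mathcal{E}_M(\Omega)$ is an algebra under the $\varepsilon$-wise operations, $\mathcal{N}(\Omega)$ is an ideal in it, and $\mathcal{G}(\Omega)=\mathcal{E}_M(\Omega)/\mathcal{N}(\Omega)$. The class of $(u_\varepsilon)_\varepsilon$ is written $[(u_\varepsilon)_\varepsilon]$. For open $\Omega'\subseteq\Omega$ the restriction is $[(u_\varepsilon)_\varepsilon]|_{\Omega'}=[(u_\varepsilon|_{\Omega'})_\varepsilon]\in\mathcal{G}(\Omega')$. With these restrictions $\Omega\to\mathcal{G}(\Omega)$ is a sheaf of algebras on $X$. For an open set $W\subseteq\mathbb{R}^d$, $\mathcal{E}^\infty_M(W)$ is the set of nets $(f_\varepsilon)_{\varepsilon\in(0,1)}$ of smooth functions on $W$ such that for every $K\subset\subset W$ there is $a\in\mathbb{R}$ such that for every multi-index $n\in\mathbb{N}_0^d$, $\sup_{x\in K}|f_\varepsilon^{(n)}(x)|=O(\varepsilon^{a})$ (the exponent $a$ does not depend on $n$). For $\Omega$ open in $X$, $\mathcal{G}^\infty(\Omega)$ is the subalgebra of $\mathcal{G}(\Omega)$ consisting of those $u$ that have a representative $(u_\varepsilon)_\varepsilon$ such that for every chart $(V,\varphi)$ of $\Omega$, $(u_\varepsilon\circ\varphi^{-1})_\varepsilon\in\mathcal{E}^\infty_M(\varphi(V))$. With the restrictions of $\mathcal{G}$, $\Omega\to\mathcal{G}^\infty(\Omega)$ is a subsheaf of $\mathcal{G}$, and its sections over $U$ are the elements of $\mathcal{G}^\infty(U)$.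 The support $\operatorname{supp} u$ of $u\in\mathcal{G}(U)$ (in particular of $u\in\mathcal{G}^\infty(U)$) is the complement in $U$ of the union of all open sets $U'\subseteq U$ with $u|_{U'}=0$ in $\mathcal{G}(U')$. A sheaf $\mathcal{F}$ on a topological space $X$ is called supple if for every open $U\subseteq X$ and every section $f\in\Gamma(U,\mathcal{F})$ the following holds: if $\operatorname{supp} f=Z_1\cup Z_2$ with $Z_1,Z_2$ arbitrary closed sets of $X$, then there exist $f_1,f_2\in\Gamma(U,\mathcal{F})$ with $\operatorname{supp} f_1\subseteq Z_1$, $\operatorname{supp} f_2\subseteq Z_2$ and $f=f_1+f_2$. *)

theory Defs
  imports "HOL-Analysis.Analysis" "HOL-Algebra.QuotRing"
begin

section \<open>Smooth functions on open subsets of $R^d$\<close>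

text \<open>
  The class \<^class>\<open>euclidean_space\<close> has no zero-dimensional instance.  To include $d = 0$, the
  space $R^d$ is rendered as \<^term>\<open>span B\<close> where \<^term>\<open>B :: 'e::euclidean_space set\<close> is either
  \<^term>\<open>Basis :: 'e::euclidean_space set\<close> (so the span is the whole type, $d \ge 1$) or empty
  (so the span is the origin, $d = 0$).  The set \<^term>\<open>B\<close> is the set of coordinate directions.
\<close>

definition partial_deriv :: "'e::euclidean_space \<Rightarrow> ('e \<Rightarrow> 'b::real_normed_vector) \<Rightarrow> 'e \<Rightarrow> 'b" where
  "partial_deriv b f x = vector_derivative (\<lambda>t::real. f (x + t *\<^sub>R b)) (at 0)"

text \<open>
  A multi-index is represented by a list of directions, the number of occurrences of \<^term>\<open>b\<close> being
  the order of differentiation in direction \<^term>\<open>b\<close>.  Partial derivatives of smooth functions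
  commute, so the order of the list is immaterial.
\<close>

definition partials :: "'e::euclidean_space list \<Rightarrow> ('e \<Rightarrow> 'b::real_normed_vector) \<Rightarrow> 'e \<Rightarrow> 'b" where
  "partials bs f = foldr partial_deriv bs f"

text \<open>Only meaningful for \<^term>\<open>W\<close> open in \<^term>\<open>span B\<close>; values outside \<^term>\<open>W\<close> are irrelevant.\<close>

definition smooth_fun :: "'e::euclidean_space set \<Rightarrow> 'e set \<Rightarrow> ('e \<Rightarrow> 'b::real_normed_vector) \<Rightarrow> bool" where
  "smooth_fun B W f \<longleftrightarrow>
     (\<forall>bs. set bs \<subseteq> B \<longrightarrow>
        continuous_on W (partials bs f) \<and>
        (\<forall>b\<in>B. \<forall>x\<in>W. (\<lambda>t::real. partials bs f (x + t *\<^sub>R b)) differentiable (at 0)))"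


section \<open>Smooth manifolds\<close>

record ('a, 'e) manifold =
  mtop :: "'a topology"
  dirs :: "'e set"
  atlas :: "('a set \<times> ('a \<Rightarrow> 'e)) set"

definition is_chart :: "('a, 'e::euclidean_space) manifold \<Rightarrow> 'a set \<times> ('a \<Rightarrow> 'e) \<Rightarrow> bool" where
  "is_chart X = (\<lambda>(V, \<phi>).
     openin (mtop X) V \<and> openin (top_of_set (span (dirs X))) (\<phi> ` V) \<and>
     homeomorphic_map (subtopology (mtop X) V) (top_of_set (\<phi> ` V)) \<phi>)"

definition smooth_transition ::
    "('a, 'e::euclidean_space) manifold \<Rightarrow> 'a set \<times> ('a \<Rightarrow> 'e) \<Rightarrow> 'a set \<times> ('a \<Rightarrow> 'e) \<Rightarrow> bool" where
  "smooth_transition X = (\<lambda>(V, \<phi>) (V', \<phi>').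
     smooth_fun (dirs X) (\<phi> ` (V \<inter> V')) (\<phi>' \<circ> inv_into V \<phi>))"

definition compatible ::
    "('a, 'e::euclidean_space) manifold \<Rightarrow> 'a set \<times> ('a \<Rightarrow> 'e) \<Rightarrow> 'a set \<times> ('a \<Rightarrow> 'e) \<Rightarrow> bool" where
  "compatible X c c' \<longleftrightarrow> smooth_transition X c c' \<and> smooth_transition X c' c"

text \<open>The smooth structure is given by its maximal atlas.\<close>

definition smooth_manifold :: "('a, 'e::euclidean_space) manifold \<Rightarrow> bool" where
  "smooth_manifold X \<longleftrightarrow>
     (dirs X = Basis \<or> dirs X = {}) \<and>
     (\<forall>c\<in>atlas X. is_chart X c) \<and>
     (\<Union>(V, \<phi>)\<in>atlas X. V) = topspace (mtop X) \<and>
     (\<forall>c\<in>atlas X. \<forall>c'\<in>atlas X. compatible X c c') \<and>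
     (\<forall>c. is_chart X c \<and> (\<forall>c'\<in>atlas X. compatible X c c') \<longrightarrow> c \<in> atlas X)"

definition paracompact_space :: "'a topology \<Rightarrow> bool" where
  "paracompact_space T \<longleftrightarrow>
     (\<forall>\<U>. (\<forall>U\<in>\<U>. openin T U) \<and> \<Union>\<U> = topspace T \<longrightarrow>
        (\<exists>\<V>. (\<forall>V\<in>\<V>. openin T V) \<and> \<Union>\<V> = topspace T \<and>
              (\<forall>V\<in>\<V>. \<exists>U\<in>\<U>. V \<subseteq> U) \<and> locally_finite_in T \<V>))"

definition charts_of :: "('a, 'e::euclidean_space) manifold \<Rightarrow> 'a set \<Rightarrow> ('a set \<times> ('a \<Rightarrow> 'e)) set" where
  "charts_of X \<Omega> = {(V, \<phi>) \<in> atlas X. V \<subseteq> \<Omega>}"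


section \<open>Generalized functions\<close>

text \<open>
  The scalar type \<^typ>\<open>'k::{real_normed_field,euclidean_space}\<close> stands for the real or the complex
  numbers.  A function on \<^term>\<open>\<Omega>\<close> is a function on the whole type whose values outside
  \<^term>\<open>\<Omega>\<close> are ignored; likewise only the values of a net for parameters in $(0,1)$ matter.
\<close>

definition smooth_on_mfd ::
    "('a, 'e::euclidean_space) manifold \<Rightarrow> 'a set \<Rightarrow> ('a \<Rightarrow> 'k::{real_normed_field,euclidean_space}) \<Rightarrow> bool" where
  "smooth_on_mfd X \<Omega> u \<longleftrightarrow>
     (\<forall>(V, \<phi>)\<in>charts_of X \<Omega>. smooth_fun (dirs X) (\<phi> ` V) (u \<circ> inv_into V \<phi>))"

definition lin_diff_op ::
    "('a, 'e::euclidean_space) manifold \<Rightarrow> 'a set \<Rightarrow>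
     (('a \<Rightarrow> 'k) \<Rightarrow> 'a \<Rightarrow> 'k::{real_normed_field,euclidean_space}) \<Rightarrow> bool" where
  "lin_diff_op X \<Omega> P \<longleftrightarrow>
     (\<exists>k::nat. \<forall>(V, \<phi>)\<in>charts_of X \<Omega>. \<exists>a :: 'e list \<Rightarrow> 'e \<Rightarrow> 'k.
        (\<forall>bs. smooth_fun (dirs X) (\<phi> ` V) (a bs)) \<and>
        (\<forall>u. smooth_on_mfd X \<Omega> u \<longrightarrow> (\<forall>p\<in>V.
           P u p = (\<Sum>bs | set bs \<subseteq> dirs X \<and> length bs \<le> k.
                      a bs (\<phi> p) * partials bs (u \<circ> inv_into V \<phi>) (\<phi> p)))))"

text \<open>$\sup_{p \in K} |u_\varepsilon(p)| = O(\varepsilon^a)$ for $\varepsilon \to 0$, written so as to avoid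
  the unspecified real supremum of the empty set.\<close>

definition sup_bigo :: "'p set \<Rightarrow> (real \<Rightarrow> 'p \<Rightarrow> 'k::real_normed_vector) \<Rightarrow> real \<Rightarrow> bool" where
  "sup_bigo K u a \<longleftrightarrow>
     (\<exists>C. \<forall>\<^sub>F \<epsilon> in at_right 0. \<forall>p\<in>K. norm (u \<epsilon> p) \<le> C * \<epsilon> powr a)"

definition moderate_nets ::
    "('a, 'e::euclidean_space) manifold \<Rightarrow> 'a set \<Rightarrow>
     (real \<Rightarrow> 'a \<Rightarrow> 'k::{real_normed_field,euclidean_space}) set" where
  "moderate_nets X \<Omega> =
     {u. (\<forall>\<epsilon>\<in>{0<..<1}. smooth_on_mfd X \<Omega> (u \<epsilon>)) \<and>
         (\<forall>K P. compactin (mtop X) K \<and> K \<subseteq> \<Omega> \<and> lin_diff_op X \<Omega> P \<longrightarrow>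
            (\<exists>N::nat. sup_bigo K (\<lambda>\<epsilon>. P (u \<epsilon>)) (- real N)))}"

definition negligible_nets ::
    "('a, 'e::euclidean_space) manifold \<Rightarrow> 'a set \<Rightarrow>
     (real \<Rightarrow> 'a \<Rightarrow> 'k::{real_normed_field,euclidean_space}) set" where
  "negligible_nets X \<Omega> =
     {u \<in> moderate_nets X \<Omega>.
        \<forall>K. compactin (mtop X) K \<and> K \<subseteq> \<Omega> \<longrightarrow> (\<forall>m::nat. sup_bigo K u (real m))}"

definition moderate_ring ::
    "('a, 'e::euclidean_space) manifold \<Rightarrow> 'a set \<Rightarrow>
     (real \<Rightarrow> 'a \<Rightarrow> 'k::{real_normed_field,euclidean_space}) ring" where
  "moderate_ring X \<Omega> =
     \<lparr>carrier = moderate_nets X \<Omega>,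
      mult = (\<lambda>u v \<epsilon> p. u \<epsilon> p * v \<epsilon> p), one = (\<lambda>\<epsilon> p. 1),
      zero = (\<lambda>\<epsilon> p. 0), add = (\<lambda>u v \<epsilon> p. u \<epsilon> p + v \<epsilon> p)\<rparr>"

definition gen_fun ::
    "('a, 'e::euclidean_space) manifold \<Rightarrow> 'a set \<Rightarrow>
     (real \<Rightarrow> 'a \<Rightarrow> 'k::{real_normed_field,euclidean_space}) set ring" where
  "gen_fun X \<Omega> = moderate_ring X \<Omega> Quot negligible_nets X \<Omega>"

text \<open>Sections are cosets of nets, so the restriction to \<^term>\<open>\<Omega>'\<close> is the common coset over
  \<^term>\<open>\<Omega>'\<close> of all representatives.\<close>

definition gen_restrict ::
    "('a, 'e::euclidean_space) manifold \<Rightarrow> 'a set \<Rightarrow>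
     (real \<Rightarrow> 'a \<Rightarrow> 'k::{real_normed_field,euclidean_space}) set \<Rightarrow> (real \<Rightarrow> 'a \<Rightarrow> 'k) set" where
  "gen_restrict X \<Omega>' f = (\<Union>u\<in>f. negligible_nets X \<Omega>' +>\<^bsub>moderate_ring X \<Omega>'\<^esub> u)"

definition regular_nets ::
    "'e::euclidean_space set \<Rightarrow> 'e set \<Rightarrow> (real \<Rightarrow> 'e \<Rightarrow> 'k::{real_normed_field,euclidean_space}) set" where
  "regular_nets B W =
     {f. (\<forall>\<epsilon>\<in>{0<..<1}. smooth_fun B W (f \<epsilon>)) \<and>
         (\<forall>K. compact K \<and> K \<subseteq> W \<longrightarrow>
            (\<exists>a::real. \<forall>bs. set bs \<subseteq> B \<longrightarrow> sup_bigo K (\<lambda>\<epsilon>. partials bs (f \<epsilon>)) a))}"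

definition regular_gen_fun ::
    "('a, 'e::euclidean_space) manifold \<Rightarrow> 'a set \<Rightarrow>
     (real \<Rightarrow> 'a \<Rightarrow> 'k::{real_normed_field,euclidean_space}) set ring" where
  "regular_gen_fun X \<Omega> = (gen_fun X \<Omega>)
     \<lparr>carrier := {f \<in> carrier (gen_fun X \<Omega>). \<exists>u\<in>f. \<forall>(V, \<phi>)\<in>charts_of X \<Omega>.
        (\<lambda>\<epsilon>. u \<epsilon> \<circ> inv_into V \<phi>) \<in> regular_nets (dirs X) (\<phi> ` V)}\<rparr>"


section \<open>Supple sheaves\<close>

text \<open>A sheaf of rings \<^term>\<open>F\<close> on \<^term>\<open>T\<close> is given by its rings of sections and by
  restriction maps, \<^term>\<open>res V f\<close> being the restriction of the section \<^term>\<open>f\<close> to \<^term>\<open>V\<close>.\<close>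

definition sheaf_supp ::
    "'a topology \<Rightarrow> ('a set \<Rightarrow> 's ring) \<Rightarrow> ('a set \<Rightarrow> 's \<Rightarrow> 's) \<Rightarrow> 'a set \<Rightarrow> 's \<Rightarrow> 'a set" where
  "sheaf_supp T F res U f = U - \<Union>{V. openin T V \<and> V \<subseteq> U \<and> res V f = \<zero>\<^bsub>F V\<^esub>}"

definition supple ::
    "'a topology \<Rightarrow> ('a set \<Rightarrow> 's ring) \<Rightarrow> ('a set \<Rightarrow> 's \<Rightarrow> 's) \<Rightarrow> bool" where
  "supple T F res \<longleftrightarrow>
     (\<forall>U f Z1 Z2. openin T U \<and> f \<in> carrier (F U) \<and> closedin T Z1 \<and> closedin T Z2 \<and>
        sheaf_supp T F res U f = Z1 \<union> Z2 \<longrightarrow>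
        (\<exists>f1\<in>carrier (F U). \<exists>f2\<in>carrier (F U).
           sheaf_supp T F res U f1 \<subseteq> Z1 \<and> sheaf_supp T F res U f2 \<subseteq> Z2 \<and>
           f = f1 \<oplus>\<^bsub>F U\<^esub> f2))"

end

theory Submission
  imports Defs
begin

text \<open>
  Let $f$ be the class of a regular net $u$ with support $Z_1 \cup Z_2$.  It is split as
  $f = [\eta u] + [(1-\eta) u]$, where $\eta$ is equal to $1$ near every point of $Z_1 \setminus Z_2$ and to
  $0$ near every point of $Z_2 \setminus Z_1$.  A point outside $Z_1$ either lies off the support of $f$ or in
  $Z_2 \setminus Z_1$, so that $[\eta u]$ vanishes near it; symmetrically for $[(1-\eta) u]$ and $Z_2$.

  A smooth function $\eta$ of this kind need not exist, because the two sets may come together at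
  points of $Z_1 \cap Z_2$.  So $\eta$ has to be a net $(\eta_\varepsilon)$ that separates the two sets outside a
  neighbourhood of $Z_1 \cap Z_2$ shrinking as $\varepsilon \to 0$.  Regularity of $u$ means that on a compact set
  all derivatives grow with one and the same power of $\varepsilon$; for the product to keep this, the
  derivatives of $\eta_\varepsilon$ of every order must grow more slowly than every negative power of
  $\varepsilon$.  Such a slow scale net comes from a diagonal argument (\<open>slow_diagonal\<close>): any sequence of
  smooth functions can be run through so slowly that its derivatives grow only logarithmically.
  Applied to smooth functions that separate two closed subsets of Euclidean space more and more closely, this
  gives \<open>slow_separating_net\<close>, and averaging over the charts of a locally finite cover gives the net
  on the manifold (\<open>slow_on_mfd_separating_net\<close>).

  The calculus behind this is that of nets whose derivatives have a common growth exponent on a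
  given set (\<open>tame\<close>): exponents add under products and are preserved by composition with a smooth
  map, in particular under a change of chart (\<open>tame_compose\<close>).  On the side of the quotient algebra
  it must be known that moderate nets restrict to smaller open sets (\<open>moderate_restrict\<close>), which
  rests on multiplying a differential operator by a bump function, and that a net which is regular in
  all charts is moderate (\<open>moderate_if_regular_in_charts\<close>).
\<close>

section \<open>Differentiability from continuous partial derivatives\<close>

text \<open>
  Walking from \<^term>\<open>x\<close> to \<^term>\<open>x + h\<close> along the coordinate directions one after the other, each leg is
  controlled by the mean value inequality for the function minus its expected linear part, whose
  derivative is small because the partial derivative is continuous at \<^term>\<open>x\<close>.  The finite set in
  the induction is the set of coordinate directions already used.
\<close>

lemma has_derivative_partials_euclidean:
  fixes f :: "'e::euclidean_space \<Rightarrow> 'b::real_normed_vector"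
  assumes W: "open W" "x \<in> W"
    and diff: "\<And>y i. y \<in> W \<Longrightarrow> i \<in> Basis \<Longrightarrow> (\<lambda>t::real. f (y + t *\<^sub>R i)) differentiable (at 0)"
    and cont: "\<And>i. i \<in> Basis \<Longrightarrow> continuous_on W (partial_deriv i f)"
  shows "(f has_derivative (\<lambda>h. \<Sum>i\<in>Basis. (h \<bullet> i) *\<^sub>R partial_deriv i f x)) (at x)"
proof -
  have vd: "((\<lambda>t::real. f (y + t *\<^sub>R i)) has_vector_derivative partial_deriv i f (y + s *\<^sub>R i)) (at s)"
    if "y + s *\<^sub>R i \<in> W" "i \<in> Basis" for y i s
  proof -
    have "((\<lambda>t::real. f ((y + s *\<^sub>R i) + t *\<^sub>R i)) has_vector_derivative partial_deriv i f (y + s *\<^sub>R i)) (at (s + -s))"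
      using diff[OF that] by (simp add: partial_deriv_def vector_derivative_works)
    moreover have "((\<lambda>t. t + - s) has_vector_derivative 1) (at s)"
      by (auto intro!: derivative_eq_intros)
    ultimately have "((\<lambda>t::real. f ((y + s *\<^sub>R i) + t *\<^sub>R i)) \<circ> (\<lambda>t. t + -s) has_vector_derivative 1 *\<^sub>R partial_deriv i f (y + s *\<^sub>R i)) (at s)"
      by (rule vector_diff_chain_at[rotated])
    then show ?thesis by (simp add: o_def algebra_simps)
  qed
  have key: "\<exists>d>0. \<forall>h. norm h < d \<longrightarrow>
      norm (f (x + (\<Sum>i\<in>S. (h \<bullet> i) *\<^sub>R i)) - f x - (\<Sum>i\<in>S. (h \<bullet> i) *\<^sub>R partial_deriv i f x)) \<le> e * real (card S) * norm h"
    if "S \<subseteq> Basis" "e > 0" for e S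
    using finite_subset[OF that(1) finite_Basis] that
  proof (induction S rule: finite_induct)
    case empty
    then show ?case by (auto intro: exI[of _ 1])
  next
    case (insert j S)
    then obtain d1 where d1: "d1 > 0" "\<And>h. norm h < d1 \<Longrightarrow>
      norm (f (x + (\<Sum>i\<in>S. (h \<bullet> i) *\<^sub>R i)) - f x - (\<Sum>i\<in>S. (h \<bullet> i) *\<^sub>R partial_deriv i f x)) \<le> e * real (card S) * norm h"
      by auto
    from W obtain d2 where d2: "d2 > 0" "ball x d2 \<subseteq> W" by (meson open_contains_ball)
    have j: "j \<in> Basis" using insert by auto
    have "continuous (at x) (partial_deriv j f)"
      using cont[OF j] W by (simp add: continuous_on_eq_continuous_at)
    then obtain d3 where d3: "d3 > 0" "\<And>y. dist y x < d3 \<Longrightarrow> norm (partial_deriv j f y - partial_deriv j f x) < e"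
      using \<open>e > 0\<close> unfolding continuous_at_eps_delta by (metis dist_norm)
    \<comment> \<open>Every point met on the next leg is within \<open>N * norm h\<close> of \<open>x\<close>: each of the at most
      \<open>DIM('e)\<close> legs before it, and the part of the leg itself, has length at most \<open>norm h\<close>.\<close>
    define N where "N = real (DIM('e)) + 1"
    define d where "d = Min {d1, d2 / N, d3 / N}"
    have N0: "N > 0" unfolding N_def by simp
    have dpos: "d > 0" using d1 d2 d3 N0 by (simp add: d_def)
    have "norm (f (x + (\<Sum>i\<in>insert j S. (h \<bullet> i) *\<^sub>R i)) - f x - (\<Sum>i\<in>insert j S. (h \<bullet> i) *\<^sub>R partial_deriv i f x))
         \<le> e * real (card (insert j S)) * norm h" if h: "norm h < d" for h
    proof -
      define y where "y = x + (\<Sum>i\<in>S. (h \<bullet> i) *\<^sub>R i)"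
      have near: "dist (y + s *\<^sub>R j) x < min d2 d3" if s: "\<bar>s\<bar> \<le> \<bar>h \<bullet> j\<bar>" for s
      proof -
        have "norm (\<Sum>i\<in>S. (h \<bullet> i) *\<^sub>R i) \<le> (\<Sum>i\<in>S. norm h)"
        proof (rule order_trans[OF norm_sum], rule sum_mono)
          fix i assume "i \<in> S"
          then have "i \<in> Basis" using insert.prems by auto
          then show "norm ((h \<bullet> i) *\<^sub>R i) \<le> norm h" using Basis_le_norm[of i h] by simp
        qed
        also have "\<dots> \<le> real (DIM('e)) * norm h"
          using insert.prems by (simp add: card_mono mult_right_mono)
        finally have 1: "norm (\<Sum>i\<in>S. (h \<bullet> i) *\<^sub>R i) \<le> real (DIM('e)) * norm h" .
        have 2: "norm (s *\<^sub>R j) \<le> norm h" using s j Basis_le_norm[OF j, of h] by simp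
        have "dist (y + s *\<^sub>R j) x \<le> norm (\<Sum>i\<in>S. (h \<bullet> i) *\<^sub>R i) + norm (s *\<^sub>R j)"
          using norm_triangle_ineq[of "\<Sum>i\<in>S. (h \<bullet> i) *\<^sub>R i" "s *\<^sub>R j"] by (simp add: y_def dist_norm algebra_simps)
        also have "\<dots> \<le> N * norm h" using 1 2 by (simp add: N_def algebra_simps)
        also have "\<dots> < N * d" using h N0 by simp
        also have "\<dots> \<le> min d2 d3" 
        proof -
          have "d \<le> d2 / N" "d \<le> d3 / N" by (simp_all add: d_def)
          then show ?thesis using N0 by (simp add: field_simps)
        qed
        finally show ?thesis .
      qed
      define g where "g s = f (y + s *\<^sub>R j) - s *\<^sub>R partial_deriv j f x" for s
      have "norm (g (h \<bullet> j) - g 0) \<le> e * norm (h \<bullet> j - 0)"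
      proof (rule differentiable_bound[where S = "closed_segment 0 (h \<bullet> j)" and f' = "\<lambda>s t. t *\<^sub>R (partial_deriv j f (y + s *\<^sub>R j) - partial_deriv j f x)"])
        fix s assume s: "s \<in> closed_segment 0 (h \<bullet> j)"
        then have abs: "\<bar>s\<bar> \<le> \<bar>h \<bullet> j\<bar>" by (auto simp: closed_segment_eq_real_ivl split: if_splits)
        have inW: "y + s *\<^sub>R j \<in> W" using near[OF abs] d2 by (auto simp: dist_commute subset_iff)
        have "(g has_vector_derivative partial_deriv j f (y + s *\<^sub>R j) - partial_deriv j f x) (at s)"
          unfolding g_def
          by (rule has_vector_derivative_diff[OF vd[OF inW j]]) (auto intro!: derivative_eq_intros)
        then show "(g has_derivative (\<lambda>t. t *\<^sub>R (partial_deriv j f (y + s *\<^sub>R j) - partial_deriv j f x))) (at s within closed_segment 0 (h \<bullet> j))"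
          by (simp add: has_vector_derivative_def has_derivative_at_withinI)
        have "norm (partial_deriv j f (y + s *\<^sub>R j) - partial_deriv j f x) < e"
          using near[OF abs] d3 by auto
        then show "onorm (\<lambda>t. t *\<^sub>R (partial_deriv j f (y + s *\<^sub>R j) - partial_deriv j f x)) \<le> e"
          by (intro onorm_le) (simp add: mult.commute[of e] mult_left_mono less_imp_le)
      qed auto
      note gbound = this
      have A: "norm (f (y + (h \<bullet> j) *\<^sub>R j) - f y - (h \<bullet> j) *\<^sub>R partial_deriv j f x) \<le> e * norm h"
      proof -
        have "norm (f (y + (h \<bullet> j) *\<^sub>R j) - f y - (h \<bullet> j) *\<^sub>R partial_deriv j f x) = norm (g (h \<bullet> j) - g 0)"
          by (simp add: g_def algebra_simps)
        also have "\<dots> \<le> e * \<bar>h \<bullet> j\<bar>"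
          using gbound by simp
        also have "\<dots> \<le> e * norm h"
          using Basis_le_norm[OF j, of h] \<open>e > 0\<close> by (intro mult_left_mono) auto
        finally show ?thesis .
      qed
      have B: "norm (f y - f x - (\<Sum>i\<in>S. (h \<bullet> i) *\<^sub>R partial_deriv i f x)) \<le> e * real (card S) * norm h"
        using d1(2)[of h] h by (simp add: d_def y_def)
      have "f (x + (\<Sum>i\<in>insert j S. (h \<bullet> i) *\<^sub>R i)) - f x - (\<Sum>i\<in>insert j S. (h \<bullet> i) *\<^sub>R partial_deriv i f x)
        = (f (y + (h \<bullet> j) *\<^sub>R j) - f y - (h \<bullet> j) *\<^sub>R partial_deriv j f x)
        + (f y - f x - (\<Sum>i\<in>S. (h \<bullet> i) *\<^sub>R partial_deriv i f x))"
        using insert.hyps by (simp add: y_def algebra_simps)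
      then show ?thesis
        using norm_triangle_le[OF add_mono[OF A B]] insert.hyps by (simp add: algebra_simps)
    qed
    then show ?case using dpos by blast
  qed
  show ?thesis
    unfolding has_derivative_at_alt
  proof (intro conjI allI impI)
    show "bounded_linear (\<lambda>h. \<Sum>i\<in>Basis. (h \<bullet> i) *\<^sub>R partial_deriv i f x)"
      by (intro bounded_linear_sum bounded_linear_compose[OF bounded_linear_scaleR_left] bounded_linear_inner_left)
    fix e :: real assume e: "e > 0"
    have "e / real (DIM('e)) > 0" using e by simp
    from key[OF subset_refl this] obtain d where d: "d > 0" "\<And>h. norm h < d \<Longrightarrow>
       norm (f (x + (\<Sum>i\<in>Basis. (h \<bullet> i) *\<^sub>R i)) - f x - (\<Sum>i\<in>Basis. (h \<bullet> i) *\<^sub>R partial_deriv i f x)) \<le> e / real (DIM('e)) * real (DIM('e)) * norm h"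
      by blast
    show "\<exists>d>0. \<forall>y. norm (y - x) < d \<longrightarrow> norm (f y - f x - (\<Sum>i\<in>Basis. ((y - x) \<bullet> i) *\<^sub>R partial_deriv i f x)) \<le> e * norm (y - x)"
    proof (intro exI[of _ d] conjI allI impI d(1))
      fix y assume "norm (y - x) < d"
      from d(2)[OF this] show "norm (f y - f x - (\<Sum>i\<in>Basis. ((y - x) \<bullet> i) *\<^sub>R partial_deriv i f x)) \<le> e * norm (y - x)"
        by (simp add: euclidean_representation)
    qed
  qed
qed

section \<open>Growth of nets on a set\<close>

lemma sup_bigoI:
  assumes "\<forall>\<^sub>F \<epsilon> in at_right 0. \<forall>p\<in>K. norm (u \<epsilon> p) \<le> C * \<epsilon> powr a"
  shows "sup_bigo K u a"
  using assms unfolding sup_bigo_def by blast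

lemma eventually_at_right_0_unit: "\<forall>\<^sub>F \<epsilon>::real in at_right 0. \<epsilon> \<in> {0<..<1}"
  by (rule eventually_at_right_real) simp

lemma sup_bigoE:
  assumes "sup_bigo K u a"
  obtains C where "C \<ge> 0" "\<forall>\<^sub>F \<epsilon> in at_right 0. \<forall>p\<in>K. norm (u \<epsilon> p) \<le> C * \<epsilon> powr a"
proof -
  from assms obtain C where C: "\<forall>\<^sub>F \<epsilon> in at_right 0. \<forall>p\<in>K. norm (u \<epsilon> p) \<le> C * \<epsilon> powr a"
    unfolding sup_bigo_def by blast
  have "\<forall>\<^sub>F \<epsilon> in at_right 0. \<forall>p\<in>K. norm (u \<epsilon> p) \<le> \<bar>C\<bar> * \<epsilon> powr a"
    using C by eventually_elim (meson abs_ge_self mult_right_mono order_trans powr_ge_zero)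
  then show ?thesis using that[of "\<bar>C\<bar>"] by simp
qed

lemma sup_bigo_subset: "sup_bigo K u a \<Longrightarrow> L \<subseteq> K \<Longrightarrow> sup_bigo L u a"
  unfolding sup_bigo_def by (blast intro: eventually_mono)

lemma sup_bigo_cong:
  assumes "sup_bigo K u a" "\<forall>\<^sub>F \<epsilon> in at_right 0. \<forall>p\<in>K. v \<epsilon> p = u \<epsilon> p"
  shows "sup_bigo K v a"
proof -
  from assms(1) obtain C where "\<forall>\<^sub>F \<epsilon> in at_right 0. \<forall>p\<in>K. norm (u \<epsilon> p) \<le> C * \<epsilon> powr a"
    unfolding sup_bigo_def by blast
  with assms(2) have "\<forall>\<^sub>F \<epsilon> in at_right 0. \<forall>p\<in>K. norm (v \<epsilon> p) \<le> C * \<epsilon> powr a"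
    by eventually_elim simp
  then show ?thesis by (rule sup_bigoI)
qed

lemma sup_bigo_antimono:
  assumes "sup_bigo K u a" "b \<le> a"
  shows "sup_bigo K u b"
proof -
  from assms(1) obtain C where C: "C \<ge> 0" "\<forall>\<^sub>F \<epsilon> in at_right 0. \<forall>p\<in>K. norm (u \<epsilon> p) \<le> C * \<epsilon> powr a"
    by (rule sup_bigoE)
  have "\<forall>\<^sub>F \<epsilon> in at_right 0. \<forall>p\<in>K. norm (u \<epsilon> p) \<le> C * \<epsilon> powr b"
    using C(2) eventually_at_right_0_unit
  proof eventually_elim
    case (elim \<epsilon>)
    have "\<epsilon> powr a \<le> \<epsilon> powr b" using elim(2) assms(2) by (intro powr_mono') auto
    then show ?case using elim(1) C(1) by (meson mult_left_mono order_trans)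
  qed
  then show ?thesis by (rule sup_bigoI)
qed

lemma sup_bigo_add:
  assumes "sup_bigo K u a" "sup_bigo K v a"
  shows "sup_bigo K (\<lambda>\<epsilon> p. u \<epsilon> p + v \<epsilon> p) a"
proof -
  from assms obtain C D where "\<forall>\<^sub>F \<epsilon> in at_right 0. \<forall>p\<in>K. norm (u \<epsilon> p) \<le> C * \<epsilon> powr a"
      "\<forall>\<^sub>F \<epsilon> in at_right 0. \<forall>p\<in>K. norm (v \<epsilon> p) \<le> D * \<epsilon> powr a"
    unfolding sup_bigo_def by blast
  then have "\<forall>\<^sub>F \<epsilon> in at_right 0. \<forall>p\<in>K. norm (u \<epsilon> p + v \<epsilon> p) \<le> (C + D) * \<epsilon> powr a"
    by eventually_elim (auto simp: algebra_simps intro!: norm_triangle_le add_mono)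
  then show ?thesis by (rule sup_bigoI)
qed

lemma sup_bigo_zero [simp]: "sup_bigo K (\<lambda>\<epsilon> p. 0) a"
  by (rule sup_bigoI[of _ _ 0]) simp

lemma sup_bigo_sum:
  assumes "finite I" "\<And>i. i \<in> I \<Longrightarrow> sup_bigo K (u i) a"
  shows "sup_bigo K (\<lambda>\<epsilon> p. \<Sum>i\<in>I. u i \<epsilon> p) a"
  using assms by (induction I rule: finite_induct) (auto intro: sup_bigo_add)

text \<open>
  The bound on \<^term>\<open>w\<close> is a hypothesis so that the lemma serves products of scalars, scalar
  multiples, and images under bounded linear maps alike.
\<close>

lemma sup_bigo_prod_bound:
  assumes "sup_bigo K u a" "sup_bigo K v b"
    and "\<And>\<epsilon> p. norm (w \<epsilon> p) \<le> norm (u \<epsilon> p) * norm (v \<epsilon> p)"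
  shows "sup_bigo K w (a + b)"
proof -
  from assms(1) obtain C where C: "C \<ge> 0" "\<forall>\<^sub>F \<epsilon> in at_right 0. \<forall>p\<in>K. norm (u \<epsilon> p) \<le> C * \<epsilon> powr a"
    by (rule sup_bigoE)
  from assms(2) obtain D where D: "D \<ge> 0" "\<forall>\<^sub>F \<epsilon> in at_right 0. \<forall>p\<in>K. norm (v \<epsilon> p) \<le> D * \<epsilon> powr b"
    by (rule sup_bigoE)
  have "\<forall>\<^sub>F \<epsilon> in at_right 0. \<forall>p\<in>K. norm (w \<epsilon> p) \<le> (C * D) * \<epsilon> powr (a + b)"
    using C(2) D(2)
  proof eventually_elim
    case (elim \<epsilon>)
    show ?case
    proof
      fix p assume p: "p \<in> K"
      have "norm (w \<epsilon> p) \<le> norm (u \<epsilon> p) * norm (v \<epsilon> p)" by (rule assms)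
      also have "\<dots> \<le> (C * \<epsilon> powr a) * (D * \<epsilon> powr b)"
        using elim p C D by (intro mult_mono) auto
      finally show "norm (w \<epsilon> p) \<le> (C * D) * \<epsilon> powr (a + b)" by (simp add: powr_add algebra_simps)
    qed
  qed
  then show ?thesis by (rule sup_bigoI)
qed

lemma sup_bigo_empty [simp]: "sup_bigo {} u a"
  by (simp add: sup_bigo_def)

lemma sup_bigo_const:
  assumes "a \<le> 0" "\<And>p. p \<in> K \<Longrightarrow> norm (f p) \<le> C"
  shows "sup_bigo K (\<lambda>\<epsilon>. f) a"
proof -
  have "\<forall>\<^sub>F \<epsilon>::real in at_right 0. \<forall>p\<in>K. norm (f p) \<le> \<bar>C\<bar> * \<epsilon> powr a"
    using eventually_at_right_0_unit
  proof eventually_elim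
    case (elim \<epsilon>)
    have "\<epsilon> powr 0 \<le> \<epsilon> powr a" using elim assms(1) by (intro powr_mono') auto
    then have one: "1 \<le> \<epsilon> powr a" using elim by simp
    have "norm (f p) \<le> \<bar>C\<bar> * \<epsilon> powr a" if "p \<in> K" for p
    proof -
      have "norm (f p) \<le> \<bar>C\<bar> * 1" using assms(2)[OF that] by simp
      also have "\<dots> \<le> \<bar>C\<bar> * \<epsilon> powr a" using one by (intro mult_left_mono) auto
      finally show ?thesis .
    qed
    then show ?case by blast
  qed
  then show ?thesis by (rule sup_bigoI)
qed

lemma sup_bigo_scaleR:
  assumes "sup_bigo K u a"
  shows "sup_bigo K (\<lambda>\<epsilon> p. c *\<^sub>R u \<epsilon> p) a"
proof -
  have "sup_bigo K (\<lambda>\<epsilon> p. c) 0" by (rule sup_bigo_const[of _ _ _ "norm c"]) auto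
  from sup_bigo_prod_bound[OF this assms, of "\<lambda>\<epsilon> p. c *\<^sub>R u \<epsilon> p"] show ?thesis by simp
qed

lemma sup_bigo_finite_Union:
  assumes "finite \<K>" "\<And>L. L \<in> \<K> \<Longrightarrow> sup_bigo L u a"
  shows "sup_bigo (\<Union>\<K>) u a"
proof -
  have "\<forall>L\<in>\<K>. \<exists>C. C \<ge> 0 \<and> (\<forall>\<^sub>F \<epsilon> in at_right 0. \<forall>p\<in>L. norm (u \<epsilon> p) \<le> C * \<epsilon> powr a)"
  proof
    fix L assume "L \<in> \<K>"
    then obtain C where "C \<ge> 0" "\<forall>\<^sub>F \<epsilon> in at_right 0. \<forall>p\<in>L. norm (u \<epsilon> p) \<le> C * \<epsilon> powr a"
      using sup_bigoE[OF assms(2)] by blast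
    then show "\<exists>C. C \<ge> 0 \<and> (\<forall>\<^sub>F \<epsilon> in at_right 0. \<forall>p\<in>L. norm (u \<epsilon> p) \<le> C * \<epsilon> powr a)" by blast
  qed
  from bchoice[OF this] obtain C where C: "\<And>L. L \<in> \<K> \<Longrightarrow> C L \<ge> 0"
      "\<And>L. L \<in> \<K> \<Longrightarrow> \<forall>\<^sub>F \<epsilon> in at_right 0. \<forall>p\<in>L. norm (u \<epsilon> p) \<le> C L * \<epsilon> powr a"
    by blast
  have "\<forall>\<^sub>F \<epsilon> in at_right 0. \<forall>L\<in>\<K>. \<forall>p\<in>L. norm (u \<epsilon> p) \<le> C L * \<epsilon> powr a"
    by (rule eventually_ball_finite[OF assms(1)]) (use C(2) in blast)
  then have "\<forall>\<^sub>F \<epsilon> in at_right 0. \<forall>p\<in>\<Union>\<K>. norm (u \<epsilon> p) \<le> (\<Sum>L\<in>\<K>. C L) * \<epsilon> powr a"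
  proof eventually_elim
    case (elim \<epsilon>)
    show ?case
    proof
      fix p assume "p \<in> \<Union>\<K>"
      then obtain L where L: "L \<in> \<K>" "p \<in> L" by blast
      have "C L \<le> (\<Sum>L\<in>\<K>. C L)" using assms(1) C(1) L(1) by (intro member_le_sum) auto
      then show "norm (u \<epsilon> p) \<le> (\<Sum>L\<in>\<K>. C L) * \<epsilon> powr a"
        using elim L by (meson mult_right_mono order_trans powr_ge_zero)
    qed
  qed
  then show ?thesis by (rule sup_bigoI)
qed

lemma sup_bigo_compact_local:
  assumes "compactin T K"
    and "\<And>x. x \<in> K \<Longrightarrow> \<exists>N. openin T N \<and> x \<in> N \<and> sup_bigo (K \<inter> N) u a"
  shows "sup_bigo K u a"
proof -
  from assms(2) obtain N where N: "\<And>x. x \<in> K \<Longrightarrow> openin T (N x) \<and> x \<in> N x \<and> sup_bigo (K \<inter> N x) u a"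
    by metis
  then have "\<forall>V\<in>N ` K. openin T V" "K \<subseteq> \<Union>(N ` K)" by auto
  then obtain \<F> where F: "finite \<F>" "\<F> \<subseteq> N ` K" "K \<subseteq> \<Union>\<F>"
    using assms(1)[unfolded compactin_def, THEN conjunct2, THEN spec[of _ "N ` K"]] by blast
  have "sup_bigo (\<Union>((\<lambda>V. K \<inter> V) ` \<F>)) u a"
    using F N by (intro sup_bigo_finite_Union) auto
  then show ?thesis by (rule sup_bigo_subset) (use F in auto)
qed

text \<open>
  The exponents may differ from point to point; the least one of a finite subcover works everywhere.
\<close>

lemma sup_bigo_compact_local_exponent:
  assumes K: "compactin T K"
    and "\<And>x. x \<in> K \<Longrightarrow> \<exists>N a. openin T N \<and> x \<in> N \<and> sup_bigo (K \<inter> N) u a"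
  shows "\<exists>n::nat. sup_bigo K u (- real n)"
proof -
  have "\<forall>x\<in>K. \<exists>N. \<exists>a. openin T N \<and> x \<in> N \<and> sup_bigo (K \<inter> N) u a" using assms(2) by simp
  from bchoice[OF this] obtain N where "\<forall>x\<in>K. \<exists>a. openin T (N x) \<and> x \<in> N x \<and> sup_bigo (K \<inter> N x) u a" ..
  from bchoice[OF this] obtain a where
    N: "\<forall>x\<in>K. openin T (N x) \<and> x \<in> N x \<and> sup_bigo (K \<inter> N x) u (a x)" ..
  then have "\<forall>V\<in>N ` K. openin T V" "K \<subseteq> \<Union>(N ` K)" by auto
  then obtain \<F> where F: "finite \<F>" "\<F> \<subseteq> N ` K" "K \<subseteq> \<Union>\<F>"
    using K[unfolded compactin_def, THEN conjunct2, THEN spec[of _ "N ` K"]] by blast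
  obtain P where P: "finite P" "P \<subseteq> K" "\<F> = N ` P"
    using finite_subset_image[OF F(1,2)] by blast
  define b where "b = Min (insert 0 (a ` P))"
  have "sup_bigo (\<Union>((\<lambda>x. K \<inter> N x) ` P)) u b"
  proof (rule sup_bigo_finite_Union)
    fix L assume "L \<in> (\<lambda>x. K \<inter> N x) ` P"
    then obtain x where x: "x \<in> P" "L = K \<inter> N x" by blast
    have "b \<le> a x" using P(1) x(1) by (simp add: b_def)
    then show "sup_bigo L u b" using N x P(2) by (auto intro: sup_bigo_antimono)
  qed (use P in auto)
  then have "sup_bigo K u b" by (rule sup_bigo_subset) (use F P in auto)
  moreover have "- real (nat \<lceil>- b\<rceil>) \<le> b" by linarith
  ultimately have "sup_bigo K u (- real (nat \<lceil>- b\<rceil>))" by (rule sup_bigo_antimono)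
  then show ?thesis ..
qed

section \<open>Iterated partial derivatives depend only on local values\<close>

lemma partials_Nil [simp]: "partials [] f = f"
  by (simp add: partials_def)

lemma partials_Cons [simp]: "partials (b # bs) f = partial_deriv b (partials bs f)"
  by (simp add: partials_def)

lemma partials_append: "partials (bs @ cs) f = partials bs (partials cs f)"
  by (simp add: partials_def)

text \<open>
  Lines in a direction of \<^term>\<open>B\<close> stay in \<^term>\<open>span B\<close>, so relative openness suffices for differentiating
  along them, also in dimension zero.
\<close>

lemma eventually_line_in_open:
  fixes x b :: "'e::euclidean_space"
  assumes W: "openin (top_of_set (span B)) W" and x: "x \<in> W" and b: "b \<in> B"
  shows "\<forall>\<^sub>F t::real in nhds 0. x + t *\<^sub>R b \<in> W"
proof -
  from W obtain O' where O': "open O'" "W = span B \<inter> O'" by (auto simp: openin_open)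
  have "open ((\<lambda>t::real. x + t *\<^sub>R b) -` O')"
    by (intro open_vimage O'(1) continuous_intros)
  moreover have "0 \<in> (\<lambda>t::real. x + t *\<^sub>R b) -` O'" using O' x by simp
  ultimately have "\<forall>\<^sub>F t::real in nhds 0. x + t *\<^sub>R b \<in> O'"
    using eventually_nhds_in_open by fastforce
  moreover have "x + t *\<^sub>R b \<in> span B" for t
    using x O' b by (auto intro: span_add span_mul span_base)
  ultimately show ?thesis using O' by (auto elim: eventually_mono)
qed

lemma partial_deriv_cong:
  assumes W: "openin (top_of_set (span B)) W" and x: "x \<in> W" and b: "b \<in> B"
    and eq: "\<And>y. y \<in> W \<Longrightarrow> f y = g y"
  shows "partial_deriv b f x = partial_deriv b g x"
  unfolding partial_deriv_def
proof (rule vector_derivative_cong_eq)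
  show "\<forall>\<^sub>F t in nhds (0::real). t \<in> UNIV \<longrightarrow> f (x + t *\<^sub>R b) = g (x + t *\<^sub>R b)"
    using eventually_line_in_open[OF W x b] by eventually_elim (use eq in auto)
qed (use x eq in auto)

lemma line_differentiable_cong:
  fixes f g :: "'e::euclidean_space \<Rightarrow> 'b::real_normed_vector"
  assumes W: "openin (top_of_set (span B)) W" and x: "x \<in> W" and b: "b \<in> B"
    and eq: "\<And>y. y \<in> W \<Longrightarrow> f y = g y"
    and d: "(\<lambda>t::real. f (x + t *\<^sub>R b)) differentiable (at 0)"
  shows "(\<lambda>t::real. g (x + t *\<^sub>R b)) differentiable (at 0)"
proof -
  from d obtain D where D: "((\<lambda>t::real. f (x + t *\<^sub>R b)) has_derivative D) (at 0)"
    by (auto simp: differentiable_def)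
  have ev: "\<forall>\<^sub>F t in nhds (0::real). f (x + t *\<^sub>R b) = g (x + t *\<^sub>R b)"
    using eventually_line_in_open[OF W x b] by eventually_elim (use eq in auto)
  have "((\<lambda>t::real. g (x + t *\<^sub>R b)) has_derivative D) (at 0)"
    by (rule has_derivative_transform_eventually[OF D])
       (use ev x eq in \<open>auto simp: eventually_at_filter elim: eventually_mono\<close>)
  then show ?thesis by (auto simp: differentiable_def)
qed

lemma partials_cong:
  assumes W: "openin (top_of_set (span B)) W"
    and bs: "set bs \<subseteq> B" and eq: "\<And>y. y \<in> W \<Longrightarrow> f y = g y" and x: "x \<in> W"
  shows "partials bs f x = partials bs g x"
  using bs x
proof (induction bs arbitrary: x)
  case (Cons b bs)
  then show ?case by (auto intro!: partial_deriv_cong[OF W])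
qed (use eq in auto)


section \<open>Nets with a common growth exponent for all derivatives\<close>

text \<open>
  The partial derivatives up to order \<open>k\<close> are continuous on \<^term>\<open>W\<close> and differentiable along the directions
  in \<^term>\<open>B\<close>, and on \<^term>\<open>K\<close> they grow at most like $\varepsilon^{a'}$ for every $a'<a$, with one \<^term>\<open>a\<close> for all these orders.  The strict
  inequality lets logarithmic growth count as exponent $0$.  Growth is
  required on a single set \<^term>\<open>K\<close> because the exponent of a regular net depends on the compact set; for
  empty \<^term>\<open>K\<close> only differentiability remains, and facts on smooth functions are special cases.
  The order is bounded by \<open>k\<close> because the proofs for composition and reciprocals are inductions in
  which a lower order derivative of the whole expression reappears inside a product.
\<close>

definition tame_upto ::
  "'e::euclidean_space set \<Rightarrow> 'e set \<Rightarrow> 'e set \<Rightarrow> real \<Rightarrow> nat \<Rightarrow> (real \<Rightarrow> 'e \<Rightarrow> 'b::real_normed_vector) \<Rightarrow> bool" where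
  "tame_upto B W K a k g \<longleftrightarrow>
     (\<forall>bs. set bs \<subseteq> B \<and> length bs \<le> k \<longrightarrow>
        (\<forall>\<epsilon>\<in>{0<..<1}. continuous_on W (partials bs (g \<epsilon>)) \<and>
           (\<forall>b\<in>B. \<forall>x\<in>W. (\<lambda>t::real. partials bs (g \<epsilon>) (x + t *\<^sub>R b)) differentiable (at 0))) \<and>
        (\<forall>a'<a. sup_bigo K (\<lambda>\<epsilon>. partials bs (g \<epsilon>)) a'))"

definition tame ::
  "'e::euclidean_space set \<Rightarrow> 'e set \<Rightarrow> 'e set \<Rightarrow> real \<Rightarrow> (real \<Rightarrow> 'e \<Rightarrow> 'b::real_normed_vector) \<Rightarrow> bool" where
  "tame B W K a g \<longleftrightarrow> (\<forall>k. tame_upto B W K a k g)"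

lemma tame_upto_0:
  "tame_upto B W K a 0 g \<longleftrightarrow>
     (\<forall>\<epsilon>\<in>{0<..<1}. continuous_on W (g \<epsilon>) \<and>
        (\<forall>b\<in>B. \<forall>x\<in>W. (\<lambda>t::real. g \<epsilon> (x + t *\<^sub>R b)) differentiable (at 0))) \<and>
     (\<forall>a'<a. sup_bigo K g a')"
  by (auto simp: tame_upto_def)

lemma tame_continuous_on: "tame B W K a g \<Longrightarrow> \<epsilon> \<in> {0<..<1} \<Longrightarrow> continuous_on W (g \<epsilon>)"
  unfolding tame_def by (drule spec[of _ 0]) (auto simp: tame_upto_0)

lemma tame_line_differentiable:
  "tame B W K a g \<Longrightarrow> \<epsilon> \<in> {0<..<1} \<Longrightarrow> b \<in> B \<Longrightarrow> x \<in> W \<Longrightarrow>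
    (\<lambda>t::real. g \<epsilon> (x + t *\<^sub>R b)) differentiable (at 0)"
  unfolding tame_def by (drule spec[of _ 0]) (auto simp: tame_upto_0)

lemma tame_sup_bigo: "tame B W K a g \<Longrightarrow> a' < a \<Longrightarrow> sup_bigo K g a'"
  unfolding tame_def by (drule spec[of _ 0]) (auto simp: tame_upto_0)

lemma tame_upto_mono: "tame_upto B W K a k g \<Longrightarrow> j \<le> k \<Longrightarrow> tame_upto B W K a j g"
  unfolding tame_upto_def by (meson order_trans)

text \<open>
  Peeling off the innermost derivative, rather than the outermost one, is what makes induction on
  the order work: the differentiation rules apply to it, and the remaining derivatives act on
  expressions of the same kind.
\<close>

lemma tame_upto_Suc:
  "tame_upto B W K a (Suc k) g \<longleftrightarrow>
     tame_upto B W K a 0 g \<and> (\<forall>b\<in>B. tame_upto B W K a k (\<lambda>\<epsilon>. partial_deriv b (g \<epsilon>)))"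
proof -
  define Q where "Q h \<longleftrightarrow> (\<forall>\<epsilon>\<in>{0<..<1}. continuous_on W (h \<epsilon>) \<and>
      (\<forall>b\<in>B. \<forall>x\<in>W. (\<lambda>t::real. h \<epsilon> (x + t *\<^sub>R b)) differentiable (at 0))) \<and> (\<forall>a'<a. sup_bigo K h a')"
    for h :: "real \<Rightarrow> 'a \<Rightarrow> 'b"
  have iff: "tame_upto B W K a m h \<longleftrightarrow> (\<forall>bs. set bs \<subseteq> B \<and> length bs \<le> m \<longrightarrow> Q (\<lambda>\<epsilon>. partials bs (h \<epsilon>)))" for m h
    unfolding tame_upto_def Q_def ..
  show ?thesis
    unfolding iff
  proof (intro iffI conjI ballI allI impI)
    fix b bs
    assume all: "\<forall>bs. set bs \<subseteq> B \<and> length bs \<le> Suc k \<longrightarrow> Q (\<lambda>\<epsilon>. partials bs (g \<epsilon>))"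
      and "b \<in> B" "set bs \<subseteq> B \<and> length bs \<le> k"
    then show "Q (\<lambda>\<epsilon>. partials bs (partial_deriv b (g \<epsilon>)))"
      using all[rule_format, of "bs @ [b]"] by (simp add: partials_append)
  next
    fix bs
    assume R: "(\<forall>bs. set bs \<subseteq> B \<and> length bs \<le> 0 \<longrightarrow> Q (\<lambda>\<epsilon>. partials bs (g \<epsilon>))) \<and>
        (\<forall>b\<in>B. \<forall>bs. set bs \<subseteq> B \<and> length bs \<le> k \<longrightarrow> Q (\<lambda>\<epsilon>. partials bs (partial_deriv b (g \<epsilon>))))"
      and bs: "set bs \<subseteq> B \<and> length bs \<le> Suc k"
    show "Q (\<lambda>\<epsilon>. partials bs (g \<epsilon>))"
    proof (cases bs rule: rev_cases)
      case Nil
      then show ?thesis using R bs by simp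
    next
      case (snoc cs b)
      then show ?thesis using R bs by (simp add: partials_append)
    qed
  qed (drule spec[of _ "[]"], simp)
qed

lemma tame_deriv: "tame B W K a g \<Longrightarrow> b \<in> B \<Longrightarrow> tame B W K a (\<lambda>\<epsilon>. partial_deriv b (g \<epsilon>))"
  unfolding tame_def using tame_upto_Suc by blast

lemma tame_upto_cong:
  assumes W: "openin (top_of_set (span B)) W" and K: "K \<subseteq> W"
    and eq: "\<And>\<epsilon> x. \<epsilon> \<in> {0<..<1} \<Longrightarrow> x \<in> W \<Longrightarrow> g \<epsilon> x = h \<epsilon> x"
    and g: "tame_upto B W K a k g"
  shows "tame_upto B W K a k h"
  unfolding tame_upto_def
proof (intro allI impI conjI ballI)
  fix bs assume bs: "set bs \<subseteq> B \<and> length bs \<le> k"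
  have peq: "partials bs (g \<epsilon>) x = partials bs (h \<epsilon>) x" if "\<epsilon> \<in> {0<..<1}" "x \<in> W" for \<epsilon> x
    using partials_cong[OF W, of bs "g \<epsilon>" "h \<epsilon>" x] bs eq that by blast
  { fix \<epsilon> :: real assume e: "\<epsilon> \<in> {0<..<1}"
    have "continuous_on W (partials bs (g \<epsilon>))" using g bs e unfolding tame_upto_def by blast
    then show "continuous_on W (partials bs (h \<epsilon>))"
      using peq[OF e] by (simp cong: continuous_on_cong)
    fix b x assume bx: "b \<in> B" "x \<in> W"
    have "(\<lambda>t::real. partials bs (g \<epsilon>) (x + t *\<^sub>R b)) differentiable (at 0)"
      using g bs e bx unfolding tame_upto_def by blast
    then show "(\<lambda>t::real. partials bs (h \<epsilon>) (x + t *\<^sub>R b)) differentiable (at 0)"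
      by (rule line_differentiable_cong[OF W bx(2,1), rotated]) (rule peq[OF e]) }
  fix a' :: real assume "a' < a"
  then have "sup_bigo K (\<lambda>\<epsilon>. partials bs (g \<epsilon>)) a'" using g bs unfolding tame_upto_def by blast
  then show "sup_bigo K (\<lambda>\<epsilon>. partials bs (h \<epsilon>)) a'"
    by (rule sup_bigo_cong)
       (use eventually_at_right_0_unit in \<open>rule eventually_mono\<close>, use peq K in auto)
qed

lemma tame_cong:
  assumes "openin (top_of_set (span B)) W" "K \<subseteq> W"
    and "\<And>\<epsilon> x. \<epsilon> \<in> {0<..<1} \<Longrightarrow> x \<in> W \<Longrightarrow> g \<epsilon> x = h \<epsilon> x"
    and "tame B W K a g"
  shows "tame B W K a h"
  unfolding tame_def
proof
  fix k
  show "tame_upto B W K a k h"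
    by (rule tame_upto_cong[OF assms(1,2), where g = g]) (use assms(3,4) in \<open>auto simp: tame_def\<close>)
qed

lemma tame_upto_subset:
  "tame_upto B W K a k g \<Longrightarrow> B' \<subseteq> B \<Longrightarrow> W' \<subseteq> W \<Longrightarrow> K' \<subseteq> K \<Longrightarrow> tame_upto B' W' K' a k g"
  unfolding tame_upto_def
  by (blast intro: continuous_on_subset sup_bigo_subset)

lemma tame_subset:
  "tame B W K a g \<Longrightarrow> B' \<subseteq> B \<Longrightarrow> W' \<subseteq> W \<Longrightarrow> K' \<subseteq> K \<Longrightarrow> tame B' W' K' a g"
  unfolding tame_def by (blast intro: tame_upto_subset)

lemma partial_deriv_eqI:
  "((\<lambda>t::real. f (x + t *\<^sub>R b)) has_vector_derivative D) (at 0) \<Longrightarrow> partial_deriv b f x = D"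
  unfolding partial_deriv_def by (rule vector_derivative_at)

lemma line_has_vector_derivative:
  "(\<lambda>t::real. f (x + t *\<^sub>R b)) differentiable (at 0) \<Longrightarrow>
    ((\<lambda>t::real. f (x + t *\<^sub>R b)) has_vector_derivative partial_deriv b f x) (at 0)"
  by (simp add: partial_deriv_def vector_derivative_works)

lemma tame_upto_bounded_linear:
  fixes g :: "real \<Rightarrow> 'e::euclidean_space \<Rightarrow> 'b::real_normed_vector"
    and L :: "'b \<Rightarrow> 'c::real_normed_vector"
  assumes L: "bounded_linear L" and W: "openin (top_of_set (span B)) W" and K: "K \<subseteq> W"
    and "tame_upto B W K a k g"
  shows "tame_upto B W K a k (\<lambda>\<epsilon> x. L (g \<epsilon> x))"
  using assms(4)
proof (induction k arbitrary: g)
  case 0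
  from L obtain C where C: "\<And>x. norm (L x) \<le> norm x * C" by (meson bounded_linear.bounded)
  have "sup_bigo K (\<lambda>\<epsilon> x. L (g \<epsilon> x)) a'" if "a' < a" for a'
  proof -
    from 0 that have "sup_bigo K g a'" by (simp add: tame_upto_0)
    moreover have "sup_bigo K (\<lambda>\<epsilon> x. C) 0"
      by (rule sup_bigoI[of _ _ "norm C"]) (use eventually_at_right_0_unit in \<open>rule eventually_mono\<close>, auto)
    moreover have "norm (L (g \<epsilon> p)) \<le> norm (g \<epsilon> p) * norm C" for \<epsilon> p
      using C[of "g \<epsilon> p"] by (rule order_trans) (auto intro: mult_left_mono)
    ultimately show ?thesis using sup_bigo_prod_bound[of K g a' "\<lambda>\<epsilon> x. C" 0 "\<lambda>\<epsilon> x. L (g \<epsilon> x)"] by simp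
  qed
  moreover have "(\<lambda>t. L (g \<epsilon> (x + t *\<^sub>R b))) differentiable at 0"
    if "\<epsilon> \<in> {0<..<1}" "b \<in> B" "x \<in> W" for \<epsilon> b x
    using bounded_linear.has_vector_derivative[OF L line_has_vector_derivative[of "g \<epsilon>" x b]] 0 that
    by (auto simp: tame_upto_0 intro: differentiableI_vector)
  moreover have "continuous_on W (\<lambda>x. L (g \<epsilon> x))" if "\<epsilon> \<in> {0<..<1}" for \<epsilon>
    by (rule bounded_linear.continuous_on[OF L]) (use 0 that in \<open>auto simp: tame_upto_0\<close>)
  ultimately show ?case by (simp add: tame_upto_0)
next
  case (Suc k)
  have "tame_upto B W K a k (\<lambda>\<epsilon>. partial_deriv b (\<lambda>x. L (g \<epsilon> x)))" if b: "b \<in> B" for b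
  proof (rule tame_upto_cong[OF W K])
    show "tame_upto B W K a k (\<lambda>\<epsilon> x. L (partial_deriv b (g \<epsilon>) x))"
      using Suc b by (auto simp: tame_upto_Suc)
    fix \<epsilon> :: real and x assume "\<epsilon> \<in> {0<..<1}" "x \<in> W"
    then show "L (partial_deriv b (g \<epsilon>) x) = partial_deriv b (\<lambda>x. L (g \<epsilon> x)) x"
      using Suc.prems b
      by (intro partial_deriv_eqI[symmetric] bounded_linear.has_vector_derivative[OF L] line_has_vector_derivative)
         (auto simp: tame_upto_Suc[of B W K a k g] tame_upto_0)
  qed
  moreover have "tame_upto B W K a 0 (\<lambda>\<epsilon> x. L (g \<epsilon> x))"
    using Suc.IH[of g] tame_upto_mono[OF Suc.prems, of k] tame_upto_mono[of B W K a k _ 0] by simp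
  ultimately show ?case by (simp add: tame_upto_Suc)
qed

lemma tame_upto_add:
  fixes g h :: "real \<Rightarrow> 'e::euclidean_space \<Rightarrow> 'b::real_normed_vector"
  assumes W: "openin (top_of_set (span B)) W" and K: "K \<subseteq> W"
    and "tame_upto B W K a k g" "tame_upto B W K a k h"
  shows "tame_upto B W K a k (\<lambda>\<epsilon> x. g \<epsilon> x + h \<epsilon> x)"
  using assms(3,4)
proof (induction k arbitrary: g h)
  case 0
  then show ?case by (auto simp: tame_upto_0 intro: continuous_intros sup_bigo_add differentiable_add)
next
  case (Suc k)
  have "tame_upto B W K a k (\<lambda>\<epsilon>. partial_deriv b (\<lambda>x. g \<epsilon> x + h \<epsilon> x))" if b: "b \<in> B" for b
  proof (rule tame_upto_cong[OF W K])
    show "tame_upto B W K a k (\<lambda>\<epsilon> x. partial_deriv b (g \<epsilon>) x + partial_deriv b (h \<epsilon>) x)"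
      using Suc b by (auto simp: tame_upto_Suc)
    fix \<epsilon> :: real and x assume "\<epsilon> \<in> {0<..<1}" "x \<in> W"
    then show "partial_deriv b (g \<epsilon>) x + partial_deriv b (h \<epsilon>) x = partial_deriv b (\<lambda>x. g \<epsilon> x + h \<epsilon> x) x"
      using Suc.prems b
      by (intro partial_deriv_eqI[symmetric] has_vector_derivative_add line_has_vector_derivative)
         (auto simp: tame_upto_Suc[of B W K a k] tame_upto_0)
  qed
  moreover have "tame_upto B W K a 0 (\<lambda>\<epsilon> x. g \<epsilon> x + h \<epsilon> x)"
    using Suc.IH[of g h] tame_upto_mono[OF Suc.prems(1), of k] tame_upto_mono[OF Suc.prems(2), of k]
      tame_upto_mono[of B W K a k _ 0] by simp
  ultimately show ?case by (simp add: tame_upto_Suc)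
qed

lemma tame_upto_zero:
  fixes B :: "'e::euclidean_space set"
  shows "tame_upto B W K a k (\<lambda>\<epsilon> x. 0 :: 'b::real_normed_vector)"
proof (induction k)
  case (Suc k)
  have "partial_deriv b (\<lambda>x. 0 :: 'b) = (\<lambda>x. 0)" for b :: 'e
    by (auto simp: partial_deriv_def)
  with Suc show ?case by (simp add: tame_upto_Suc tame_upto_0)
qed (simp add: tame_upto_0)

lemma tame_upto_sum:
  assumes "openin (top_of_set (span B)) W" "K \<subseteq> W"
    and "finite I" "\<And>i. i \<in> I \<Longrightarrow> tame_upto B W K a k (g i)"
  shows "tame_upto B W K a k (\<lambda>\<epsilon> x. \<Sum>i\<in>I. g i \<epsilon> x)"
  using assms(3,4)
  by (induction I rule: finite_induct) (auto intro: tame_upto_zero tame_upto_add[OF assms(1,2)])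

lemma tame_upto_scaleR:
  fixes f :: "real \<Rightarrow> 'e::euclidean_space \<Rightarrow> real" and g :: "real \<Rightarrow> 'e \<Rightarrow> 'b::real_normed_vector"
  assumes W: "openin (top_of_set (span B)) W" and K: "K \<subseteq> W"
    and "tame_upto B W K a k f" "tame_upto B W K c k g"
  shows "tame_upto B W K (a + c) k (\<lambda>\<epsilon> x. f \<epsilon> x *\<^sub>R g \<epsilon> x)"
  using assms(3,4)
proof (induction k arbitrary: f g)
  case 0
  have "sup_bigo K (\<lambda>\<epsilon> x. f \<epsilon> x *\<^sub>R g \<epsilon> x) a'" if "a' < a + c" for a'
  proof -
    define d where "d = (a + c - a') / 2"
    have "d > 0" using that by (simp add: d_def)
    then have "sup_bigo K f (a - d)" "sup_bigo K g (c - d)" using 0 by (auto simp: tame_upto_0)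
    then have "sup_bigo K (\<lambda>\<epsilon> x. f \<epsilon> x *\<^sub>R g \<epsilon> x) (a - d + (c - d))"
      by (rule sup_bigo_prod_bound) simp
    moreover have "a - d + (c - d) = a'" by (simp add: d_def field_simps)
    ultimately show ?thesis by simp
  qed
  moreover have "(\<lambda>t. f \<epsilon> (x + t *\<^sub>R b) *\<^sub>R g \<epsilon> (x + t *\<^sub>R b)) differentiable at 0"
    if "\<epsilon> \<in> {0<..<1}" "b \<in> B" "x \<in> W" for \<epsilon> b x
    using 0 that by (auto simp: tame_upto_0 intro!: differentiable_scaleR)
  ultimately show ?case using 0 by (auto simp: tame_upto_0 intro: continuous_intros)
next
  case (Suc k)
  have "tame_upto B W K (a + c) k (\<lambda>\<epsilon>. partial_deriv b (\<lambda>x. f \<epsilon> x *\<^sub>R g \<epsilon> x))" if b: "b \<in> B" for b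
  proof (rule tame_upto_cong[OF W K])
    have "tame_upto B W K a k f" "tame_upto B W K c k g" using Suc.prems by (auto intro: tame_upto_mono)
    moreover have "tame_upto B W K a k (\<lambda>\<epsilon>. partial_deriv b (f \<epsilon>))" "tame_upto B W K c k (\<lambda>\<epsilon>. partial_deriv b (g \<epsilon>))"
      using Suc.prems b by (auto simp: tame_upto_Suc)
    ultimately show "tame_upto B W K (a + c) k
        (\<lambda>\<epsilon> x. f \<epsilon> x *\<^sub>R partial_deriv b (g \<epsilon>) x + partial_deriv b (f \<epsilon>) x *\<^sub>R g \<epsilon> x)"
      by (intro tame_upto_add[OF W K] Suc.IH)
    fix \<epsilon> :: real and x assume ex: "\<epsilon> \<in> {0<..<1}" "x \<in> W"
    have "((\<lambda>t. f \<epsilon> (x + t *\<^sub>R b)) has_field_derivative partial_deriv b (f \<epsilon>) x) (at 0)"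
      using line_has_vector_derivative[of "f \<epsilon>" x b] Suc.prems(1) b ex
      by (auto simp: tame_upto_Suc tame_upto_0 has_real_derivative_iff_has_vector_derivative)
    moreover have "((\<lambda>t. g \<epsilon> (x + t *\<^sub>R b)) has_vector_derivative partial_deriv b (g \<epsilon>) x) (at 0)"
      using line_has_vector_derivative[of "g \<epsilon>" x b] Suc.prems(2) b ex
      by (auto simp: tame_upto_Suc tame_upto_0)
    ultimately show "f \<epsilon> x *\<^sub>R partial_deriv b (g \<epsilon>) x + partial_deriv b (f \<epsilon>) x *\<^sub>R g \<epsilon> x
        = partial_deriv b (\<lambda>x. f \<epsilon> x *\<^sub>R g \<epsilon> x) x"
      using has_vector_derivative_scaleR by (intro partial_deriv_eqI[symmetric]) fastforce
  qed
  moreover have "tame_upto B W K (a + c) 0 (\<lambda>\<epsilon> x. f \<epsilon> x *\<^sub>R g \<epsilon> x)"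
    using Suc.IH[of f g] tame_upto_mono[OF Suc.prems(1), of k] tame_upto_mono[OF Suc.prems(2), of k]
      tame_upto_mono[of B W K "a+c" k _ 0] by simp
  ultimately show ?case by (simp add: tame_upto_Suc)
qed

lemma tame_add:
  "openin (top_of_set (span B)) W \<Longrightarrow> K \<subseteq> W \<Longrightarrow> tame B W K a g \<Longrightarrow> tame B W K a h \<Longrightarrow>
    tame B W K a (\<lambda>\<epsilon> x. g \<epsilon> x + h \<epsilon> x)"
  unfolding tame_def by (blast intro: tame_upto_add)

lemma tame_scaleR:
  "openin (top_of_set (span B)) W \<Longrightarrow> K \<subseteq> W \<Longrightarrow> tame B W K a f \<Longrightarrow> tame B W K c g \<Longrightarrow>
    tame B W K (a + c) (\<lambda>\<epsilon> x. f \<epsilon> x *\<^sub>R g \<epsilon> x)"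
  unfolding tame_def by (blast intro: tame_upto_scaleR)

lemma partial_deriv_compose:
  fixes T :: "'e::euclidean_space \<Rightarrow> 'f::euclidean_space" and g :: "'f \<Rightarrow> 'b::real_normed_vector"
  assumes V: "open V" "T x \<in> V"
    and T: "(\<lambda>t::real. T (x + t *\<^sub>R b)) differentiable (at 0)"
    and diff: "\<And>y i. y \<in> V \<Longrightarrow> i \<in> Basis \<Longrightarrow> (\<lambda>t::real. g (y + t *\<^sub>R i)) differentiable (at 0)"
    and cont: "\<And>i. i \<in> Basis \<Longrightarrow> continuous_on V (partial_deriv i g)"
  shows "((\<lambda>t::real. g (T (x + t *\<^sub>R b))) has_vector_derivative
      (\<Sum>i\<in>Basis. (partial_deriv b T x \<bullet> i) *\<^sub>R partial_deriv i g (T x))) (at 0)"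
proof -
  have "((\<lambda>t. T (x + t *\<^sub>R b)) has_derivative (\<lambda>t. t *\<^sub>R partial_deriv b T x)) (at 0)"
    using line_has_vector_derivative[OF T] by (simp add: has_vector_derivative_def)
  moreover have "(g has_derivative (\<lambda>h. \<Sum>i\<in>Basis. (h \<bullet> i) *\<^sub>R partial_deriv i g (T x))) (at (T (x + 0 *\<^sub>R b)))"
    using has_derivative_partials_euclidean[OF V diff cont] by simp
  ultimately have "((\<lambda>t. g (T (x + t *\<^sub>R b))) has_derivative
      (\<lambda>t. \<Sum>i\<in>Basis. ((t *\<^sub>R partial_deriv b T x) \<bullet> i) *\<^sub>R partial_deriv i g (T x))) (at 0)"
    by (rule has_derivative_compose)
  then show ?thesis by (simp add: has_vector_derivative_def scaleR_sum_right)
qed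

text \<open>
  By the chain rule a derivative of the composite is a sum of products of a component of a
  derivative of \<^term>\<open>T\<close> with a derivative of the net composed with \<^term>\<open>T\<close>; the latter is tame of one order
  less by induction.  The sum runs over all coordinate directions of the target, so either these are
  the directions of \<^term>\<open>B'\<close>, or there is nothing to differentiate because \<^term>\<open>B\<close> is empty.
\<close>

lemma tame_compose:
  fixes T :: "'e::euclidean_space \<Rightarrow> 'f::euclidean_space" and g :: "real \<Rightarrow> 'f \<Rightarrow> 'b::real_normed_vector"
  assumes dirs: "B = {} \<or> B' = Basis"
    and W: "openin (top_of_set (span B)) W" and K: "K \<subseteq> W"
    and V: "openin (top_of_set (span B')) V" and TW: "T ` W \<subseteq> V"
    and T: "tame B W K 0 (\<lambda>\<epsilon>. T)" and g: "tame B' V (T ` K) a g"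
  shows "tame B W K a (\<lambda>\<epsilon> x. g \<epsilon> (T x))"
proof -
  have chain: "((\<lambda>t::real. g \<epsilon> (T (x + t *\<^sub>R b))) has_vector_derivative
      (\<Sum>i\<in>Basis. (partial_deriv b T x \<bullet> i) *\<^sub>R partial_deriv i (g \<epsilon>) (T x))) (at 0)"
    if "b \<in> B" "\<epsilon> \<in> {0<..<1}" "x \<in> W" and g: "tame B' V (T ` K) a g"
    for b \<epsilon> x and g :: "real \<Rightarrow> 'f \<Rightarrow> 'b"
  proof (rule partial_deriv_compose)
    have B': "B' = Basis" using dirs that by auto
    show "open V" using V B' by (simp add: openin_open_eq)
    show "T x \<in> V" using TW that by auto
    show "(\<lambda>t. T (x + t *\<^sub>R b)) differentiable at 0"
      using tame_line_differentiable[OF T] that by blast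
    show "(\<lambda>t. g \<epsilon> (y + t *\<^sub>R i)) differentiable at 0" if "y \<in> V" "i \<in> Basis" for y i
      using tame_line_differentiable[OF g] \<open>\<epsilon> \<in> _\<close> that B' by blast
    show "continuous_on V (partial_deriv i (g \<epsilon>))" if "i \<in> Basis" for i
      using tame_continuous_on[OF tame_deriv[OF g]] that B' \<open>\<epsilon> \<in> _\<close> by blast
  qed
  have base: "tame_upto B W K a 0 (\<lambda>\<epsilon> x. g \<epsilon> (T x))" if g: "tame B' V (T ` K) a g"
    for g :: "real \<Rightarrow> 'f \<Rightarrow> 'b"
    unfolding tame_upto_0
  proof (intro conjI ballI allI impI)
    fix \<epsilon> :: real assume e: "\<epsilon> \<in> {0<..<1}"
    show "continuous_on W (\<lambda>x. g \<epsilon> (T x))"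
      by (rule continuous_on_compose2[OF tame_continuous_on[OF g e] tame_continuous_on[OF T e] TW])
    fix b x assume "b \<in> B" "x \<in> W"
    then show "(\<lambda>t::real. g \<epsilon> (T (x + t *\<^sub>R b))) differentiable (at 0)"
      by (rule differentiableI_vector[OF chain[OF _ e _ g]])
  next
    fix a' assume "a' < a"
    with g have "sup_bigo (T ` K) g a'" by (rule tame_sup_bigo)
    then show "sup_bigo K (\<lambda>\<epsilon> x. g \<epsilon> (T x)) a'" by (simp add: sup_bigo_def)
  qed
  have "tame_upto B W K a k (\<lambda>\<epsilon> x. g \<epsilon> (T x))" for k
    using g
  proof (induction k arbitrary: g)
    case 0
    then show ?case by (rule base)
  next
    case (Suc k)
    have "tame_upto B W K a k (\<lambda>\<epsilon>. partial_deriv b (\<lambda>x. g \<epsilon> (T x)))" if b: "b \<in> B" for b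
    proof (rule tame_upto_cong[OF W K])
      have B': "B' = Basis" using dirs b by auto
      have "tame_upto B W K 0 k (\<lambda>\<epsilon>. partial_deriv b T)"
        using tame_deriv[OF T b] unfolding tame_def by blast
      then have "tame_upto B W K 0 k (\<lambda>\<epsilon> x. partial_deriv b T x \<bullet> i)" for i
        by (rule tame_upto_bounded_linear[OF bounded_linear_inner_left W K])
      moreover have "tame_upto B W K a k (\<lambda>\<epsilon> x. partial_deriv i (g \<epsilon>) (T x))" if "i \<in> Basis" for i
        using tame_deriv[OF Suc.prems] that B' by (intro Suc.IH) auto
      ultimately have "tame_upto B W K (0 + a) k (\<lambda>\<epsilon> x. (partial_deriv b T x \<bullet> i) *\<^sub>R partial_deriv i (g \<epsilon>) (T x))"
        if "i \<in> Basis" for i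
        using that by (intro tame_upto_scaleR[OF W K])
      then show "tame_upto B W K a k (\<lambda>\<epsilon> x. \<Sum>i\<in>Basis. (partial_deriv b T x \<bullet> i) *\<^sub>R partial_deriv i (g \<epsilon>) (T x))"
        by (intro tame_upto_sum[OF W K]) auto
      fix \<epsilon> :: real and x assume "\<epsilon> \<in> {0<..<1}" "x \<in> W"
      then show "(\<Sum>i\<in>Basis. (partial_deriv b T x \<bullet> i) *\<^sub>R partial_deriv i (g \<epsilon>) (T x)) = partial_deriv b (\<lambda>x. g \<epsilon> (T x)) x"
        using chain[OF b _ _ Suc.prems] by (intro partial_deriv_eqI[symmetric])
    qed
    then show ?case using base[OF Suc.prems] by (simp add: tame_upto_Suc)
  qed
  then show ?thesis unfolding tame_def by blast
qed

section \<open>Slow scale nets and regular nets\<close>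

text \<open>
  Slow scale nets: on compact sets every derivative is $O(\varepsilon^{a})$ for all $a<0$.  They are the
  multipliers that preserve regularity, since they worsen the exponent of a regular net by an
  arbitrarily small amount that does not depend on the order of differentiation.
\<close>

definition slow ::
  "'e::euclidean_space set \<Rightarrow> 'e set \<Rightarrow> (real \<Rightarrow> 'e \<Rightarrow> 'b::real_normed_vector) \<Rightarrow> bool" where
  "slow B W g \<longleftrightarrow> (\<forall>K. compact K \<and> K \<subseteq> W \<longrightarrow> tame B W K 0 g)"

lemma tame_iff:
  "tame B W K a g \<longleftrightarrow> (\<forall>\<epsilon>\<in>{0<..<1}. smooth_fun B W (g \<epsilon>)) \<and>
     (\<forall>bs. set bs \<subseteq> B \<longrightarrow> (\<forall>a'<a. sup_bigo K (\<lambda>\<epsilon>. partials bs (g \<epsilon>)) a'))"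
  (is "?L \<longleftrightarrow> ?R")
proof
  assume ?L
  then have *: "tame_upto B W K a (length bs) g" for bs :: "'a list" by (simp add: tame_def)
  show ?R
    unfolding smooth_fun_def
    using *[unfolded tame_upto_def] by blast
next
  assume ?R
  then show ?L unfolding tame_def tame_upto_def smooth_fun_def by blast
qed

lemma smooth_fun_iff_tame: "smooth_fun B W f \<longleftrightarrow> tame B W {} a (\<lambda>\<epsilon>. f)"
proof -
  have "(1/2::real) \<in> {0<..<1}" by simp
  then have "(\<forall>\<epsilon>::real\<in>{0<..<1}. smooth_fun B W f) \<longleftrightarrow> smooth_fun B W f" by blast
  then show ?thesis unfolding tame_iff by simp
qed

text \<open>
  Derivatives of a fixed smooth function are bounded on a compact set, that is
  $O(\varepsilon^{0})$.
\<close>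

lemma smooth_fun_tame_const:
  assumes f: "smooth_fun B W f" and K: "compact K" "K \<subseteq> W"
  shows "tame B W K 0 (\<lambda>\<epsilon>. f)"
  unfolding tame_iff
proof (intro conjI allI impI ballI f)
  fix bs and a' :: real assume bs: "set bs \<subseteq> B" and a': "a' < 0"
  have "continuous_on K (partials bs f)"
    using f bs K(2) by (auto simp: smooth_fun_def intro: continuous_on_subset)
  then have "compact (partials bs f ` K)" using K(1) compact_continuous_image by blast
  then obtain C where "\<And>x. x \<in> K \<Longrightarrow> norm (partials bs f x) \<le> C"
    using compact_imp_bounded bounded_iff by (metis imageI)
  with a' show "sup_bigo K (\<lambda>\<epsilon>. partials bs f) a'" by (intro sup_bigo_const) auto
qed

lemma slow_smooth_fun: "slow B W g \<Longrightarrow> \<epsilon> \<in> {0<..<1} \<Longrightarrow> smooth_fun B W (g \<epsilon>)"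
  unfolding slow_def by (drule spec[of _ "{}"]) (simp add: tame_iff)

lemma slow_tame: "slow B W g \<Longrightarrow> compact K \<Longrightarrow> K \<subseteq> W \<Longrightarrow> tame B W K 0 g"
  unfolding slow_def by blast

text \<open>
  This turns each closure property of slow scale nets into one of smooth functions.
\<close>

lemma slow_const_iff: "slow B W (\<lambda>\<epsilon>. f) \<longleftrightarrow> smooth_fun B W f"
proof
  have "(1/2::real) \<in> {0<..<1}" by simp
  then show "slow B W (\<lambda>\<epsilon>. f) \<Longrightarrow> smooth_fun B W f" using slow_smooth_fun by blast
  show "smooth_fun B W f \<Longrightarrow> slow B W (\<lambda>\<epsilon>. f)" unfolding slow_def by (blast intro: smooth_fun_tame_const)
qed

lemma slowI:
  assumes "\<And>\<epsilon>. \<epsilon> \<in> {0<..<1} \<Longrightarrow> smooth_fun B W (g \<epsilon>)"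
    and "\<And>K bs a. compact K \<Longrightarrow> K \<subseteq> W \<Longrightarrow> set bs \<subseteq> B \<Longrightarrow> a < 0 \<Longrightarrow> sup_bigo K (\<lambda>\<epsilon>. partials bs (g \<epsilon>)) a"
  shows "slow B W g"
  unfolding slow_def tame_iff using assms by blast

lemma slow_subset: "slow B W g \<Longrightarrow> B' \<subseteq> B \<Longrightarrow> W' \<subseteq> W \<Longrightarrow> slow B' W' g"
  unfolding slow_def by (meson order_refl order_trans tame_subset)

lemma slow_cong:
  assumes "openin (top_of_set (span B)) W"
    and "\<And>\<epsilon> x. \<epsilon> \<in> {0<..<1} \<Longrightarrow> x \<in> W \<Longrightarrow> g \<epsilon> x = h \<epsilon> x"
    and "slow B W g"
  shows "slow B W h"
  unfolding slow_def
proof (intro allI impI, elim conjE)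
  fix K assume K: "compact K" "K \<subseteq> W"
  show "tame B W K 0 h"
    by (rule tame_cong[OF assms(1) K(2), where g = g]) (use assms K slow_tame in auto)
qed

lemma slow_add:
  "openin (top_of_set (span B)) W \<Longrightarrow> slow B W g \<Longrightarrow> slow B W h \<Longrightarrow> slow B W (\<lambda>\<epsilon> x. g \<epsilon> x + h \<epsilon> x)"
  unfolding slow_def by (blast intro: tame_add)

lemma slow_scaleR:
  assumes "openin (top_of_set (span B)) W" "slow B W f" "slow B W g"
  shows "slow B W (\<lambda>\<epsilon> x. f \<epsilon> x *\<^sub>R g \<epsilon> x)"
  unfolding slow_def
proof (intro allI impI, elim conjE)
  fix K assume K: "compact K" "K \<subseteq> W"
  show "tame B W K 0 (\<lambda>\<epsilon> x. f \<epsilon> x *\<^sub>R g \<epsilon> x)"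
    using tame_scaleR[OF assms(1) K(2) slow_tame[OF assms(2) K] slow_tame[OF assms(3) K]] by simp
qed

lemma slow_zero: "slow B W (\<lambda>\<epsilon> x. 0)"
  unfolding slow_def tame_def by (blast intro: tame_upto_zero)

lemma slow_compose:
  fixes T :: "'e::euclidean_space \<Rightarrow> 'f::euclidean_space"
  assumes dirs: "B = {} \<or> B' = Basis"
    and W: "openin (top_of_set (span B)) W"
    and V: "openin (top_of_set (span B')) V" and TW: "T ` W \<subseteq> V"
    and T: "smooth_fun B W T" and g: "slow B' V g"
  shows "slow B W (\<lambda>\<epsilon> x. g \<epsilon> (T x))"
  unfolding slow_def
proof (intro allI impI, elim conjE)
  fix K assume K: "compact K" "K \<subseteq> W"
  have "continuous_on W T" using T by (simp add: smooth_fun_def) (metis empty_subsetI list.set(1) partials_Nil)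
  then have "compact (T ` K)" using K continuous_on_subset compact_continuous_image by blast
  moreover have "T ` K \<subseteq> V" using TW K by blast
  ultimately show "tame B W K 0 (\<lambda>\<epsilon> x. g \<epsilon> (T x))"
    using tame_compose[OF dirs W K(2) V TW smooth_fun_tame_const[OF T K] slow_tame[OF g]] by blast
qed

lemma smooth_fun_subset: "smooth_fun B W f \<Longrightarrow> B' \<subseteq> B \<Longrightarrow> W' \<subseteq> W \<Longrightarrow> smooth_fun B' W' f"
  using slow_subset[of B W "\<lambda>\<epsilon>. f"] by (simp add: slow_const_iff)

lemma smooth_fun_cong:
  "openin (top_of_set (span B)) W \<Longrightarrow> (\<And>x. x \<in> W \<Longrightarrow> f x = g x) \<Longrightarrow> smooth_fun B W f \<Longrightarrow> smooth_fun B W g"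
  using slow_cong[of B W "\<lambda>\<epsilon>. f" "\<lambda>\<epsilon>. g"] by (simp add: slow_const_iff)

lemma smooth_fun_add:
  "openin (top_of_set (span B)) W \<Longrightarrow> smooth_fun B W f \<Longrightarrow> smooth_fun B W g \<Longrightarrow> smooth_fun B W (\<lambda>x. f x + g x)"
  using slow_add[of B W "\<lambda>\<epsilon>. f" "\<lambda>\<epsilon>. g"] by (simp add: slow_const_iff)

lemma smooth_fun_scaleR:
  "openin (top_of_set (span B)) W \<Longrightarrow> smooth_fun B W f \<Longrightarrow> smooth_fun B W g \<Longrightarrow> smooth_fun B W (\<lambda>x. f x *\<^sub>R g x)"
  using slow_scaleR[of B W "\<lambda>\<epsilon>. f" "\<lambda>\<epsilon>. g"] by (simp add: slow_const_iff)

lemma smooth_fun_zero: "smooth_fun B W (\<lambda>x. 0)"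
  using slow_zero[of B W] by (simp add: slow_const_iff)

lemma smooth_fun_compose:
  fixes T :: "'e::euclidean_space \<Rightarrow> 'f::euclidean_space"
  assumes "B = {} \<or> B' = Basis" "openin (top_of_set (span B)) W" "openin (top_of_set (span B')) V" "T ` W \<subseteq> V"
    and "smooth_fun B W T" "smooth_fun B' V g"
  shows "smooth_fun B W (\<lambda>x. g (T x))"
  using slow_compose[OF assms(1-5), of "\<lambda>\<epsilon>. g"] assms(6) by (simp add: slow_const_iff)

lemma smooth_fun_bounded_linear:
  assumes "bounded_linear L" "openin (top_of_set (span B)) W" "smooth_fun B W f"
  shows "smooth_fun B W (\<lambda>x. L (f x))"
proof -
  have "tame B W {} 0 (\<lambda>\<epsilon>. f)" using assms(3) smooth_fun_iff_tame[of B W f 0] by simp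
  then have "tame B W {} 0 (\<lambda>\<epsilon> x. L (f x))"
    unfolding tame_def using tame_upto_bounded_linear[OF assms(1,2), of "{}" 0 _ "\<lambda>\<epsilon>. f"] by simp
  then show ?thesis using smooth_fun_iff_tame[of B W "\<lambda>x. L (f x)" 0] by simp
qed

lemma smooth_fun_local:
  assumes W: "openin (top_of_set (span B)) W"
    and loc: "\<And>x. x \<in> W \<Longrightarrow> \<exists>V. openin (top_of_set (span B)) V \<and> x \<in> V \<and> V \<subseteq> W \<and> smooth_fun B V f"
  shows "smooth_fun B W f"
  unfolding smooth_fun_def
proof (intro allI impI conjI ballI)
  fix bs assume bs: "set bs \<subseteq> B"
  show "continuous_on W (partials bs f)"
    unfolding continuous_on_eq_continuous_within
  proof
    fix x assume x: "x \<in> W"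
    then obtain V where V: "openin (top_of_set (span B)) V" "x \<in> V" "V \<subseteq> W" "smooth_fun B V f"
      using loc by blast
    from V(1) obtain O' where O': "open O'" "V = span B \<inter> O'" by (auto simp: openin_open)
    have "W \<subseteq> span B" using W openin_imp_subset by blast
    then have "at x within V = at x within W"
      by (intro at_within_nhd[of x O']) (use O' V in auto)
    moreover have "continuous (at x within V) (partials bs f)"
      using V bs by (auto simp: smooth_fun_def continuous_on_eq_continuous_within)
    ultimately show "continuous (at x within W) (partials bs f)" by simp
  qed
  fix b x assume "b \<in> B" "x \<in> W"
  then show "(\<lambda>t::real. partials bs f (x + t *\<^sub>R b)) differentiable (at 0)"
    using loc[of x] bs unfolding smooth_fun_def by blast
qed

text \<open>
  Smoothness is a pointwise condition, and a compact set is covered by finitely many balls whose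
  intersections with it lie in the neighbourhoods where the estimate is known.
\<close>

lemma slow_local:
  assumes W: "openin (top_of_set (span B)) W"
    and loc: "\<And>x. x \<in> W \<Longrightarrow> \<exists>V. openin (top_of_set (span B)) V \<and> x \<in> V \<and> V \<subseteq> W \<and> slow B V g"
  shows "slow B W g"
proof (rule slowI)
  fix \<epsilon> :: real assume e: "\<epsilon> \<in> {0<..<1}"
  show "smooth_fun B W (g \<epsilon>)"
  proof (rule smooth_fun_local[OF W])
    fix x assume "x \<in> W"
    from loc[OF this] show "\<exists>V. openin (top_of_set (span B)) V \<and> x \<in> V \<and> V \<subseteq> W \<and> smooth_fun B V (g \<epsilon>)"
      using slow_smooth_fun[OF _ e] by (elim exE conjE, intro exI conjI)
  qed
next
  fix K bs and a :: real assume K: "compact K" "K \<subseteq> W" and bs: "set bs \<subseteq> B" and a: "a < 0"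
  show "sup_bigo K (\<lambda>\<epsilon>. partials bs (g \<epsilon>)) a"
  proof (rule sup_bigo_compact_local[of euclidean])
    show "compactin euclidean K" using K by simp
    fix x assume x: "x \<in> K"
    then obtain V where V: "openin (top_of_set (span B)) V" "x \<in> V" "V \<subseteq> W" "slow B V g"
      using loc K(2) by blast
    from V(1) obtain O' where O': "open O'" "V = span B \<inter> O'" by (auto simp: openin_open)
    then obtain r where r: "r > 0" "cball x r \<subseteq> O'" using V(2) open_contains_cball by (metis IntD2)
    have "K \<inter> cball x r \<subseteq> V" using r(2) K(2) O'(2) openin_imp_subset[OF W] by blast
    then have "tame B V (K \<inter> cball x r) 0 g" using V(4) K(1) by (intro slow_tame) auto
    then have "sup_bigo (K \<inter> cball x r) (\<lambda>\<epsilon>. partials bs (g \<epsilon>)) a"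
      using bs a by (simp add: tame_iff)
    then have "sup_bigo (K \<inter> ball x r) (\<lambda>\<epsilon>. partials bs (g \<epsilon>)) a"
      by (rule sup_bigo_subset) auto
    then show "\<exists>N. openin euclidean N \<and> x \<in> N \<and> sup_bigo (K \<inter> N) (\<lambda>\<epsilon>. partials bs (g \<epsilon>)) a"
      using r(1) by (intro exI[of _ "ball x r"]) auto
  qed
qed

text \<open>
  Passing from \<open>tame\<close> with exponent $a$ back to a regular net costs some fixed amount of the
  exponent (here $1$), which is harmless because it is the same for all derivatives.
\<close>

lemma regular_nets_iff_tame:
  "f \<in> regular_nets B W \<longleftrightarrow> (\<forall>K. compact K \<and> K \<subseteq> W \<longrightarrow> (\<exists>a. tame B W K a f))"
  (is "_ \<longleftrightarrow> ?R")
proof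
  assume f: "f \<in> regular_nets B W"
  show ?R
  proof (intro allI impI)
    fix K assume "compact K \<and> K \<subseteq> W"
    with f obtain a where "\<And>bs. set bs \<subseteq> B \<Longrightarrow> sup_bigo K (\<lambda>\<epsilon>. partials bs (f \<epsilon>)) a"
      unfolding regular_nets_def by blast
    then have "\<forall>bs. set bs \<subseteq> B \<longrightarrow> (\<forall>a'<a. sup_bigo K (\<lambda>\<epsilon>. partials bs (f \<epsilon>)) a')"
      by (meson sup_bigo_antimono less_imp_le)
    moreover have "\<forall>\<epsilon>\<in>{0<..<1}. smooth_fun B W (f \<epsilon>)" using f by (simp add: regular_nets_def)
    ultimately have "tame B W K a f" by (simp add: tame_iff)
    then show "\<exists>a. tame B W K a f" ..
  qed
next
  assume R: ?R
  then obtain a where "tame B W {} a f" using compact_empty by blast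
  then have "\<forall>\<epsilon>\<in>{0<..<1}. smooth_fun B W (f \<epsilon>)" by (simp add: tame_iff)
  moreover have "\<exists>a. \<forall>bs. set bs \<subseteq> B \<longrightarrow> sup_bigo K (\<lambda>\<epsilon>. partials bs (f \<epsilon>)) a"
    if K: "compact K" "K \<subseteq> W" for K
  proof -
    from R K obtain a where a: "tame B W K a f" by blast
    then have "\<forall>bs. set bs \<subseteq> B \<longrightarrow> sup_bigo K (\<lambda>\<epsilon>. partials bs (f \<epsilon>)) (a - 1)"
      by (simp add: tame_iff)
    then show ?thesis by blast
  qed
  ultimately show "f \<in> regular_nets B W" unfolding regular_nets_def by blast
qed

lemma regular_nets_slow_scaleR:
  assumes W: "openin (top_of_set (span B)) W" and g: "slow B W g" and f: "f \<in> regular_nets B W"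
  shows "(\<lambda>\<epsilon> x. g \<epsilon> x *\<^sub>R f \<epsilon> x) \<in> regular_nets B W"
  unfolding regular_nets_iff_tame
proof (intro allI impI, elim conjE)
  fix K assume K: "compact K" "K \<subseteq> W"
  then obtain a where a: "tame B W K a f" using f regular_nets_iff_tame by blast
  show "\<exists>a. tame B W K a (\<lambda>\<epsilon> x. g \<epsilon> x *\<^sub>R f \<epsilon> x)"
    using tame_scaleR[OF W K(2) slow_tame[OF g K] a] by blast
qed

section \<open>Smooth bump functions\<close>

lemma openin_span_Basis: "openin (top_of_set (span (Basis :: 'e::euclidean_space set))) W \<longleftrightarrow> open W"
  by (metis open_openin span_Basis subtopology_UNIV)

lemma openin_span_Basis_UNIV: "openin (top_of_set (span (Basis :: 'e::euclidean_space set))) UNIV"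
  by (rule openin_span_Basis[THEN iffD2, OF open_UNIV])

text \<open>
  A family of functions that is closed under differentiation, up to values outside \<^term>\<open>W\<close>, consists
  of smooth functions if its members are continuous and differentiable along lines.
\<close>

lemma smooth_fun_coinduct:
  fixes f :: "'e::euclidean_space \<Rightarrow> 'b::real_normed_vector"
  assumes W: "openin (top_of_set (span B)) W"
    and P: "P f"
    and cont: "\<And>f. P f \<Longrightarrow> continuous_on W f"
    and diff: "\<And>f b x. P f \<Longrightarrow> b \<in> B \<Longrightarrow> x \<in> W \<Longrightarrow> (\<lambda>t::real. f (x + t *\<^sub>R b)) differentiable (at 0)"
    and step: "\<And>f b. P f \<Longrightarrow> b \<in> B \<Longrightarrow> \<exists>g. P g \<and> (\<forall>x\<in>W. partial_deriv b f x = g x)"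
  shows "smooth_fun B W f"
proof -
  have "tame_upto B W {} 0 k (\<lambda>\<epsilon>. f)" for k
    using P
  proof (induction k arbitrary: f)
    case 0
    then show ?case using cont diff by (simp add: tame_upto_0)
  next
    case (Suc k)
    have "tame_upto B W {} 0 k (\<lambda>\<epsilon>. partial_deriv b f)" if b: "b \<in> B" for b
    proof -
      obtain g where g: "P g" "\<And>x. x \<in> W \<Longrightarrow> partial_deriv b f x = g x" using step[OF Suc.prems b] by blast
      show ?thesis
        by (rule tame_upto_cong[OF W, where g = "\<lambda>\<epsilon>. g"]) (use g Suc.IH in auto)
    qed
    then show ?case using cont diff Suc.prems by (simp add: tame_upto_Suc tame_upto_0)
  qed
  then show ?thesis unfolding smooth_fun_iff_tame[of _ _ _ 0] tame_def by blast
qed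

lemma smooth_fun_affine:
  fixes L :: "'e::euclidean_space \<Rightarrow> 'b::real_normed_vector"
  assumes "bounded_linear L" "openin (top_of_set (span B)) W"
  shows "smooth_fun B W (\<lambda>x. L x + c)"
proof (rule smooth_fun_coinduct[OF assms(2), where P = "\<lambda>f. \<exists>L c. bounded_linear L \<and> f = (\<lambda>x. L x + c)"])
  show "\<exists>L' c'. bounded_linear L' \<and> (\<lambda>x. L x + c) = (\<lambda>x. L' x + c')" using assms by blast
  fix f :: "'e \<Rightarrow> 'b" assume "\<exists>L c. bounded_linear L \<and> f = (\<lambda>x. L x + c)"
  then obtain M d where M: "bounded_linear M" "f = (\<lambda>x. M x + d)" by blast
  show "continuous_on W f"
    unfolding M(2) by (intro continuous_intros bounded_linear.continuous_on[OF M(1)])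
  interpret M: bounded_linear M by (rule M(1))
  have vd: "((\<lambda>t::real. f (x + t *\<^sub>R b)) has_vector_derivative M b) (at 0)" for x b
    unfolding M(2) M.add M.scaleR by (auto intro!: derivative_eq_intros)
  fix b assume "b \<in> B"
  { fix x show "(\<lambda>t::real. f (x + t *\<^sub>R b)) differentiable (at 0)"
      by (rule differentiableI_vector[OF vd]) }
  have "bounded_linear (\<lambda>x::'e. 0::'b) \<and> (\<lambda>x::'e. M b) = (\<lambda>x. 0 + M b)"
    by (simp add: bounded_linear_zero)
  then have "\<exists>L c. bounded_linear L \<and> (\<lambda>x::'e. M b) = (\<lambda>x. L x + c)" by blast
  then show "\<exists>g. (\<exists>L c. bounded_linear L \<and> g = (\<lambda>x. L x + c)) \<and> (\<forall>x\<in>W. partial_deriv b f x = g x)"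
    using partial_deriv_eqI[OF vd] by (intro exI[of _ "\<lambda>x. M b"]) simp
qed

lemma smooth_fun_const: "openin (top_of_set (span B)) W \<Longrightarrow> smooth_fun B W (\<lambda>x. c)"
  using smooth_fun_affine[OF bounded_linear_zero, of B W c] by simp

lemma smooth_fun_sum:
  assumes "openin (top_of_set (span B)) W" "finite I" "\<And>i. i \<in> I \<Longrightarrow> smooth_fun B W (f i)"
  shows "smooth_fun B W (\<lambda>x. \<Sum>i\<in>I. f i x)"
  using assms(2,3) by (induction I rule: finite_induct) (auto intro: smooth_fun_zero smooth_fun_add[OF assms(1)])

text \<open>
  The functions $t^{-n} e^{-1/t}$, extended by $0$ to $t \le 0$.  Their linear span is closed under
  differentiation, which is why all of them are treated together.
\<close>

definition flat :: "nat \<Rightarrow> real \<Rightarrow> real" where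
  "flat n t = (if t \<le> 0 then 0 else inverse t ^ n * exp (- inverse t))"

lemma flat_tendsto_0_right: "(flat n \<longlongrightarrow> 0) (at_right 0)"
proof -
  have "((\<lambda>x::real. x ^ n / exp x) \<longlongrightarrow> 0) at_top" by (rule tendsto_power_div_exp_0)
  then have "((\<lambda>t::real. inverse t ^ n / exp (inverse t)) \<longlongrightarrow> 0) (at_right 0)"
    by (rule filterlim_compose[OF _ filterlim_inverse_at_top_right])
  moreover have "\<forall>\<^sub>F t::real in at_right 0. inverse t ^ n / exp (inverse t) = flat n t"
    using eventually_at_right_0_unit by eventually_elim (auto simp: flat_def exp_minus divide_inverse)
  ultimately show ?thesis by (rule Lim_transform_eventually)
qed

lemma flat_tendsto_0: "(flat n \<longlongrightarrow> 0) (at 0)"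
proof -
  have "\<forall>\<^sub>F t::real in at_left 0. 0 = flat n t"
    by (auto simp: eventually_at_filter flat_def)
  then have "(flat n \<longlongrightarrow> 0) (at_left 0)" by (rule Lim_transform_eventually[OF tendsto_const])
  then show ?thesis using flat_tendsto_0_right by (simp add: filterlim_split_at)
qed

lemma flat_has_field_derivative:
  "(flat n has_field_derivative (flat (n + 2) t - real n * flat (n + 1) t)) (at t)"
proof (cases t "0::real" rule: linorder_cases)
  case less
  have "((\<lambda>t::real. 0) has_field_derivative 0) (at t)" by simp
  then have "(flat n has_field_derivative 0) (at t)"
    by (rule has_field_derivative_transform_within_open[of _ _ _ "{..<0}"]) (use less in \<open>auto simp: flat_def\<close>)
  then show ?thesis using less by (simp add: flat_def)
next
  case equal
  have "((\<lambda>h. (flat n (0 + h) - flat n 0) / h) \<longlongrightarrow> 0) (at 0)"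
  proof (rule Lim_transform_eventually[OF flat_tendsto_0[of "n + 1"]])
    show "\<forall>\<^sub>F h in at 0. flat (n + 1) h = (flat n (0 + h) - flat n 0) / h"
      by (auto simp: flat_def eventually_at_filter divide_inverse)
  qed
  then show ?thesis using equal by (simp add: DERIV_def flat_def)
next
  case greater
  have "((\<lambda>t. inverse t ^ n * exp (- inverse t)) has_field_derivative
      (flat (n + 2) t - real n * flat (n + 1) t)) (at t)"
  proof (cases n)
    case 0
    show ?thesis
      by (rule derivative_eq_intros refl | use greater 0 in \<open>force simp: flat_def power2_eq_square\<close>)+
  next
    case (Suc m)
    show ?thesis
      by (rule derivative_eq_intros refl | use greater Suc in \<open>force simp: flat_def power2_eq_square algebra_simps\<close>)+
  qed
  then show ?thesis
    by (rule has_field_derivative_transform_within_open[of _ _ _ "{0<..}"]) (use greater in \<open>auto simp: flat_def\<close>)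
qed

lemma real_line_has_vector_derivative:
  fixes f :: "real \<Rightarrow> real"
  assumes "(f has_field_derivative D) (at x)"
  shows "((\<lambda>t::real. f (x + t *\<^sub>R 1)) has_vector_derivative D) (at 0)"
proof -
  have "((\<lambda>t. x + t) has_field_derivative 1) (at 0)" by (auto intro!: derivative_eq_intros)
  then have "((\<lambda>t. f (x + t)) has_field_derivative D * 1) (at 0)"
    by (intro DERIV_chain2[where f = f]) (use assms in auto)
  then show ?thesis by (simp add: has_real_derivative_iff_has_vector_derivative)
qed

lemma smooth_fun_flat: "smooth_fun Basis UNIV (flat n)"
proof -
  have W: "openin (top_of_set (span (Basis :: real set))) UNIV"
    by (rule openin_span_Basis_UNIV)
  have "tame_upto Basis UNIV {} 0 k (\<lambda>\<epsilon>. flat n)" for k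
  proof (induction k arbitrary: n)
    case 0
    then show ?case
      using real_line_has_vector_derivative[OF flat_has_field_derivative] DERIV_isCont[OF flat_has_field_derivative]
      by (auto simp: tame_upto_0 continuous_on_eq_continuous_at intro: differentiableI_vector)
  next
    case (Suc k)
    have "tame_upto Basis UNIV {} 0 k (\<lambda>\<epsilon>. partial_deriv 1 (flat n))"
    proof (rule tame_upto_cong[OF W, where g = "\<lambda>\<epsilon> t. flat (n + 2) t + (- real n * flat (n + 1) t)"])
      show "tame_upto Basis UNIV {} 0 k (\<lambda>\<epsilon> t. flat (n + 2) t + (- real n * flat (n + 1) t))"
        by (intro tame_upto_add[OF W] tame_upto_bounded_linear[OF bounded_linear_mult_right W] Suc) auto
      fix x show "flat (n + 2) x + (- real n * flat (n + 1) x) = partial_deriv 1 (flat n) x"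
        using partial_deriv_eqI[OF real_line_has_vector_derivative[OF flat_has_field_derivative]] by simp
    qed auto
    moreover have "tame_upto Basis UNIV {} 0 0 (\<lambda>\<epsilon>. flat n)"
      using Suc tame_upto_mono by blast
    ultimately show ?case by (simp add: tame_upto_Suc)
  qed
  then show ?thesis unfolding smooth_fun_iff_tame[of _ _ _ 0] tame_def by blast
qed

lemma smooth_fun_inverse: "smooth_fun Basis {0<..} (inverse :: real \<Rightarrow> real)"
proof -
  have W: "openin (top_of_set (span (Basis :: real set))) {0<..}"
    by (rule openin_span_Basis[THEN iffD2, OF open_greaterThan])
  have der: "(inverse has_field_derivative - (inverse x * inverse x)) (at x)" if "x > 0" for x :: real
    using DERIV_inverse[of x] that by (simp add: power2_eq_square)
  have "tame_upto Basis {0<..} {} 0 k (\<lambda>\<epsilon>. inverse :: real \<Rightarrow> real)" for k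
  proof (induction k)
    case 0
    then show ?case
      using real_line_has_vector_derivative[OF der]
      by (auto simp: tame_upto_0 intro!: continuous_intros intro: differentiableI_vector)
  next
    case (Suc k)
    have "tame_upto Basis {0<..} {} 0 k (\<lambda>\<epsilon>. partial_deriv 1 (inverse :: real \<Rightarrow> real))"
    proof (rule tame_upto_cong[OF W, where g = "\<lambda>\<epsilon> t. - (inverse t *\<^sub>R inverse t)"])
      show "tame_upto Basis {0<..} {} 0 k (\<lambda>\<epsilon> t::real. - (inverse t *\<^sub>R inverse t))"
        using tame_upto_scaleR[OF W _ Suc Suc]
        by (intro tame_upto_bounded_linear[OF bounded_linear_minus[OF bounded_linear_ident] W]) simp_all
      fix x :: real assume "x \<in> {0<..}"
      then show "- (inverse x *\<^sub>R inverse x) = partial_deriv 1 inverse x"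
        using partial_deriv_eqI[OF real_line_has_vector_derivative[OF der]] by simp
    qed auto
    moreover have "tame_upto Basis {0<..} {} 0 0 (\<lambda>\<epsilon>. inverse :: real \<Rightarrow> real)"
      using Suc tame_upto_mono by blast
    ultimately show ?case by (simp add: tame_upto_Suc)
  qed
  then show ?thesis unfolding smooth_fun_iff_tame[of _ _ _ 0] tame_def by blast
qed

lemma smooth_fun_divide:
  fixes f :: "'e::euclidean_space \<Rightarrow> real"
  assumes W: "openin (top_of_set (span B)) W"
    and g: "smooth_fun B W g" "\<And>x. x \<in> W \<Longrightarrow> g x > 0" and f: "smooth_fun B W f"
  shows "smooth_fun B W (\<lambda>x. f x / g x)"
proof -
  have "openin (top_of_set (span (Basis :: real set))) {0<..}"
    by (rule openin_span_Basis[THEN iffD2, OF open_greaterThan])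
  then have "smooth_fun B W (\<lambda>x. inverse (g x))"
    using g by (intro smooth_fun_compose[OF _ W _ _ g(1) smooth_fun_inverse]) auto
  from smooth_fun_scaleR[OF W f this] show ?thesis by (simp add: divide_inverse)
qed

definition smooth_step :: "real \<Rightarrow> real" where
  "smooth_step t = flat 0 t / (flat 0 t + flat 0 (1 - t))"

lemma flat_0_nonneg: "flat 0 t \<ge> 0" and flat_0_pos_iff: "flat 0 t > 0 \<longleftrightarrow> t > 0"
  and flat_0_nonpos: "t \<le> 0 \<Longrightarrow> flat 0 t = 0"
  by (auto simp: flat_def)

lemma smooth_step_pos: "flat 0 t + flat 0 (1 - t) > 0"
  using flat_0_nonneg[of t] flat_0_nonneg[of "1 - t"] flat_0_pos_iff[of t] flat_0_pos_iff[of "1 - t"]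
  by linarith

lemma smooth_step_le_0: "t \<le> 0 \<Longrightarrow> smooth_step t = 0"
  by (simp add: smooth_step_def flat_0_nonpos)

lemma smooth_step_ge_1: "t \<ge> 1 \<Longrightarrow> smooth_step t = 1"
  using smooth_step_pos[of t] by (simp add: smooth_step_def flat_0_nonpos)

lemma smooth_step_nonneg: "smooth_step t \<ge> 0"
  using smooth_step_pos[of t] flat_0_nonneg[of t] by (simp add: smooth_step_def)

lemma smooth_fun_smooth_step: "smooth_fun Basis UNIV smooth_step"
proof -
  have W: "openin (top_of_set (span (Basis :: real set))) UNIV" by (rule openin_span_Basis_UNIV)
  have "smooth_fun Basis UNIV (\<lambda>t::real. - t + 1)"
    by (rule smooth_fun_affine[OF bounded_linear_minus[OF bounded_linear_ident] W])
  then have "smooth_fun Basis UNIV (\<lambda>t::real. flat 0 (- t + 1))"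
    by (intro smooth_fun_compose[OF _ W W _ _ smooth_fun_flat]) auto
  then have "smooth_fun Basis UNIV (\<lambda>t::real. flat 0 t + flat 0 (1 - t))"
    using smooth_fun_add[OF W smooth_fun_flat] by simp
  then show ?thesis
    unfolding smooth_step_def using smooth_step_pos by (intro smooth_fun_divide[OF W _ _ smooth_fun_flat]) auto
qed

text \<open>
  Positivity exactly on the ball comes from $e^{-1/t}$ evaluated at $t = r^2 - |x-c|^2$, which is a
  polynomial in the coordinates.
\<close>

lemma smooth_ball_bump:
  fixes c :: "'e::euclidean_space"
  assumes "r > 0"
  shows "\<exists>H::'e \<Rightarrow> real. smooth_fun Basis UNIV H \<and> (\<forall>x. H x \<ge> 0) \<and> (\<forall>x. H x > 0 \<longleftrightarrow> x \<in> ball c r)"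
proof -
  have W: "openin (top_of_set (span (Basis :: 'e set))) UNIV"
   and W1: "openin (top_of_set (span (Basis :: real set))) UNIV" by (rule openin_span_Basis_UNIV)+
  have aff: "smooth_fun Basis UNIV (\<lambda>x. x \<bullet> i + - (c \<bullet> i))" for i
    by (rule smooth_fun_affine[OF bounded_linear_inner_left W])
  have "smooth_fun Basis UNIV (\<lambda>x. \<Sum>i\<in>Basis. (x \<bullet> i + - (c \<bullet> i)) *\<^sub>R (x \<bullet> i + - (c \<bullet> i)))"
    by (intro smooth_fun_sum[OF W] smooth_fun_scaleR[OF W] aff) auto
  then have "smooth_fun Basis UNIV (\<lambda>x. r\<^sup>2 + - (\<Sum>i\<in>Basis. (x \<bullet> i + - (c \<bullet> i)) *\<^sub>R (x \<bullet> i + - (c \<bullet> i))))"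
    by (intro smooth_fun_add[OF W smooth_fun_const[OF W]]
        smooth_fun_bounded_linear[OF bounded_linear_minus[OF bounded_linear_ident] W])
  moreover have "r\<^sup>2 + - (\<Sum>i\<in>Basis. (x \<bullet> i + - (c \<bullet> i)) *\<^sub>R (x \<bullet> i + - (c \<bullet> i))) = r\<^sup>2 - (dist c x)\<^sup>2" for x
  proof -
    have "(dist c x)\<^sup>2 = (x - c) \<bullet> (x - c)"
      by (simp add: dist_norm norm_minus_commute[of c x] power2_norm_eq_inner)
    also have "\<dots> = (\<Sum>i\<in>Basis. ((x - c) \<bullet> i) * ((x - c) \<bullet> i))"
      by (rule euclidean_inner)
    finally show ?thesis by (simp add: inner_diff_left)
  qed
  ultimately have sm: "smooth_fun Basis UNIV (\<lambda>x. r\<^sup>2 - (dist c x)\<^sup>2)" by simp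
  show ?thesis
  proof (intro exI[of _ "\<lambda>x. flat 0 (r\<^sup>2 - (dist c x)\<^sup>2)"] conjI allI)
    show "smooth_fun Basis UNIV (\<lambda>x. flat 0 (r\<^sup>2 - (dist c x)\<^sup>2))"
      by (rule smooth_fun_compose[OF _ W W1 _ sm smooth_fun_flat]) auto
    show "flat 0 (r\<^sup>2 - (dist c x)\<^sup>2) > 0 \<longleftrightarrow> x \<in> ball c r" for x
      using assms power2_less_imp_less[of "dist c x" r] power_strict_mono[of "dist c x" r 2]
      by (auto simp: flat_0_pos_iff)
  qed (rule flat_0_nonneg)
qed

text \<open>
  Finitely many ball bumps have a sum that is positive on \<^term>\<open>P\<close>, hence at least some $m>0$ there.
  Dividing by $m$ and applying the smooth step raises it to the constant $1$ on \<^term>\<open>P\<close>.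
\<close>

lemma smooth_urysohn:
  fixes P Q :: "'e::euclidean_space set"
  assumes P: "compact P" and Q: "open Q" "P \<subseteq> Q"
  obtains G :: "'e \<Rightarrow> real" and C where "smooth_fun Basis UNIV G" "compact C" "C \<subseteq> Q"
    "\<And>x. x \<notin> C \<Longrightarrow> G x = 0" "\<And>x. x \<in> P \<Longrightarrow> G x = 1" "\<And>x. G x \<ge> 0"
proof -
  have W: "openin (top_of_set (span (Basis :: 'e set))) UNIV"
   and W1: "openin (top_of_set (span (Basis :: real set))) UNIV" by (rule openin_span_Basis_UNIV)+
  have "\<forall>x\<in>P. \<exists>r>0. cball x r \<subseteq> Q" using Q open_contains_cball by blast
  from bchoice[OF this] obtain r where r: "\<And>x. x \<in> P \<Longrightarrow> r x > 0" "\<And>x. x \<in> P \<Longrightarrow> cball x (r x) \<subseteq> Q"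
    by blast
  have "\<forall>x\<in>P. \<exists>H::'e \<Rightarrow> real. smooth_fun Basis UNIV H \<and> (\<forall>y. H y \<ge> 0) \<and> (\<forall>y. H y > 0 \<longleftrightarrow> y \<in> ball x (r x))"
    by (intro ballI smooth_ball_bump r(1))
  from bchoice[OF this] obtain H :: "'e \<Rightarrow> 'e \<Rightarrow> real" where
    H: "\<And>x. x \<in> P \<Longrightarrow> smooth_fun Basis UNIV (H x)" "\<And>x y. x \<in> P \<Longrightarrow> H x y \<ge> 0"
      "\<And>x y. x \<in> P \<Longrightarrow> H x y > 0 \<longleftrightarrow> y \<in> ball x (r x)"
    by blast
  have "P \<subseteq> (\<Union>x\<in>P. ball x (r x))" using r(1) by auto
  then obtain F where F: "F \<subseteq> P" "finite F" "P \<subseteq> (\<Union>x\<in>F. ball x (r x))"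
    using compactE_image[OF P, of P "\<lambda>x. ball x (r x)"] by auto
  define S where "S y = (\<Sum>x\<in>F. H x y)" for y
  define C where "C = (\<Union>x\<in>F. cball x (r x))"
  have S: "smooth_fun Basis UNIV S"
    unfolding S_def using F H by (intro smooth_fun_sum[OF W]) auto
  have Spos: "S y > 0" if "y \<in> P" for y
  proof -
    from that F obtain x where "x \<in> F" "y \<in> ball x (r x)" by blast
    then show ?thesis unfolding S_def using F H by (intro sum_pos2[of F x]) auto
  qed
  have S0: "S y = 0" if "y \<notin> C" for y
    unfolding S_def
  proof (intro sum.neutral ballI)
    fix x assume x: "x \<in> F"
    then have "y \<notin> ball x (r x)" using that by (auto simp: C_def)
    then show "H x y = 0" using H(2,3)[of x y] x F(1) by (metis order_le_less subsetD)
  qed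
  obtain m where m: "m > 0" "\<And>y. y \<in> P \<Longrightarrow> S y \<ge> m"
  proof (cases "P = {}")
    case True
    then show ?thesis using that[of 1] by simp
  next
    case False
    have "continuous_on P S"
      using smooth_fun_iff_tame[of Basis UNIV S 0] S tame_continuous_on[of Basis UNIV "{}" 0 "\<lambda>\<epsilon>. S" "1/2"]
      by (auto intro: continuous_on_subset)
    then obtain x where "x \<in> P" "\<And>y. y \<in> P \<Longrightarrow> S x \<le> S y"
      using continuous_attains_inf[OF P False] by blast
    then show ?thesis using that[of "S x"] Spos by simp
  qed
  show ?thesis
  proof (rule that[of "\<lambda>y. smooth_step (S y / m)" C])
    have "smooth_fun Basis UNIV (\<lambda>y. S y / m)"
      by (rule smooth_fun_bounded_linear[OF bounded_linear_divide W S])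
    then show "smooth_fun Basis UNIV (\<lambda>y. smooth_step (S y / m))"
      by (intro smooth_fun_compose[OF _ W W1 _ _ smooth_fun_smooth_step]) auto
    show "compact C" unfolding C_def using F by (intro compact_UN) auto
    show "C \<subseteq> Q" unfolding C_def using F r by blast
    show "smooth_step (S y / m) = 0" if "y \<notin> C" for y using S0[OF that] by (simp add: smooth_step_le_0)
    show "smooth_step (S y / m) = 1" if "y \<in> P" for y using m that by (intro smooth_step_ge_1) simp
  qed (rule smooth_step_nonneg)
qed

section \<open>Slow scale nets separating two closed sets\<close>

lemma minus_ln_at_top: "filterlim (\<lambda>\<epsilon>::real. - ln \<epsilon>) at_top (at_right 0)"
  using ln_at_0 by (simp add: filterlim_uminus_at_top)

text \<open>
  Take the largest $i$ such that both $i$ and $M_i$ are at most $-\ln\varepsilon$.  The bound on $i$ makes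
  the maximum exist, and every $n$ is eventually admissible, so the index tends to infinity.
\<close>

lemma exists_slowly_growing_index:
  fixes M :: "nat \<Rightarrow> real"
  shows "\<exists>j. filterlim j at_top (at_right 0) \<and> (\<forall>\<^sub>F \<epsilon> in at_right 0. M (j \<epsilon>) \<le> - ln \<epsilon>)"
proof -
  define N where "N i = max (real i) (M i)" for i
  define I where "I \<epsilon> = {i. N i \<le> - ln \<epsilon>}" for \<epsilon>
  define j where "j \<epsilon> = Max (I \<epsilon>)" for \<epsilon>
  have fin: "finite (I \<epsilon>)" for \<epsilon>
  proof (rule finite_subset)
    show "I \<epsilon> \<subseteq> {..nat \<lceil>- ln \<epsilon>\<rceil>}"
    proof
      fix i assume "i \<in> I \<epsilon>"
      then have "real i \<le> - ln \<epsilon>" by (simp add: I_def N_def)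
      then show "i \<in> {..nat \<lceil>- ln \<epsilon>\<rceil>}" by (simp add: le_nat_iff le_ceiling_iff)
    qed
  qed simp
  have ev: "\<forall>\<^sub>F \<epsilon> in at_right 0. n \<in> I \<epsilon>" for n
    using minus_ln_at_top unfolding filterlim_at_top I_def by simp
  have "filterlim j at_top (at_right 0)"
    unfolding filterlim_at_top
  proof
    fix n
    show "\<forall>\<^sub>F \<epsilon> in at_right 0. n \<le> j \<epsilon>"
      using ev[of n] by eventually_elim (simp add: j_def fin)
  qed
  moreover have "\<forall>\<^sub>F \<epsilon> in at_right 0. M (j \<epsilon>) \<le> - ln \<epsilon>"
    using ev[of 0]
  proof eventually_elim
    case (elim \<epsilon>)
    then have "j \<epsilon> \<in> I \<epsilon>" unfolding j_def using fin by (intro Max_in) auto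
    then show ?case by (simp add: I_def N_def)
  qed
  ultimately show ?thesis by blast
qed

text \<open>
  Any sequence of smooth functions becomes a slow scale net when it is run through slowly enough.
  Let $M_i$ bound the derivatives of order at most $i$ of the $i$-th function on the ball of radius $i$.
  A given compact set and a given order are eventually covered by the index, and along an index with
  $M_{j(\varepsilon)} \le -\ln\varepsilon$ the derivatives grow at most logarithmically.
\<close>

lemma slow_diagonal:
  fixes g :: "nat \<Rightarrow> 'e::euclidean_space \<Rightarrow> 'b::real_normed_vector"
  assumes g: "\<And>i. smooth_fun Basis UNIV (g i)"
  shows "\<exists>j. filterlim j at_top (at_right 0) \<and> slow Basis UNIV (\<lambda>\<epsilon>. g (j \<epsilon>))"
proof -
  have "\<forall>i. \<exists>M. \<forall>bs x. set bs \<subseteq> Basis \<and> length bs \<le> i \<and> x \<in> cball 0 (real i) \<longrightarrow> norm (partials bs (g i) x) \<le> M"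
  proof
    fix i
    define L where "L = {bs. set bs \<subseteq> (Basis :: 'e set) \<and> length bs \<le> i}"
    have "finite L" unfolding L_def by (rule finite_lists_length_le) simp
    moreover have "bounded (partials bs (g i) ` cball 0 (real i))" if "bs \<in> L" for bs
    proof -
      have "continuous_on (cball 0 (real i)) (partials bs (g i))"
        using g[of i] that unfolding L_def smooth_fun_def by (blast intro: continuous_on_subset)
      then show ?thesis by (intro compact_imp_bounded compact_continuous_image) auto
    qed
    ultimately have "bounded (\<Union>bs\<in>L. partials bs (g i) ` cball 0 (real i))" by (rule bounded_UN[rule_format])
    then obtain M where "\<forall>y\<in>(\<Union>bs\<in>L. partials bs (g i) ` cball 0 (real i)). norm y \<le> M"
      unfolding bounded_iff by blast
    then show "\<exists>M. \<forall>bs x. set bs \<subseteq> Basis \<and> length bs \<le> i \<and> x \<in> cball 0 (real i) \<longrightarrow> norm (partials bs (g i) x) \<le> M"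
      unfolding L_def by (intro exI[of _ M]) blast
  qed
  from choice[OF this] obtain M where M: "\<And>i bs x. set bs \<subseteq> Basis \<Longrightarrow> length bs \<le> i \<Longrightarrow> x \<in> cball 0 (real i)
      \<Longrightarrow> norm (partials bs (g i) x) \<le> M i" by blast
  obtain j where j: "filterlim j at_top (at_right 0)" "\<forall>\<^sub>F \<epsilon> in at_right 0. M (j \<epsilon>) \<le> - ln \<epsilon>"
    using exists_slowly_growing_index[of M] by blast
  have "slow Basis UNIV (\<lambda>\<epsilon>. g (j \<epsilon>))"
  proof (rule slowI)
    show "smooth_fun Basis UNIV (g (j \<epsilon>))" for \<epsilon> by (rule g)
    fix K :: "'e set" and bs :: "'e list" and a :: real
    assume K: "compact K" and bs: "set bs \<subseteq> Basis" and a: "a < 0"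
    obtain R where R: "\<And>x. x \<in> K \<Longrightarrow> norm x \<le> R" using compact_imp_bounded[OF K] bounded_iff by blast
    define m where "m = max (length bs) (nat \<lceil>R\<rceil>)"
    have "\<forall>\<^sub>F \<epsilon> in at_right 0. m \<le> j \<epsilon>" using j(1) unfolding filterlim_at_top by blast
    then have "\<forall>\<^sub>F \<epsilon> in at_right 0. \<forall>p\<in>K. norm (partials bs (g (j \<epsilon>)) p) \<le> (1 / - a) * \<epsilon> powr a"
      using j(2) eventually_at_right_0_unit
    proof eventually_elim
      case (elim \<epsilon>)
      have "ln (1 / \<epsilon>) \<le> (1 / \<epsilon>) powr (- a) / (- a)" using elim(3) a by (intro ln_powr_bound) auto
      then have ln: "- ln \<epsilon> \<le> (1 / - a) * \<epsilon> powr a"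
        using elim(3) by (simp add: ln_div powr_minus_divide powr_divide)
      show ?case
      proof
        fix p assume "p \<in> K"
        from R[OF this] have "norm p \<le> R" .
        moreover have "nat \<lceil>R\<rceil> \<le> j \<epsilon>" using elim(1) by (simp add: m_def)
        ultimately have "norm p \<le> real (j \<epsilon>)" by linarith
        then have "norm (partials bs (g (j \<epsilon>)) p) \<le> M (j \<epsilon>)"
          using bs elim(1) by (intro M) (auto simp: m_def)
        then show "norm (partials bs (g (j \<epsilon>)) p) \<le> (1 / - a) * \<epsilon> powr a" using elim(2) ln by linarith
      qed
    qed
    then show "sup_bigo K (\<lambda>\<epsilon>. partials bs (g (j \<epsilon>))) a" by (rule sup_bigoI)
  qed
  with j(1) show ?thesis by blast
qed

text \<open>
  A single smooth function that is $1$ near \<^term>\<open>A1 - A2\<close> and $0$ near \<^term>\<open>A2 - A1\<close> need not exist, as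
  both sets may accumulate at points of \<^term>\<open>A1 \<inter> A2\<close>.  But the $j$-th function of a sequence can satisfy this at
  distance at least $1/(j+1)$ from \<^term>\<open>A2\<close> and \<^term>\<open>A1\<close> respectively, on a large ball for the first
  requirement, and running through the sequence slowly gives a slow scale net.
\<close>

lemma slow_separating_net:
  fixes A1 A2 :: "'e::euclidean_space set"
  assumes A: "closed A1" "closed A2"
  shows "\<exists>h :: real \<Rightarrow> 'e \<Rightarrow> real. slow Basis UNIV h \<and>
    (\<forall>x\<in>A1 - A2. \<exists>N. open N \<and> x \<in> N \<and> (\<forall>\<^sub>F \<epsilon> in at_right 0. \<forall>y\<in>N. h \<epsilon> y = 1)) \<and>
    (\<forall>x\<in>A2 - A1. \<exists>N. open N \<and> x \<in> N \<and> (\<forall>\<^sub>F \<epsilon> in at_right 0. \<forall>y\<in>N. h \<epsilon> y = 0))"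
proof -
  consider "A1 = {}" | "A2 = {}" | "A1 \<noteq> {}" "A2 \<noteq> {}" by blast
  then show ?thesis
  proof cases
    case 1
    then show ?thesis using slow_zero[of Basis UNIV]
      by (intro exI[of _ "\<lambda>\<epsilon> x. 0"]) (auto intro!: exI[of _ UNIV])
  next
    case 2
    have "slow Basis UNIV (\<lambda>\<epsilon> x::'e. 1::real)"
      using smooth_fun_const[OF openin_span_Basis_UNIV] by (simp add: slow_const_iff)
    then show ?thesis using 2
      by (intro exI[of _ "\<lambda>\<epsilon> x. 1"]) (auto intro!: exI[of _ UNIV])
  next
    case 3
    define d1 where "d1 x = infdist x A1" for x
    define d2 where "d2 x = infdist x A2" for x
    have cont: "continuous_on UNIV d1" "continuous_on UNIV d2"
      unfolding d1_def d2_def by (intro continuous_intros)+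
    have d0: "d1 x \<ge> 0" "d2 x \<ge> 0" for x by (simp_all add: d1_def d2_def infdist_nonneg)
    have dz: "d1 x = 0 \<longleftrightarrow> x \<in> A1" "d2 x = 0 \<longleftrightarrow> x \<in> A2" for x
      using A 3 by (simp_all add: d1_def d2_def in_closed_iff_infdist_zero)
    \<comment> \<open>The cones \<open>d1 \<le> d2 / 3\<close> and \<open>d2 \<le> d1 / 3\<close> contain neighbourhoods of the points of \<open>A1 - A2\<close>
      and \<open>A2 - A1\<close>, and they meet only where both distances vanish.\<close>
    define P where "P j = {x. d1 x \<le> d2 x / 3 \<and> 1 / real (Suc j) \<le> d2 x} \<inter> cball 0 (real j)" for j
    define Q where "Q j = {x. d2 x \<le> d1 x / 3 \<and> 1 / real (Suc j) \<le> d1 x}" for j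
    have "\<forall>j. \<exists>G::'e \<Rightarrow> real. smooth_fun Basis UNIV G \<and> (\<forall>x\<in>P j. G x = 1) \<and> (\<forall>x\<in>Q j. G x = 0)"
    proof
      fix j
      have "closed {x. d1 x \<le> d2 x / 3 \<and> 1 / real (Suc j) \<le> d2 x}"
        by (intro closed_Collect_conj closed_Collect_le continuous_intros cont) auto
      then have P: "compact (P j)" unfolding P_def by (intro closed_Int_compact) auto
      have "closed (Q j)"
        unfolding Q_def by (intro closed_Collect_conj closed_Collect_le continuous_intros cont) auto
      then have Q: "open (- Q j)" by (simp add: open_Compl)
      have "P j \<subseteq> - Q j"
      proof
        fix x assume x: "x \<in> P j"
        show "x \<in> - Q j"
        proof
          assume "x \<in> Q j"
          then have "d2 x \<le> d1 x / 3" by (simp add: Q_def)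
          moreover have "d1 x \<le> d2 x / 3" "1 / real (Suc j) \<le> d2 x" using x by (auto simp: P_def)
          moreover have "1 / real (Suc j) > 0" by simp
          ultimately show False by linarith
        qed
      qed
      then obtain G :: "'e \<Rightarrow> real" and C where "smooth_fun Basis UNIV G" "C \<subseteq> - Q j"
        "\<And>x. x \<notin> C \<Longrightarrow> G x = 0" "\<And>x. x \<in> P j \<Longrightarrow> G x = 1"
        by (rule smooth_urysohn[OF P Q]) blast
      then show "\<exists>G::'e \<Rightarrow> real. smooth_fun Basis UNIV G \<and> (\<forall>x\<in>P j. G x = 1) \<and> (\<forall>x\<in>Q j. G x = 0)"
        by (intro exI[of _ G]) auto
    qed
    from choice[OF this] obtain G :: "nat \<Rightarrow> 'e \<Rightarrow> real" where
      G: "\<And>j. smooth_fun Basis UNIV (G j)" "\<And>j x. x \<in> P j \<Longrightarrow> G j x = 1" "\<And>j x. x \<in> Q j \<Longrightarrow> G j x = 0"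
      by blast
    obtain j where j: "filterlim j at_top (at_right 0)" "slow Basis UNIV (\<lambda>\<epsilon>. G (j \<epsilon>))"
      using slow_diagonal[of G, OF G(1)] by blast
    have small: "\<forall>\<^sub>F \<epsilon> in at_right 0. 1 / real (Suc (j \<epsilon>)) \<le> c \<and> R \<le> real (j \<epsilon>)" if "c > 0" for c R :: real
    proof -
      have "\<forall>\<^sub>F \<epsilon> in at_right 0. nat \<lceil>1 / c\<rceil> \<le> j \<epsilon>" "\<forall>\<^sub>F \<epsilon> in at_right 0. nat \<lceil>R\<rceil> \<le> j \<epsilon>"
        using j(1) unfolding filterlim_at_top by blast+
      then show ?thesis
      proof eventually_elim
        case (elim \<epsilon>)
        then have "1 / c \<le> real (j \<epsilon>)" "R \<le> real (j \<epsilon>)" by linarith+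
        moreover from this have "1 \<le> c * real (j \<epsilon>)" using that by (simp add: field_simps)
        then have "1 \<le> c * real (Suc (j \<epsilon>))" using that by (simp add: algebra_simps)
        then have "1 / real (Suc (j \<epsilon>)) \<le> c" by (simp add: divide_le_eq)
        ultimately show ?case by simp
      qed
    qed
    have "\<exists>N. open N \<and> x \<in> N \<and> (\<forall>\<^sub>F \<epsilon> in at_right 0. \<forall>y\<in>N. G (j \<epsilon>) y = 1)" if x: "x \<in> A1 - A2" for x
    proof -
      have d: "d1 x = 0" "d2 x > 0" using x dz[of x] d0[of x] by (auto simp: order_le_less)
      define N where "N = {y. d1 y < d2 y / 3 \<and> d2 x / 2 < d2 y \<and> norm y < norm x + 1}"
      have "open N" unfolding N_def by (intro open_Collect_conj open_Collect_less continuous_intros cont) auto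
      moreover have "x \<in> N" using d by (simp add: N_def)
      moreover have "\<forall>\<^sub>F \<epsilon> in at_right 0. \<forall>y\<in>N. G (j \<epsilon>) y = 1"
        using small[of "d2 x / 2" "norm x + 1"] d(2)
        by (auto elim!: eventually_mono intro!: G(2) simp: N_def P_def)
      ultimately show ?thesis by blast
    qed
    moreover have "\<exists>N. open N \<and> x \<in> N \<and> (\<forall>\<^sub>F \<epsilon> in at_right 0. \<forall>y\<in>N. G (j \<epsilon>) y = 0)" if x: "x \<in> A2 - A1" for x
    proof -
      have d: "d2 x = 0" "d1 x > 0" using x dz[of x] d0[of x] by (auto simp: order_le_less)
      define N where "N = {y. d2 y < d1 y / 3 \<and> d1 x / 2 < d1 y}"
      have "open N" unfolding N_def by (intro open_Collect_conj open_Collect_less continuous_intros cont) auto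
      moreover have "x \<in> N" using d by (simp add: N_def)
      moreover have "\<forall>\<^sub>F \<epsilon> in at_right 0. \<forall>y\<in>N. G (j \<epsilon>) y = 0"
        using small[of "d1 x / 2" 0] d(2)
        by (auto elim!: eventually_mono intro!: G(3) simp: N_def Q_def)
      ultimately show ?thesis by blast
    qed
    ultimately show ?thesis using j(2) by blast
  qed
qed

section \<open>Charts and slow scale nets on a manifold\<close>

definition slow_on_mfd ::
  "('a, 'e::euclidean_space) manifold \<Rightarrow> 'a set \<Rightarrow> (real \<Rightarrow> 'a \<Rightarrow> 'b::real_normed_vector) \<Rightarrow> bool" where
  "slow_on_mfd X \<Omega> g \<longleftrightarrow>
     (\<forall>V \<phi>. (V, \<phi>) \<in> atlas X \<longrightarrow> V \<subseteq> \<Omega> \<longrightarrow>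
        slow (dirs X) (\<phi> ` V) (\<lambda>\<epsilon> x. g \<epsilon> (inv_into V \<phi> x)))"

lemma smooth_on_mfd_iff_slow_on_mfd: "smooth_on_mfd X \<Omega> u \<longleftrightarrow> slow_on_mfd X \<Omega> (\<lambda>\<epsilon>. u)"
  unfolding smooth_on_mfd_def slow_on_mfd_def charts_of_def slow_const_iff o_def by blast

lemma slow_on_mfd_mono: "slow_on_mfd X \<Omega> g \<Longrightarrow> \<Omega>' \<subseteq> \<Omega> \<Longrightarrow> slow_on_mfd X \<Omega>' g"
  unfolding slow_on_mfd_def by blast

lemma smooth_on_mfd_mono: "smooth_on_mfd X \<Omega> u \<Longrightarrow> \<Omega>' \<subseteq> \<Omega> \<Longrightarrow> smooth_on_mfd X \<Omega>' u"
  unfolding smooth_on_mfd_def charts_of_def by blast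

lemma inv_into_subset:
  assumes "inj_on f V" "V' \<subseteq> V" "x \<in> f ` V'"
  shows "inv_into V' f x = inv_into V f x"
  using assms by (metis (no_types, lifting) f_inv_into_f image_mono inj_on_subset inv_into_f_f inv_into_into subset_iff)

locale smooth_mfd =
  fixes X :: "('a, 'e::euclidean_space) manifold"
  assumes smooth: "smooth_manifold X"
begin

lemma dirs_cases: "dirs X = Basis \<or> dirs X = {}"
  using smooth by (simp add: smooth_manifold_def)

lemma closed_span_dirs: "closed (span (dirs X))"
  by (simp add: closed_subspace)

lemma chart_is_chart: "(V, \<phi>) \<in> atlas X \<Longrightarrow> is_chart X (V, \<phi>)"
  using smooth unfolding smooth_manifold_def by blast

lemma chart_open: "(V, \<phi>) \<in> atlas X \<Longrightarrow> openin (mtop X) V"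
  using chart_is_chart[of V \<phi>] by (simp add: is_chart_def)

lemma chart_open_image: "(V, \<phi>) \<in> atlas X \<Longrightarrow> openin (top_of_set (span (dirs X))) (\<phi> ` V)"
  using chart_is_chart[of V \<phi>] by (simp add: is_chart_def)

lemma chart_homeomorphic:
  "(V, \<phi>) \<in> atlas X \<Longrightarrow> homeomorphic_map (subtopology (mtop X) V) (top_of_set (\<phi> ` V)) \<phi>"
  using chart_is_chart[of V \<phi>] by (simp add: is_chart_def)

lemma chart_topspace: "(V, \<phi>) \<in> atlas X \<Longrightarrow> topspace (subtopology (mtop X) V) = V"
  using openin_subset[OF chart_open[of V \<phi>]] by auto

lemma chart_inj_on: "(V, \<phi>) \<in> atlas X \<Longrightarrow> inj_on \<phi> V"
  using homeomorphic_imp_injective_map[OF chart_homeomorphic[of V \<phi>]] chart_topspace by metis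

lemma chart_open_preimage:
  assumes c: "(V, \<phi>) \<in> atlas X" and O': "open O'"
  shows "openin (mtop X) {p \<in> V. \<phi> p \<in> O'}"
proof -
  have "openin (subtopology (mtop X) V) {p \<in> topspace (subtopology (mtop X) V). \<phi> p \<in> \<phi> ` V \<inter> O'}"
    by (rule openin_continuous_map_preimage[OF homeomorphic_imp_continuous_map[OF chart_homeomorphic[OF c]]])
       (use O' in \<open>simp add: openin_open_Int\<close>)
  moreover have "{p \<in> topspace (subtopology (mtop X) V). \<phi> p \<in> \<phi> ` V \<inter> O'} = {p \<in> V. \<phi> p \<in> O'}"
    unfolding chart_topspace[OF c] by auto
  ultimately show ?thesis using openin_trans_full[OF _ chart_open[OF c]] by simp
qed

lemma chart_open_image_subset:
  assumes c: "(V, \<phi>) \<in> atlas X" and O': "openin (mtop X) O'" "O' \<subseteq> V"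
  shows "openin (top_of_set (span (dirs X))) (\<phi> ` O')"
proof -
  have "openin (subtopology (mtop X) V) O'" using O' by (simp add: openin_subtopology_alt) (metis inf.absorb2 image_iff mem_Collect_eq)
  then have "openin (top_of_set (\<phi> ` V)) (\<phi> ` O')"
    using homeomorphic_imp_open_map[OF chart_homeomorphic[OF c]] by (simp add: open_map_def)
  then show ?thesis using chart_open_image[OF c] openin_trans by blast
qed

lemma charts_compatible:
  assumes "(V, \<phi>) \<in> atlas X" "(V', \<phi>') \<in> atlas X"
  shows "smooth_fun (dirs X) (\<phi> ` (V \<inter> V')) (\<lambda>x. \<phi>' (inv_into V \<phi> x))"
proof -
  have "compatible X (V, \<phi>) (V', \<phi>')" using smooth assms unfolding smooth_manifold_def by blast
  then show ?thesis by (simp add: compatible_def smooth_transition_def o_def)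
qed

text \<open>
  The restricted chart is compatible with the whole atlas, hence belongs to it by maximality.
\<close>

lemma chart_restrict:
  assumes c: "(V, \<phi>) \<in> atlas X" and V': "openin (mtop X) V'" "V' \<subseteq> V"
  shows "(V', \<phi>) \<in> atlas X"
proof -
  have "homeomorphic_map (subtopology (subtopology (mtop X) V) V') (subtopology (top_of_set (\<phi> ` V)) (\<phi> ` V')) \<phi>"
    by (rule homeomorphic_map_subtopologies[OF chart_homeomorphic[OF c]])
       (unfold chart_topspace[OF c], use V' in auto)
  moreover have "subtopology (subtopology (mtop X) V) V' = subtopology (mtop X) V'"
    using V' by (simp add: subtopology_subtopology inf.absorb2)
  moreover have "subtopology (top_of_set (\<phi> ` V)) (\<phi> ` V') = top_of_set (\<phi> ` V')"
    using V' by (simp add: subtopology_subtopology inf.absorb2 image_mono)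
  ultimately have "is_chart X (V', \<phi>)"
    using V' chart_open_image_subset[OF c V'] by (simp add: is_chart_def)
  moreover have "compatible X (V', \<phi>) (V2, \<phi>2)" if c2: "(V2, \<phi>2) \<in> atlas X" for V2 \<phi>2
    unfolding compatible_def smooth_transition_def split o_def
  proof
    have o: "openin (top_of_set (span (dirs X))) (\<phi> ` (V' \<inter> V2))"
      using V' chart_open[OF c2] by (intro chart_open_image_subset[OF c]) auto
    have s: "smooth_fun (dirs X) (\<phi> ` (V' \<inter> V2)) (\<lambda>x. \<phi>2 (inv_into V \<phi> x))"
      by (rule smooth_fun_subset[OF charts_compatible[OF c c2]]) (use V' in auto)
    show "smooth_fun (dirs X) (\<phi> ` (V' \<inter> V2)) (\<lambda>x. \<phi>2 (inv_into V' \<phi> x))"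
      by (rule smooth_fun_cong[OF o _ s])
         (use inv_into_subset[OF chart_inj_on[OF c] V'(2)] in auto)
    show "smooth_fun (dirs X) (\<phi>2 ` (V2 \<inter> V')) (\<lambda>x. \<phi> (inv_into V2 \<phi>2 x))"
      by (rule smooth_fun_subset[OF charts_compatible[OF c2 c]]) (use V' in auto)
  qed
  ultimately show ?thesis using smooth unfolding smooth_manifold_def by (metis surj_pair)
qed

lemma chart_at:
  assumes "openin (mtop X) \<Omega>" "p \<in> \<Omega>"
  obtains V \<phi> where "(V, \<phi>) \<in> atlas X" "p \<in> V" "V \<subseteq> \<Omega>"
proof -
  have "p \<in> topspace (mtop X)" using assms openin_subset by blast
  then obtain V \<phi> where c: "(V, \<phi>) \<in> atlas X" "p \<in> V"
    using smooth unfolding smooth_manifold_def by blast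
  have "openin (mtop X) (V \<inter> \<Omega>)" using chart_open[OF c(1)] assms by blast
  then have "(V \<inter> \<Omega>, \<phi>) \<in> atlas X" using chart_restrict[OF c(1)] by blast
  then show ?thesis using that c assms by blast
qed

lemma slow_on_mfd_zero: "slow_on_mfd X \<Omega> (\<lambda>\<epsilon> p. 0)"
  unfolding slow_on_mfd_def by (intro allI impI slow_zero)

lemma slow_on_mfd_add: "slow_on_mfd X \<Omega> g \<Longrightarrow> slow_on_mfd X \<Omega> h \<Longrightarrow> slow_on_mfd X \<Omega> (\<lambda>\<epsilon> p. g \<epsilon> p + h \<epsilon> p)"
  unfolding slow_on_mfd_def using chart_open_image by (intro allI impI slow_add) auto

lemma slow_on_mfd_scaleR: "slow_on_mfd X \<Omega> g \<Longrightarrow> slow_on_mfd X \<Omega> h \<Longrightarrow> slow_on_mfd X \<Omega> (\<lambda>\<epsilon> p. g \<epsilon> p *\<^sub>R h \<epsilon> p)"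
  unfolding slow_on_mfd_def using chart_open_image by (intro allI impI slow_scaleR) auto

lemma slow_on_mfd_sum:
  "finite I \<Longrightarrow> (\<And>i. i \<in> I \<Longrightarrow> slow_on_mfd X \<Omega> (g i)) \<Longrightarrow> slow_on_mfd X \<Omega> (\<lambda>\<epsilon> p. \<Sum>i\<in>I. g i \<epsilon> p)"
  by (induction I rule: finite_induct) (auto intro: slow_on_mfd_zero slow_on_mfd_add)

lemma slow_on_mfd_cong:
  assumes g: "slow_on_mfd X \<Omega> g" and eq: "\<And>\<epsilon> p. \<epsilon> \<in> {0<..<1} \<Longrightarrow> p \<in> \<Omega> \<Longrightarrow> g \<epsilon> p = h \<epsilon> p"
  shows "slow_on_mfd X \<Omega> h"
  unfolding slow_on_mfd_def
proof (intro allI impI)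
  fix V \<phi> assume c: "(V, \<phi>) \<in> atlas X" "V \<subseteq> \<Omega>"
  show "slow (dirs X) (\<phi> ` V) (\<lambda>\<epsilon> x. h \<epsilon> (inv_into V \<phi> x))"
  proof (rule slow_cong[OF chart_open_image[OF c(1)]])
    show "slow (dirs X) (\<phi> ` V) (\<lambda>\<epsilon> x. g \<epsilon> (inv_into V \<phi> x))" using g c unfolding slow_on_mfd_def by blast
    show "g \<epsilon> (inv_into V \<phi> x) = h \<epsilon> (inv_into V \<phi> x)" if "\<epsilon> \<in> {0<..<1}" "x \<in> \<phi> ` V" for \<epsilon> x
      using eq[OF that(1)] inv_into_into[OF that(2)] c(2) by blast
  qed
qed

text \<open>
  Charts restrict to the open sets of a cover and their inverses agree there, so the local nature
  of slow scale nets on open sets of the model space carries over.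
\<close>

lemma slow_on_mfd_local:
  assumes loc: "\<And>p. p \<in> \<Omega> \<Longrightarrow> \<exists>N. openin (mtop X) N \<and> p \<in> N \<and> slow_on_mfd X N g"
  shows "slow_on_mfd X \<Omega> g"
  unfolding slow_on_mfd_def
proof (intro allI impI)
  fix V \<phi> assume c: "(V, \<phi>) \<in> atlas X" "V \<subseteq> \<Omega>"
  show "slow (dirs X) (\<phi> ` V) (\<lambda>\<epsilon> x. g \<epsilon> (inv_into V \<phi> x))"
  proof (rule slow_local[OF chart_open_image[OF c(1)]])
    fix x assume "x \<in> \<phi> ` V"
    then obtain p where p: "p \<in> V" "x = \<phi> p" by blast
    then obtain N where N: "openin (mtop X) N" "p \<in> N" "slow_on_mfd X N g" using loc c by blast
    have o: "openin (mtop X) (N \<inter> V)" using N chart_open[OF c(1)] by blast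
    have c': "(N \<inter> V, \<phi>) \<in> atlas X" using chart_restrict[OF c(1) o] by blast
    have "slow (dirs X) (\<phi> ` (N \<inter> V)) (\<lambda>\<epsilon> x. g \<epsilon> (inv_into (N \<inter> V) \<phi> x))"
      using N(3) c' unfolding slow_on_mfd_def by blast
    then have "slow (dirs X) (\<phi> ` (N \<inter> V)) (\<lambda>\<epsilon> x. g \<epsilon> (inv_into V \<phi> x))"
      by (rule slow_cong[OF chart_open_image[OF c'], rotated])
         (use inv_into_subset[OF chart_inj_on[OF c(1)], of "N \<inter> V"] in auto)
    then show "\<exists>U. openin (top_of_set (span (dirs X))) U \<and> x \<in> U \<and> U \<subseteq> \<phi> ` V \<and>
        slow (dirs X) U (\<lambda>\<epsilon> x. g \<epsilon> (inv_into V \<phi> x))"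
      using chart_open_image[OF c'] p N by (intro exI[of _ "\<phi> ` (N \<inter> V)"]) auto
  qed
qed

text \<open>
  It suffices that the net is slow in one chart: in any other chart it is composed with a transition
  map, which is smooth.
\<close>

lemma slow_on_mfd_chart:
  assumes c0: "(V\<^sub>0, \<phi>\<^sub>0) \<in> atlas X" and G: "slow Basis UNIV G"
  shows "slow_on_mfd X V\<^sub>0 (\<lambda>\<epsilon> p. G \<epsilon> (\<phi>\<^sub>0 p))"
  unfolding slow_on_mfd_def
proof (intro allI impI)
  fix V \<phi> assume c: "(V, \<phi>) \<in> atlas X" "V \<subseteq> V\<^sub>0"
  have "smooth_fun (dirs X) (\<phi> ` V) (\<lambda>x. \<phi>\<^sub>0 (inv_into V \<phi> x))"
    using charts_compatible[OF c(1) c0] c(2) by (simp add: inf.absorb1)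
  then show "slow (dirs X) (\<phi> ` V) (\<lambda>\<epsilon> x. G \<epsilon> (\<phi>\<^sub>0 (inv_into V \<phi> x)))"
    using slow_compose[OF _ chart_open_image[OF c(1)] openin_span_Basis_UNIV _ _ G] by blast
qed

lemma chart_compact_preimage:
  assumes c: "(V, \<phi>) \<in> atlas X" and C: "compact C" "C \<inter> span (dirs X) \<subseteq> \<phi> ` V"
  shows "compactin (mtop X) {p \<in> V. \<phi> p \<in> C}"
proof -
  have sub: "\<phi> ` V \<subseteq> span (dirs X)" using openin_imp_subset[OF chart_open_image[OF c]] .
  have im: "\<phi> ` {p \<in> V. \<phi> p \<in> C} = C \<inter> span (dirs X)" using sub C(2) by auto
  have "compact (C \<inter> span (dirs X))" using C(1) closed_span_dirs by (rule compact_Int_closed)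
  then have "compactin (top_of_set (\<phi> ` V)) (\<phi> ` {p \<in> V. \<phi> p \<in> C})"
    unfolding im using C(2) by (simp add: compactin_subtopology)
  then have "compactin (subtopology (mtop X) V) {p \<in> V. \<phi> p \<in> C}"
    using homeomorphic_map_compactness[OF chart_homeomorphic[OF c], of "{p \<in> V. \<phi> p \<in> C}"]
    unfolding chart_topspace[OF c] by auto
  then show ?thesis by (simp add: compactin_subtopology)
qed

lemma chart_cball:
  assumes c: "(V, \<phi>) \<in> atlas X" and p: "p \<in> V"
  obtains r where "r > 0" "cball (\<phi> p) r \<inter> span (dirs X) \<subseteq> \<phi> ` V"
proof -
  from chart_open_image[OF c] obtain O' where O': "open O'" "\<phi> ` V = span (dirs X) \<inter> O'"
    by (auto simp: openin_open)
  then have "\<phi> p \<in> O'" using p by auto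
  then obtain r where "r > 0" "cball (\<phi> p) r \<subseteq> O'" using O'(1) open_contains_cball by blast
  then show ?thesis using that O'(2) by blast
qed

lemma chart_ball_at:
  assumes \<Omega>: "openin (mtop X) \<Omega>" and p: "p \<in> \<Omega>"
  obtains V \<phi> D N where "(V, \<phi>) \<in> atlas X" "V \<subseteq> \<Omega>" "compact D" "D \<subseteq> \<phi> ` V"
    "openin (mtop X) N" "p \<in> N" "N \<subseteq> {q \<in> V. \<phi> q \<in> D}"
proof -
  obtain V \<phi> where c: "(V, \<phi>) \<in> atlas X" "p \<in> V" "V \<subseteq> \<Omega>" by (rule chart_at[OF \<Omega> p])
  obtain r where r: "r > 0" "cball (\<phi> p) r \<inter> span (dirs X) \<subseteq> \<phi> ` V" by (rule chart_cball[OF c(1,2)])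
  show ?thesis
  proof (rule that[OF c(1,3) _ r(2)])
    show "compact (cball (\<phi> p) r \<inter> span (dirs X))" using closed_span_dirs by (intro compact_Int_closed) auto
    show "openin (mtop X) {q \<in> V. \<phi> q \<in> ball (\<phi> p) r}" by (rule chart_open_preimage[OF c(1) open_ball])
  qed (use c(2) r(1) openin_imp_subset[OF chart_open_image[OF c(1)]] in auto)
qed

end

locale hausdorff_mfd = smooth_mfd X for X :: "('a, 'e::euclidean_space) manifold" +
  assumes hausdorff: "Hausdorff_space (mtop X)"
begin

text \<open>
  The preimage of \<^term>\<open>C\<close> is compact, hence closed in a Hausdorff space, so the chart domain and the
  complement of that preimage form an open cover, on both members of which the net is slow.
\<close>

lemma slow_on_mfd_extend_by_zero:
  assumes c: "(V, \<phi>) \<in> atlas X" and G: "slow Basis UNIV G"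
    and C: "compact C" "C \<inter> span (dirs X) \<subseteq> \<phi> ` V" "\<And>\<epsilon> x. x \<notin> C \<Longrightarrow> G \<epsilon> x = 0"
  shows "slow_on_mfd X (topspace (mtop X)) (\<lambda>\<epsilon> p. if p \<in> V then G \<epsilon> (\<phi> p) else 0)"
proof (rule slow_on_mfd_local)
  define S where "S = {p \<in> V. \<phi> p \<in> C}"
  have "closedin (mtop X) S"
    unfolding S_def by (rule compactin_imp_closedin[OF hausdorff chart_compact_preimage[OF c C(1,2)]])
  then have "openin (mtop X) (topspace (mtop X) - S)" by blast
  moreover have "slow_on_mfd X (topspace (mtop X) - S) (\<lambda>\<epsilon> p. if p \<in> V then G \<epsilon> (\<phi> p) else 0)"
    by (rule slow_on_mfd_cong[OF slow_on_mfd_zero]) (use C(3) in \<open>auto simp: S_def\<close>)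
  moreover have "slow_on_mfd X V (\<lambda>\<epsilon> p. if p \<in> V then G \<epsilon> (\<phi> p) else 0)"
    by (rule slow_on_mfd_cong[OF slow_on_mfd_chart[OF c G]]) auto
  moreover fix p assume "p \<in> topspace (mtop X)"
  ultimately show "\<exists>N. openin (mtop X) N \<and> p \<in> N \<and> slow_on_mfd X N (\<lambda>\<epsilon> p. if p \<in> V then G \<epsilon> (\<phi> p) else 0)"
    using chart_open[OF c] S_def by (cases "p \<in> V") blast+
qed

lemma smooth_local_bump:
  assumes \<Omega>: "openin (mtop X) \<Omega>" and p: "p \<in> \<Omega>"
  obtains \<rho> :: "'a \<Rightarrow> real" and S N where "slow_on_mfd X (topspace (mtop X)) (\<lambda>\<epsilon>. \<rho>)"
    "closedin (mtop X) S" "S \<subseteq> \<Omega>" "\<And>q. q \<notin> S \<Longrightarrow> \<rho> q = 0"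
    "openin (mtop X) N" "p \<in> N" "N \<subseteq> \<Omega>" "\<And>q. q \<in> N \<Longrightarrow> \<rho> q = 1"
proof -
  obtain V \<phi> where c: "(V, \<phi>) \<in> atlas X" "p \<in> V" "V \<subseteq> \<Omega>" by (rule chart_at[OF \<Omega> p])
  from chart_open_image[OF c(1)] obtain O' where O': "open O'" "\<phi> ` V = span (dirs X) \<inter> O'"
    by (auto simp: openin_open)
  then have "\<phi> p \<in> O'" using c(2) by auto
  then obtain r where r: "r > 0" "cball (\<phi> p) r \<subseteq> O'" using O'(1) open_contains_cball by blast
  obtain G :: "'e \<Rightarrow> real" and C where G: "smooth_fun Basis UNIV G" "compact C" "C \<subseteq> O'"
    "\<And>x. x \<notin> C \<Longrightarrow> G x = 0" "\<And>x. x \<in> cball (\<phi> p) r \<Longrightarrow> G x = 1"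
    by (rule smooth_urysohn[OF compact_cball O'(1) r(2)]) blast
  have C: "C \<inter> span (dirs X) \<subseteq> \<phi> ` V" using G(3) O'(2) by blast
  show ?thesis
  proof (rule that[of "\<lambda>q. if q \<in> V then G (\<phi> q) else 0" "{q \<in> V. \<phi> q \<in> C}" "{q \<in> V. \<phi> q \<in> ball (\<phi> p) r}"])
    show "slow_on_mfd X (topspace (mtop X)) (\<lambda>\<epsilon> q. if q \<in> V then G (\<phi> q) else 0)"
      using slow_on_mfd_extend_by_zero[OF c(1), of "\<lambda>\<epsilon>. G" C] G(1,2,4) C by (simp add: slow_const_iff)
    show "closedin (mtop X) {q \<in> V. \<phi> q \<in> C}"
      by (rule compactin_imp_closedin[OF hausdorff chart_compact_preimage[OF c(1) G(2) C]])
    show "openin (mtop X) {q \<in> V. \<phi> q \<in> ball (\<phi> p) r}"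
      by (rule chart_open_preimage[OF c(1) open_ball])
  qed (use c r G in auto)
qed

end

section \<open>Moderate and negligible nets on a manifold\<close>

lemma partials_add_scaleR:
  assumes W: "openin (top_of_set (span B)) W" and f: "smooth_fun B W f" and g: "smooth_fun B W g"
    and "set bs \<subseteq> B" "x \<in> W"
  shows "partials bs (\<lambda>y. f y + c *\<^sub>R g y) x = partials bs f x + c *\<^sub>R partials bs g x"
  using assms(4,5)
proof (induction bs arbitrary: x)
  case (Cons b bs)
  then have b: "b \<in> B" "set bs \<subseteq> B" by auto
  have "partial_deriv b (partials bs (\<lambda>y. f y + c *\<^sub>R g y)) x
      = partial_deriv b (\<lambda>y. partials bs f y + c *\<^sub>R partials bs g y) x"
    by (rule partial_deriv_cong[OF W Cons.prems(2) b(1)]) (rule Cons.IH[OF b(2)])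
  also have "\<dots> = partial_deriv b (partials bs f) x + c *\<^sub>R partial_deriv b (partials bs g) x"
  proof (rule partial_deriv_eqI)
    have "(\<lambda>t::real. partials bs f (x + t *\<^sub>R b)) differentiable (at 0)"
         "(\<lambda>t::real. partials bs g (x + t *\<^sub>R b)) differentiable (at 0)"
      using f g b Cons.prems(2) by (simp_all add: smooth_fun_def)
    from this[THEN line_has_vector_derivative]
    show "((\<lambda>t. partials bs f (x + t *\<^sub>R b) + c *\<^sub>R partials bs g (x + t *\<^sub>R b)) has_vector_derivative
        partial_deriv b (partials bs f) x + c *\<^sub>R partial_deriv b (partials bs g) x) (at 0)"
      by (intro has_vector_derivative_add bounded_linear.has_vector_derivative[OF bounded_linear_scaleR_right])
  qed
  finally show ?case by simp
qed simp

definition chart_coeffs ::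
  "('a, 'e::euclidean_space) manifold \<Rightarrow> 'a set \<Rightarrow> (('a \<Rightarrow> 'k) \<Rightarrow> 'a \<Rightarrow> 'k::{real_normed_field,euclidean_space}) \<Rightarrow>
     nat \<Rightarrow> 'a set \<Rightarrow> ('a \<Rightarrow> 'e) \<Rightarrow> ('e list \<Rightarrow> 'e \<Rightarrow> 'k) \<Rightarrow> bool" where
  "chart_coeffs X \<Omega> P k V \<phi> a \<longleftrightarrow>
     (\<forall>bs. smooth_fun (dirs X) (\<phi> ` V) (a bs)) \<and>
     (\<forall>u. smooth_on_mfd X \<Omega> u \<longrightarrow> (\<forall>p\<in>V. P u p = (\<Sum>bs | set bs \<subseteq> dirs X \<and> length bs \<le> k.
        a bs (\<phi> p) * partials bs (u \<circ> inv_into V \<phi>) (\<phi> p))))"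

lemma lin_diff_op_iff_chart_coeffs:
  "lin_diff_op X \<Omega> P \<longleftrightarrow> (\<exists>k. \<forall>(V, \<phi>)\<in>charts_of X \<Omega>. \<exists>a. chart_coeffs X \<Omega> P k V \<phi> a)"
  unfolding lin_diff_op_def chart_coeffs_def ..

lemma charts_ofI: "(V, \<phi>) \<in> atlas X \<Longrightarrow> V \<subseteq> \<Omega> \<Longrightarrow> (V, \<phi>) \<in> charts_of X \<Omega>"
  by (simp add: charts_of_def)

context smooth_mfd
begin

lemma slow_on_mfd_const: "slow_on_mfd X \<Omega> (\<lambda>\<epsilon> p. c)"
  unfolding slow_on_mfd_def slow_const_iff using chart_open_image by (intro allI impI smooth_fun_const) auto

lemma smooth_on_mfd_add_scaleR:
  assumes "smooth_on_mfd X \<Omega> u" "smooth_on_mfd X \<Omega> v"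
  shows "smooth_on_mfd X \<Omega> (\<lambda>p. u p + c *\<^sub>R v p)"
  using assms unfolding smooth_on_mfd_iff_slow_on_mfd
  by (intro slow_on_mfd_add slow_on_mfd_scaleR[OF slow_on_mfd_const])

lemma lin_diff_op_add_scaleR:
  fixes u v :: "'a \<Rightarrow> 'k::{real_normed_field,euclidean_space}"
  assumes P: "lin_diff_op X \<Omega> P" and \<Omega>: "openin (mtop X) \<Omega>" and p: "p \<in> \<Omega>"
    and u: "smooth_on_mfd X \<Omega> u" and v: "smooth_on_mfd X \<Omega> v"
  shows "P (\<lambda>q. u q + c *\<^sub>R v q) p = P u p + c *\<^sub>R P v p"
proof -
  obtain V \<phi> where c: "(V, \<phi>) \<in> atlas X" "p \<in> V" "V \<subseteq> \<Omega>" by (rule chart_at[OF \<Omega> p])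
  have c': "(V, \<phi>) \<in> charts_of X \<Omega>" using c by (intro charts_ofI)
  from P obtain k where "\<forall>(V, \<phi>)\<in>charts_of X \<Omega>. \<exists>a. chart_coeffs X \<Omega> P k V \<phi> a"
    unfolding lin_diff_op_iff_chart_coeffs by blast
  from bspec[OF this c'] obtain a :: "'e list \<Rightarrow> 'e \<Rightarrow> 'k" where
    a: "\<And>u. smooth_on_mfd X \<Omega> u \<Longrightarrow> P u p = (\<Sum>bs | set bs \<subseteq> dirs X \<and> length bs \<le> k.
                      a bs (\<phi> p) * partials bs (u \<circ> inv_into V \<phi>) (\<phi> p))"
    using c(2) by (auto simp: chart_coeffs_def)
  have su: "smooth_fun (dirs X) (\<phi> ` V) (u \<circ> inv_into V \<phi>)" and sv: "smooth_fun (dirs X) (\<phi> ` V) (v \<circ> inv_into V \<phi>)"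
    using u v c' unfolding smooth_on_mfd_def by auto
  have "partials bs ((\<lambda>q. u q + c *\<^sub>R v q) \<circ> inv_into V \<phi>) (\<phi> p)
      = partials bs (u \<circ> inv_into V \<phi>) (\<phi> p) + c *\<^sub>R partials bs (v \<circ> inv_into V \<phi>) (\<phi> p)"
    if "set bs \<subseteq> dirs X" for bs
    using partials_add_scaleR[OF chart_open_image[OF c(1)] su sv that, of "\<phi> p" c] c(2) by (simp add: o_def)
  then show ?thesis
    unfolding a[OF u] a[OF v] a[OF smooth_on_mfd_add_scaleR[OF u v]]
    by (simp add: distrib_left sum.distrib scaleR_sum_right)
qed

lemma moderate_add_scaleR:
  fixes u v :: "real \<Rightarrow> 'a \<Rightarrow> 'k::{real_normed_field,euclidean_space}"
  assumes \<Omega>: "openin (mtop X) \<Omega>" and u: "u \<in> moderate_nets X \<Omega>" and v: "v \<in> moderate_nets X \<Omega>"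
  shows "(\<lambda>\<epsilon> p. u \<epsilon> p + c *\<^sub>R v \<epsilon> p) \<in> moderate_nets X \<Omega>"
  unfolding moderate_nets_def
proof (intro CollectI conjI ballI allI impI)
  have sm: "smooth_on_mfd X \<Omega> (u \<epsilon>)" "smooth_on_mfd X \<Omega> (v \<epsilon>)" if "\<epsilon> \<in> {0<..<1}" for \<epsilon>
    using u v that unfolding moderate_nets_def by auto
  show "smooth_on_mfd X \<Omega> (\<lambda>p. u \<epsilon> p + c *\<^sub>R v \<epsilon> p)" if "\<epsilon> \<in> {0<..<1}" for \<epsilon>
    by (intro smooth_on_mfd_add_scaleR sm that)
  fix K and P :: "('a \<Rightarrow> 'k) \<Rightarrow> 'a \<Rightarrow> 'k"
  assume KP: "compactin (mtop X) K \<and> K \<subseteq> \<Omega> \<and> lin_diff_op X \<Omega> P"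
  then obtain N1 N2 :: nat where "sup_bigo K (\<lambda>\<epsilon>. P (u \<epsilon>)) (- real N1)" "sup_bigo K (\<lambda>\<epsilon>. P (v \<epsilon>)) (- real N2)"
    using u v unfolding moderate_nets_def by blast
  then have "sup_bigo K (\<lambda>\<epsilon>. P (u \<epsilon>)) (- real (max N1 N2))" "sup_bigo K (\<lambda>\<epsilon>. P (v \<epsilon>)) (- real (max N1 N2))"
    by (auto elim: sup_bigo_antimono)
  then have "sup_bigo K (\<lambda>\<epsilon> p. P (u \<epsilon>) p + c *\<^sub>R P (v \<epsilon>) p) (- real (max N1 N2))"
    by (intro sup_bigo_add sup_bigo_scaleR)
  moreover have "\<forall>\<^sub>F \<epsilon> in at_right 0. \<forall>p\<in>K. P (\<lambda>q. u \<epsilon> q + c *\<^sub>R v \<epsilon> q) p = P (u \<epsilon>) p + c *\<^sub>R P (v \<epsilon>) p"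
    using eventually_at_right_0_unit
  proof eventually_elim
    case (elim \<epsilon>)
    show ?case using KP by (intro ballI lin_diff_op_add_scaleR[OF _ \<Omega> _ sm[OF elim]]) auto
  qed
  ultimately have "sup_bigo K (\<lambda>\<epsilon>. P (\<lambda>p. u \<epsilon> p + c *\<^sub>R v \<epsilon> p)) (- real (max N1 N2))"
    by (rule sup_bigo_cong)
  then show "\<exists>N::nat. sup_bigo K (\<lambda>\<epsilon>. P (\<lambda>p. u \<epsilon> p + c *\<^sub>R v \<epsilon> p)) (- real N)" ..
qed

lemma negligible_add_scaleR:
  fixes u v :: "real \<Rightarrow> 'a \<Rightarrow> 'k::{real_normed_field,euclidean_space}"
  assumes \<Omega>: "openin (mtop X) \<Omega>" and u: "u \<in> negligible_nets X \<Omega>" and v: "v \<in> negligible_nets X \<Omega>"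
  shows "(\<lambda>\<epsilon> p. u \<epsilon> p + c *\<^sub>R v \<epsilon> p) \<in> negligible_nets X \<Omega>"
  unfolding negligible_nets_def
proof (intro CollectI conjI allI impI)
  show "(\<lambda>\<epsilon> p. u \<epsilon> p + c *\<^sub>R v \<epsilon> p) \<in> moderate_nets X \<Omega>"
    using u v by (intro moderate_add_scaleR[OF \<Omega>]) (auto simp: negligible_nets_def)
  fix K and m :: nat
  assume "compactin (mtop X) K \<and> K \<subseteq> \<Omega>"
  then have "sup_bigo K u (real m)" "sup_bigo K v (real m)"
    using u v by (auto simp: negligible_nets_def)
  then show "sup_bigo K (\<lambda>\<epsilon> p. u \<epsilon> p + c *\<^sub>R v \<epsilon> p) (real m)"
    by (intro sup_bigo_add sup_bigo_scaleR)
qed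

text \<open>
  In a chart the operator is a finite sum of smooth coefficients times partial derivatives; on a
  small compact ball the coefficients are bounded and the derivatives have a common growth exponent.
\<close>

lemma moderate_if_regular_in_charts:
  fixes u :: "real \<Rightarrow> 'a \<Rightarrow> 'k::{real_normed_field,euclidean_space}"
  assumes \<Omega>: "openin (mtop X) \<Omega>"
    and u: "\<And>V \<phi>. (V, \<phi>) \<in> charts_of X \<Omega> \<Longrightarrow> (\<lambda>\<epsilon>. u \<epsilon> \<circ> inv_into V \<phi>) \<in> regular_nets (dirs X) (\<phi> ` V)"
  shows "u \<in> moderate_nets X \<Omega>"
  unfolding moderate_nets_def
proof (intro CollectI conjI ballI allI impI)
  have sm: "smooth_on_mfd X \<Omega> (u \<epsilon>)" if "\<epsilon> \<in> {0<..<1}" for \<epsilon>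
    unfolding smooth_on_mfd_def using u that by (auto simp: regular_nets_def)
  then show "\<And>\<epsilon>. \<epsilon> \<in> {0<..<1} \<Longrightarrow> smooth_on_mfd X \<Omega> (u \<epsilon>)" .
  fix K and P :: "('a \<Rightarrow> 'k) \<Rightarrow> 'a \<Rightarrow> 'k"
  assume KP: "compactin (mtop X) K \<and> K \<subseteq> \<Omega> \<and> lin_diff_op X \<Omega> P"
  from KP obtain k where k: "\<forall>(V, \<phi>)\<in>charts_of X \<Omega>. \<exists>a. chart_coeffs X \<Omega> P k V \<phi> a"
    unfolding lin_diff_op_iff_chart_coeffs by blast
  show "\<exists>N::nat. sup_bigo K (\<lambda>\<epsilon>. P (u \<epsilon>)) (- real N)"
  proof (rule sup_bigo_compact_local_exponent[of "mtop X"])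
    show "compactin (mtop X) K" using KP by blast
    fix p assume "p \<in> K"
    then have p: "p \<in> \<Omega>" using KP by blast
    obtain V \<phi> D N where c: "(V, \<phi>) \<in> atlas X" "V \<subseteq> \<Omega>" and D: "compact D" "D \<subseteq> \<phi> ` V"
      and N: "openin (mtop X) N" "p \<in> N" "N \<subseteq> {q \<in> V. \<phi> q \<in> D}" by (rule chart_ball_at[OF \<Omega> p])
    have c': "(V, \<phi>) \<in> charts_of X \<Omega>" using c by (intro charts_ofI)
    from bspec[OF k c'] obtain a :: "'e list \<Rightarrow> 'e \<Rightarrow> 'k" where
      a: "\<And>bs. smooth_fun (dirs X) (\<phi> ` V) (a bs)" and
      Pu: "\<And>u q. smooth_on_mfd X \<Omega> u \<Longrightarrow> q \<in> V \<Longrightarrow> P u q = (\<Sum>bs | set bs \<subseteq> dirs X \<and> length bs \<le> k.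
                      a bs (\<phi> q) * partials bs (u \<circ> inv_into V \<phi>) (\<phi> q))"
      by (auto simp: chart_coeffs_def)
    obtain \<alpha> where \<alpha>: "tame (dirs X) (\<phi> ` V) D \<alpha> (\<lambda>\<epsilon>. u \<epsilon> \<circ> inv_into V \<phi>)"
      using u[OF c'] D unfolding regular_nets_iff_tame by blast
    define F where "F = {bs. set bs \<subseteq> dirs X \<and> length bs \<le> k}"
    have "finite (dirs X)" using dirs_cases by auto
    then have F: "finite F" unfolding F_def by (rule finite_lists_length_le)
    have "sup_bigo D (\<lambda>\<epsilon> x. a bs x * partials bs (u \<epsilon> \<circ> inv_into V \<phi>) x) (\<alpha> - 2)" if bs: "bs \<in> F" for bs
    proof -
      have "sup_bigo D (\<lambda>\<epsilon>. a bs) (-1)"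
        using tame_sup_bigo[OF smooth_fun_tame_const[OF a D], of "-1"] by simp
      moreover have "sup_bigo D (\<lambda>\<epsilon>. partials bs (u \<epsilon> \<circ> inv_into V \<phi>)) (\<alpha> - 1)"
        using \<alpha> bs by (simp add: tame_iff F_def)
      ultimately have "sup_bigo D (\<lambda>\<epsilon> x. a bs x * partials bs (u \<epsilon> \<circ> inv_into V \<phi>) x) (- 1 + (\<alpha> - 1))"
        by (rule sup_bigo_prod_bound) (simp add: norm_mult)
      then show ?thesis by simp
    qed
    then have "sup_bigo D (\<lambda>\<epsilon> x. \<Sum>bs\<in>F. a bs x * partials bs (u \<epsilon> \<circ> inv_into V \<phi>) x) (\<alpha> - 2)"
      by (intro sup_bigo_sum F)
    then have "sup_bigo {q \<in> V. \<phi> q \<in> D} (\<lambda>\<epsilon> q. \<Sum>bs\<in>F. a bs (\<phi> q) * partials bs (u \<epsilon> \<circ> inv_into V \<phi>) (\<phi> q)) (\<alpha> - 2)"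
      unfolding sup_bigo_def by (auto elim!: eventually_mono)
    then have "sup_bigo {q \<in> V. \<phi> q \<in> D} (\<lambda>\<epsilon>. P (u \<epsilon>)) (\<alpha> - 2)"
      by (rule sup_bigo_cong)
         (use eventually_at_right_0_unit in \<open>rule eventually_mono\<close>, use Pu sm in \<open>simp add: F_def\<close>)
    then have "sup_bigo (K \<inter> N) (\<lambda>\<epsilon>. P (u \<epsilon>)) (\<alpha> - 2)"
      by (rule sup_bigo_subset) (use N(3) in auto)
    then show "\<exists>N a. openin (mtop X) N \<and> p \<in> N \<and> sup_bigo (K \<inter> N) (\<lambda>\<epsilon>. P (u \<epsilon>)) a"
      using N(1,2) by blast
  qed
qed

end

context hausdorff_mfd
begin

text \<open>
  The extended operator has in each chart of \<^term>\<open>\<Omega>\<close> the coefficients of \<^term>\<open>P\<close> in the restricted chart,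
  multiplied by the cutoff function and extended by zero.  They are smooth because the cutoff
  function vanishes outside a closed subset of \<^term>\<open>\<Omega>'\<close>.
\<close>

lemma lin_diff_op_cutoff:
  fixes P :: "('a \<Rightarrow> 'k::{real_normed_field,euclidean_space}) \<Rightarrow> 'a \<Rightarrow> 'k"
  assumes P: "lin_diff_op X \<Omega>' P" and \<Omega>': "openin (mtop X) \<Omega>'" "\<Omega>' \<subseteq> \<Omega>"
    and \<rho>: "slow_on_mfd X (topspace (mtop X)) (\<lambda>\<epsilon>. \<rho>)"
    and S: "closedin (mtop X) S" "S \<subseteq> \<Omega>'" "\<And>q. q \<notin> S \<Longrightarrow> \<rho> q = 0"
  shows "lin_diff_op X \<Omega> (\<lambda>u q. if q \<in> \<Omega>' then \<rho> q *\<^sub>R P u q else 0)"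
proof -
  from P obtain k where k: "\<forall>(V, \<phi>)\<in>charts_of X \<Omega>'. \<exists>a. chart_coeffs X \<Omega>' P k V \<phi> a"
    unfolding lin_diff_op_iff_chart_coeffs by blast
  have "\<exists>a. chart_coeffs X \<Omega> (\<lambda>u q. if q \<in> \<Omega>' then \<rho> q *\<^sub>R P u q else 0) k V \<phi> a"
    if "(V, \<phi>) \<in> charts_of X \<Omega>" for V \<phi>
  proof -
    from that have c: "(V, \<phi>) \<in> atlas X" "V \<subseteq> \<Omega>" by (auto simp: charts_of_def)
    define V' where "V' = V \<inter> \<Omega>'"
    have V'o: "openin (mtop X) V'" "V' \<subseteq> V" using chart_open[OF c(1)] \<Omega>' by (auto simp: V'_def)
    have cV': "(V', \<phi>) \<in> atlas X" by (rule chart_restrict[OF c(1) V'o])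
    then have c': "(V', \<phi>) \<in> charts_of X \<Omega>'" by (simp add: charts_of_def V'_def)
    note inj = chart_inj_on[OF c(1)]
    from bspec[OF k c'] obtain a :: "'e list \<Rightarrow> 'e \<Rightarrow> 'k" where
      a: "\<And>bs. smooth_fun (dirs X) (\<phi> ` V') (a bs)" and
      Pu: "\<And>u q. smooth_on_mfd X \<Omega>' u \<Longrightarrow> q \<in> V' \<Longrightarrow> P u q = (\<Sum>bs | set bs \<subseteq> dirs X \<and> length bs \<le> k.
                      a bs (\<phi> q) * partials bs (u \<circ> inv_into V' \<phi>) (\<phi> q))"
      by (auto simp: chart_coeffs_def)
    define a' where "a' bs x = (if x \<in> \<phi> ` V' then \<rho> (inv_into V \<phi> x) *\<^sub>R a bs x else 0)" for bs x
    have "smooth_fun (dirs X) (\<phi> ` V) (a' bs)" for bs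
    proof (rule smooth_fun_local[OF chart_open_image[OF c(1)]])
      fix x assume "x \<in> \<phi> ` V"
      then obtain p where p: "p \<in> V" "x = \<phi> p" by blast
      show "\<exists>U. openin (top_of_set (span (dirs X))) U \<and> x \<in> U \<and> U \<subseteq> \<phi> ` V \<and> smooth_fun (dirs X) U (a' bs)"
      proof (cases "p \<in> V'")
        case True
        have "slow (dirs X) (\<phi> ` V') (\<lambda>\<epsilon> x. \<rho> (inv_into V' \<phi> x))"
          using \<rho> cV' openin_subset[OF V'o(1)] unfolding slow_on_mfd_def by blast
        then have "smooth_fun (dirs X) (\<phi> ` V') (\<lambda>x. \<rho> (inv_into V' \<phi> x))"
          by (simp add: slow_const_iff)
        then have "smooth_fun (dirs X) (\<phi> ` V') (\<lambda>x. \<rho> (inv_into V' \<phi> x) *\<^sub>R a bs x)"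
          by (rule smooth_fun_scaleR[OF chart_open_image[OF cV'] _ a])
        then have "smooth_fun (dirs X) (\<phi> ` V') (a' bs)"
          by (rule smooth_fun_cong[OF chart_open_image[OF cV'], rotated])
             (simp add: a'_def inv_into_subset[OF inj V'o(2)])
        then show ?thesis using True p V'o chart_open_image[OF cV'] by (intro exI[of _ "\<phi> ` V'"]) auto
      next
        case False
        then have pS: "p \<notin> S" using S(2) p(1) by (auto simp: V'_def)
        have o: "openin (mtop X) (V - S)" using chart_open[OF c(1)] S(1) by (rule openin_diff)
        have oi: "openin (top_of_set (span (dirs X))) (\<phi> ` (V - S))"
          by (rule chart_open_image_subset[OF c(1) o]) auto
        have "a' bs y = 0" if "y \<in> \<phi> ` (V - S)" for y
        proof -
          from that obtain q where q: "q \<in> V" "q \<notin> S" "y = \<phi> q" by blast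
          then have "inv_into V \<phi> y = q" using inj by simp
          then show ?thesis using S(3)[OF q(2)] by (simp add: a'_def)
        qed
        then have "smooth_fun (dirs X) (\<phi> ` (V - S)) (a' bs)"
          by (intro smooth_fun_cong[OF oi _ smooth_fun_zero]) simp
        then show ?thesis using oi p pS by (intro exI[of _ "\<phi> ` (V - S)"]) auto
      qed
    qed
    moreover have "(if p \<in> \<Omega>' then \<rho> p *\<^sub>R P u p else 0) = (\<Sum>bs | set bs \<subseteq> dirs X \<and> length bs \<le> k.
                      a' bs (\<phi> p) * partials bs (u \<circ> inv_into V \<phi>) (\<phi> p))"
      if u: "smooth_on_mfd X \<Omega> u" and p: "p \<in> V" for u p
    proof (cases "p \<in> \<Omega>'")
      case True
      then have pV': "p \<in> V'" using p by (simp add: V'_def)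
      have "partials bs (u \<circ> inv_into V' \<phi>) (\<phi> p) = partials bs (u \<circ> inv_into V \<phi>) (\<phi> p)"
        if "set bs \<subseteq> dirs X" for bs
        using pV' inv_into_subset[OF inj V'o(2)]
        by (intro partials_cong[OF chart_open_image[OF cV'] that]) auto
      moreover have "smooth_on_mfd X \<Omega>' u" using u \<Omega>'(2) by (rule smooth_on_mfd_mono)
      moreover have "a' bs (\<phi> p) = \<rho> p *\<^sub>R a bs (\<phi> p)" for bs
        using pV' p inj by (simp add: a'_def)
      ultimately show ?thesis using True pV' by (simp add: Pu scaleR_sum_right)
    next
      case False
      then have "\<phi> p \<notin> \<phi> ` V'" using p V'o(2) inj_on_image_mem_iff[OF inj p V'o(2)] by (auto simp: V'_def)
      then show ?thesis using False by (simp add: a'_def)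
    qed
    ultimately have "chart_coeffs X \<Omega> (\<lambda>u q. if q \<in> \<Omega>' then \<rho> q *\<^sub>R P u q else 0) k V \<phi> a'"
      unfolding chart_coeffs_def by blast
    then show ?thesis by (rule exI[of _ a'])
  qed
  then show ?thesis unfolding lin_diff_op_iff_chart_coeffs by (intro exI[of _ k]) blast
qed

text \<open>
  Moderateness on \<^term>\<open>\<Omega>\<close> only speaks about operators on \<^term>\<open>\<Omega>\<close>, and an operator on a smaller set need not
  extend.  Near a given point it agrees with its product with a bump function, which does.
\<close>

lemma moderate_restrict:
  fixes u :: "real \<Rightarrow> 'a \<Rightarrow> 'k::{real_normed_field,euclidean_space}"
  assumes u: "u \<in> moderate_nets X \<Omega>" and \<Omega>': "openin (mtop X) \<Omega>'" "\<Omega>' \<subseteq> \<Omega>"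
  shows "u \<in> moderate_nets X \<Omega>'"
  unfolding moderate_nets_def
proof (intro CollectI conjI ballI allI impI)
  show "smooth_on_mfd X \<Omega>' (u \<epsilon>)" if "\<epsilon> \<in> {0<..<1}" for \<epsilon>
    using u that smooth_on_mfd_mono[OF _ \<Omega>'(2)] unfolding moderate_nets_def by blast
  fix K and P :: "('a \<Rightarrow> 'k) \<Rightarrow> 'a \<Rightarrow> 'k"
  assume KP: "compactin (mtop X) K \<and> K \<subseteq> \<Omega>' \<and> lin_diff_op X \<Omega>' P"
  show "\<exists>N::nat. sup_bigo K (\<lambda>\<epsilon>. P (u \<epsilon>)) (- real N)"
  proof (rule sup_bigo_compact_local_exponent[of "mtop X"])
    show "compactin (mtop X) K" using KP by blast
    fix p assume "p \<in> K"
    then have p: "p \<in> \<Omega>'" using KP by blast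
    obtain \<rho> :: "'a \<Rightarrow> real" and S N where \<rho>: "slow_on_mfd X (topspace (mtop X)) (\<lambda>\<epsilon>. \<rho>)"
      "closedin (mtop X) S" "S \<subseteq> \<Omega>'" "\<And>q. q \<notin> S \<Longrightarrow> \<rho> q = 0"
      "openin (mtop X) N" "p \<in> N" "N \<subseteq> \<Omega>'" "\<And>q. q \<in> N \<Longrightarrow> \<rho> q = 1"
      by (rule smooth_local_bump[OF \<Omega>'(1) p]) blast
    have "lin_diff_op X \<Omega> (\<lambda>u q. if q \<in> \<Omega>' then \<rho> q *\<^sub>R P u q else 0)"
      using KP \<rho> by (intro lin_diff_op_cutoff[OF _ \<Omega>']) auto
    moreover have "K \<subseteq> \<Omega>" using KP \<Omega>' by blast
    ultimately obtain m :: nat where "sup_bigo K (\<lambda>\<epsilon> q. if q \<in> \<Omega>' then \<rho> q *\<^sub>R P (u \<epsilon>) q else 0) (- real m)"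
      using u KP unfolding moderate_nets_def by blast
    then have "sup_bigo (K \<inter> N) (\<lambda>\<epsilon> q. if q \<in> \<Omega>' then \<rho> q *\<^sub>R P (u \<epsilon>) q else 0) (- real m)"
      by (rule sup_bigo_subset) auto
    then have "sup_bigo (K \<inter> N) (\<lambda>\<epsilon>. P (u \<epsilon>)) (- real m)"
      by (rule sup_bigo_cong) (rule always_eventually, use \<rho>(7,8) in auto)
    then show "\<exists>N a. openin (mtop X) N \<and> p \<in> N \<and> sup_bigo (K \<inter> N) (\<lambda>\<epsilon>. P (u \<epsilon>)) a"
      using \<rho>(5,6) by blast
  qed
qed

lemma negligible_restrict:
  assumes "u \<in> negligible_nets X \<Omega>" "openin (mtop X) \<Omega>'" "\<Omega>' \<subseteq> \<Omega>"
  shows "u \<in> negligible_nets X \<Omega>'"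
  using assms moderate_restrict unfolding negligible_nets_def by blast

end

section \<open>Locally finite bumps and separating nets on a manifold\<close>

locale paracompact_mfd = hausdorff_mfd X for X :: "('a, 'e::euclidean_space) manifold" +
  assumes paracompact: "paracompact_space (mtop X)"
begin

lemma locally_finite_refinement:
  assumes "\<And>p. p \<in> topspace (mtop X) \<Longrightarrow> \<exists>U. openin (mtop X) U \<and> p \<in> U \<and> Q U"
  obtains \<V> where "\<And>V. V \<in> \<V> \<Longrightarrow> openin (mtop X) V" "\<Union>\<V> = topspace (mtop X)"
    "locally_finite_in (mtop X) \<V>" "\<And>V. V \<in> \<V> \<Longrightarrow> \<exists>U. V \<subseteq> U \<and> Q U"
proof -
  define \<U> where "\<U> = {U. openin (mtop X) U \<and> Q U}"
  have "\<Union>\<U> = topspace (mtop X)"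
    unfolding \<U>_def using assms openin_subset by (intro equalityI subsetI) blast+
  moreover have "\<forall>U\<in>\<U>. openin (mtop X) U" by (simp add: \<U>_def)
  ultimately have "(\<forall>U\<in>\<U>. openin (mtop X) U) \<and> \<Union>\<U> = topspace (mtop X)" by blast
  from paracompact[unfolded paracompact_space_def, THEN spec, THEN mp, OF this]
  obtain \<V> where "\<forall>V\<in>\<V>. openin (mtop X) V" "\<Union>\<V> = topspace (mtop X)"
    "\<forall>V\<in>\<V>. \<exists>U\<in>\<U>. V \<subseteq> U" "locally_finite_in (mtop X) \<V>"
    by (elim exE conjE)
  then show ?thesis using that[of \<V>] unfolding \<U>_def by blast
qed

lemma chart_ball_closure:
  assumes c: "(V, \<phi>) \<in> atlas X" and p: "p \<in> V"
  obtains U D where "openin (mtop X) U" "p \<in> U" "U \<subseteq> D" "D \<subseteq> V" "compactin (mtop X) D" "closedin (mtop X) D"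
proof -
  obtain r where r: "r > 0" "cball (\<phi> p) r \<inter> span (dirs X) \<subseteq> \<phi> ` V" by (rule chart_cball[OF c p])
  have D: "compactin (mtop X) {q \<in> V. \<phi> q \<in> cball (\<phi> p) r}"
    by (rule chart_compact_preimage[OF c compact_cball r(2)])
  show ?thesis
    by (rule that[of "{q \<in> V. \<phi> q \<in> ball (\<phi> p) r}" "{q \<in> V. \<phi> q \<in> cball (\<phi> p) r}"])
       (use chart_open_preimage[OF c open_ball] p r(1) D compactin_imp_closedin[OF hausdorff D] in auto)
qed

text \<open>
  Paracompactness is used twice: for a locally finite cover \<open>\<V>\<close> by relatively compact chart domains,
  and for a locally finite cover \<open>\<W>\<close> by sets whose closures lie in members of \<open>\<V>\<close>.  The set \<^term>\<open>E A\<close> is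
  the closure of the union of those members of \<open>\<W>\<close> whose closures lie in \<^term>\<open>A\<close>; local finiteness makes
  it the union of the closures, so it stays inside \<^term>\<open>A\<close>.
\<close>

lemma locally_finite_shrinking:
  obtains \<V> E where "locally_finite_in (mtop X) \<V>" "\<And>A. A \<in> \<V> \<Longrightarrow> \<exists>\<phi>. (A, \<phi>) \<in> atlas X"
    "\<And>A. A \<in> \<V> \<Longrightarrow> compactin (mtop X) (E A)" "\<And>A. A \<in> \<V> \<Longrightarrow> E A \<subseteq> A"
    "topspace (mtop X) \<subseteq> (\<Union>A\<in>\<V>. E A)"
proof -
  have "\<exists>U. openin (mtop X) U \<and> p \<in> U \<and>
      (\<exists>V \<phi> D. (V, \<phi>) \<in> atlas X \<and> compactin (mtop X) D \<and> closedin (mtop X) D \<and> U \<subseteq> D \<and> D \<subseteq> V)"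
    if p: "p \<in> topspace (mtop X)" for p
  proof -
    obtain V \<phi> where c: "(V, \<phi>) \<in> atlas X" "p \<in> V" "V \<subseteq> topspace (mtop X)"
      by (rule chart_at[OF openin_topspace p])
    obtain U D where "openin (mtop X) U" "p \<in> U" "U \<subseteq> D" "D \<subseteq> V" "compactin (mtop X) D" "closedin (mtop X) D"
      by (rule chart_ball_closure[OF c(1,2)])
    then show ?thesis using c(1) by blast
  qed
  from locally_finite_refinement[OF this] obtain \<V> where
    V: "\<And>A. A \<in> \<V> \<Longrightarrow> openin (mtop X) A" "\<Union>\<V> = topspace (mtop X)" "locally_finite_in (mtop X) \<V>"
      "\<And>A. A \<in> \<V> \<Longrightarrow> \<exists>U. A \<subseteq> U \<and>
        (\<exists>V \<phi> D. (V, \<phi>) \<in> atlas X \<and> compactin (mtop X) D \<and> closedin (mtop X) D \<and> U \<subseteq> D \<and> D \<subseteq> V)"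
    by auto
  have VD: "\<exists>D. compactin (mtop X) D \<and> closedin (mtop X) D \<and> A \<subseteq> D" if "A \<in> \<V>" for A
    using V(4)[OF that] by (meson subset_trans)
  have chart: "\<exists>\<phi>. (A, \<phi>) \<in> atlas X" if "A \<in> \<V>" for A
  proof -
    from V(4)[OF that] obtain V' \<phi> where "(V', \<phi>) \<in> atlas X" "A \<subseteq> V'" by (meson subset_trans)
    then show ?thesis using chart_restrict[OF _ V(1)[OF that]] by blast
  qed
  have "\<exists>U. openin (mtop X) U \<and> p \<in> U \<and> (\<exists>A\<in>\<V>. mtop X closure_of U \<subseteq> A)"
    if "p \<in> topspace (mtop X)" for p
  proof -
    from that V(2) obtain A where A: "A \<in> \<V>" "p \<in> A" by blast
    then obtain \<phi> where cA: "(A, \<phi>) \<in> atlas X" using chart by blast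
    obtain U D where U: "openin (mtop X) U" "p \<in> U" "U \<subseteq> D" "D \<subseteq> A" "compactin (mtop X) D" "closedin (mtop X) D"
      by (rule chart_ball_closure[OF cA A(2)])
    have "mtop X closure_of U \<subseteq> D" using U(3,6) by (rule closure_of_minimal)
    then show ?thesis using U A by blast
  qed
  from locally_finite_refinement[OF this] obtain \<W> where
    W: "\<And>W. W \<in> \<W> \<Longrightarrow> openin (mtop X) W" "\<Union>\<W> = topspace (mtop X)" "locally_finite_in (mtop X) \<W>"
      "\<And>W. W \<in> \<W> \<Longrightarrow> \<exists>U. W \<subseteq> U \<and> (\<exists>A\<in>\<V>. mtop X closure_of U \<subseteq> A)"
    by auto
  define \<W>\<^sub>A where "\<W>\<^sub>A A = {W \<in> \<W>. mtop X closure_of W \<subseteq> A}" for A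
  define E where "E A = mtop X closure_of \<Union>(\<W>\<^sub>A A)" for A
  have EA: "E A \<subseteq> A" for A
  proof -
    have "locally_finite_in (mtop X) (\<W>\<^sub>A A)"
      by (rule locally_finite_in_subset[OF W(3)]) (simp add: \<W>\<^sub>A_def)
    then have "E A = \<Union>((\<lambda>W. mtop X closure_of W) ` \<W>\<^sub>A A)"
      unfolding E_def by (rule closure_of_locally_finite_Union)
    then show ?thesis by (auto simp: \<W>\<^sub>A_def)
  qed
  show ?thesis
  proof (rule that[of \<V> E])
    show "compactin (mtop X) (E A)" if "A \<in> \<V>" for A
    proof -
      from VD[OF that] obtain D where D: "compactin (mtop X) D" "A \<subseteq> D" by blast
      have "E A \<subseteq> D" using EA D(2) by blast
      then show ?thesis by (rule closed_compactin[OF D(1)]) (simp add: E_def)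
    qed
    show "topspace (mtop X) \<subseteq> (\<Union>A\<in>\<V>. E A)"
    proof
      fix p assume "p \<in> topspace (mtop X)"
      then obtain W where Wp: "W \<in> \<W>" "p \<in> W" using W(2) by blast
      from W(4)[OF Wp(1)] obtain A where A: "A \<in> \<V>" "mtop X closure_of W \<subseteq> A"
        by (meson closure_of_mono subset_trans)
      then have "p \<in> \<Union>(\<W>\<^sub>A A)" using Wp by (auto simp: \<W>\<^sub>A_def)
      moreover have "\<Union>(\<W>\<^sub>A A) \<subseteq> E A"
        unfolding E_def using W(2) by (intro closure_of_subset) (auto simp: \<W>\<^sub>A_def)
      ultimately show "p \<in> (\<Union>A\<in>\<V>. E A)" using A(1) by blast
    qed
  qed (use V(3) chart EA in auto)
qed

text \<open>
  An unnormalised partition of unity: the sum of the bumps is at least $1$ everywhere, and dividing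
  by it is left to the application.
\<close>

lemma locally_finite_chart_bumps:
  obtains \<V> f C and G :: "'a set \<Rightarrow> 'e \<Rightarrow> real" where "locally_finite_in (mtop X) \<V>"
    "\<And>A. A \<in> \<V> \<Longrightarrow> (A, f A) \<in> atlas X" "\<And>A. A \<in> \<V> \<Longrightarrow> smooth_fun Basis UNIV (G A)"
    "\<And>A. A \<in> \<V> \<Longrightarrow> compact (C A)" "\<And>A. A \<in> \<V> \<Longrightarrow> C A \<inter> span (dirs X) \<subseteq> f A ` A"
    "\<And>A x. A \<in> \<V> \<Longrightarrow> x \<notin> C A \<Longrightarrow> G A x = 0" "\<And>A x. A \<in> \<V> \<Longrightarrow> G A x \<ge> 0"
    "\<And>p. p \<in> topspace (mtop X) \<Longrightarrow> \<exists>A\<in>\<V>. p \<in> A \<and> G A (f A p) = 1"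
proof -
  obtain \<V> E where V: "locally_finite_in (mtop X) \<V>" "\<And>A. A \<in> \<V> \<Longrightarrow> \<exists>\<phi>. (A, \<phi>) \<in> atlas X"
    "\<And>A. A \<in> \<V> \<Longrightarrow> compactin (mtop X) (E A)" "\<And>A. A \<in> \<V> \<Longrightarrow> E A \<subseteq> A"
    "topspace (mtop X) \<subseteq> (\<Union>A\<in>\<V>. E A)"
    by (rule locally_finite_shrinking) blast
  define Q where "Q A \<phi> C G \<longleftrightarrow> (A, \<phi>) \<in> atlas X \<and> smooth_fun Basis UNIV G \<and> compact C \<and>
     C \<inter> span (dirs X) \<subseteq> \<phi> ` A \<and> (\<forall>x. x \<notin> C \<longrightarrow> G x = 0) \<and> (\<forall>x. G x \<ge> 0) \<and> (\<forall>p\<in>E A. G (\<phi> p) = 1)"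
    for A \<phi> C and G :: "'e \<Rightarrow> real"
  have "\<forall>A\<in>\<V>. \<exists>\<phi>. \<exists>C G. Q A \<phi> C G"
  proof
    fix A assume A: "A \<in> \<V>"
    then obtain \<phi> where c: "(A, \<phi>) \<in> atlas X" using V(2) by blast
    have "compactin (subtopology (mtop X) A) (E A)" using V(3,4)[OF A] by (simp add: compactin_subtopology)
    then have "compactin (top_of_set (\<phi> ` A)) (\<phi> ` E A)"
      by (rule image_compactin[OF _ homeomorphic_imp_continuous_map[OF chart_homeomorphic[OF c]]])
    then have cE: "compact (\<phi> ` E A)" by (simp add: compactin_subtopology)
    from chart_open_image[OF c] obtain O' where O': "open O'" "\<phi> ` A = span (dirs X) \<inter> O'"
      by (auto simp: openin_open)
    have EO: "\<phi> ` E A \<subseteq> O'" using V(4)[OF A] O'(2) by blast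
    obtain G :: "'e \<Rightarrow> real" and C where G: "smooth_fun Basis UNIV G" "compact C" "C \<subseteq> O'"
      "\<And>x. x \<notin> C \<Longrightarrow> G x = 0" "\<And>x. x \<in> \<phi> ` E A \<Longrightarrow> G x = 1" "\<And>x. G x \<ge> 0"
      by (rule smooth_urysohn[OF cE O'(1) EO]) blast
    have "Q A \<phi> C G" unfolding Q_def using c G O'(2) by auto
    then show "\<exists>\<phi>. \<exists>C G. Q A \<phi> C G" by blast
  qed
  from bchoice[OF this] obtain f where "\<forall>A\<in>\<V>. \<exists>C. \<exists>G. Q A (f A) C G" by blast
  from bchoice[OF this] obtain C where "\<forall>A\<in>\<V>. \<exists>G. Q A (f A) (C A) G" by blast
  from bchoice[OF this] obtain G where Q: "\<forall>A\<in>\<V>. Q A (f A) (C A) (G A)" by blast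
  show ?thesis
  proof (rule that[of \<V> f G C])
    fix p assume "p \<in> topspace (mtop X)"
    then obtain A where A: "A \<in> \<V>" "p \<in> E A" using V(5) by blast
    have "G A (f A p) = 1" using bspec[OF Q A(1)] A(2) by (simp add: Q_def)
    moreover have "p \<in> A" using V(4) A by blast
    ultimately show "\<exists>A\<in>\<V>. p \<in> A \<and> G A (f A p) = 1" using A(1) by blast
  qed (use V(1) Q in \<open>auto simp: Q_def\<close>)
qed

lemma slow_on_mfd_divide:
  fixes g :: "real \<Rightarrow> 'a \<Rightarrow> real"
  assumes g: "slow_on_mfd X \<Omega> g" and s: "slow_on_mfd X \<Omega> (\<lambda>\<epsilon>. s)" "\<And>p. p \<in> \<Omega> \<Longrightarrow> s p > 0"
  shows "slow_on_mfd X \<Omega> (\<lambda>\<epsilon> p. g \<epsilon> p / s p)"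
proof -
  have "slow_on_mfd X \<Omega> (\<lambda>\<epsilon> p. 1 / s p)"
    unfolding slow_on_mfd_def slow_const_iff
  proof (intro allI impI)
    fix V \<phi> assume c: "(V, \<phi>) \<in> atlas X" "V \<subseteq> \<Omega>"
    have "smooth_fun (dirs X) (\<phi> ` V) (\<lambda>x. s (inv_into V \<phi> x))"
      using s(1) c unfolding slow_on_mfd_def slow_const_iff by blast
    then show "smooth_fun (dirs X) (\<phi> ` V) (\<lambda>x. 1 / s (inv_into V \<phi> x))"
    proof (rule smooth_fun_divide[OF chart_open_image[OF c(1)]])
      show "smooth_fun (dirs X) (\<phi> ` V) (\<lambda>x. 1)" by (rule smooth_fun_const[OF chart_open_image[OF c(1)]])
      show "s (inv_into V \<phi> x) > 0" if "x \<in> \<phi> ` V" for x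
        using inv_into_into[OF that] c(2) s(2) by blast
    qed
  qed
  from slow_on_mfd_scaleR[OF g this] show ?thesis by simp
qed

lemma slow_on_mfd_locally_finite_sum:
  fixes g :: "'a set \<Rightarrow> real \<Rightarrow> 'a \<Rightarrow> 'b::real_normed_vector"
  assumes \<V>: "locally_finite_in (mtop X) \<V>"
    and g: "\<And>A. A \<in> \<V> \<Longrightarrow> slow_on_mfd X (topspace (mtop X)) (g A)"
    and zero: "\<And>A \<epsilon> p. A \<in> \<V> \<Longrightarrow> p \<notin> A \<Longrightarrow> g A \<epsilon> p = 0"
  shows "slow_on_mfd X (topspace (mtop X)) (\<lambda>\<epsilon> p. \<Sum>A | A \<in> \<V> \<and> p \<in> A. g A \<epsilon> p)"
proof (rule slow_on_mfd_local)
  fix p assume "p \<in> topspace (mtop X)"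
  then obtain N where N: "openin (mtop X) N" "p \<in> N" "finite {A \<in> \<V>. A \<inter> N \<noteq> {}}"
    using \<V> unfolding locally_finite_in_def by blast
  have "slow_on_mfd X (topspace (mtop X)) (\<lambda>\<epsilon> q. \<Sum>A\<in>{A \<in> \<V>. A \<inter> N \<noteq> {}}. g A \<epsilon> q)"
    using N(3) g by (intro slow_on_mfd_sum) auto
  then have "slow_on_mfd X N (\<lambda>\<epsilon> q. \<Sum>A\<in>{A \<in> \<V>. A \<inter> N \<noteq> {}}. g A \<epsilon> q)"
    using openin_subset[OF N(1)] by (rule slow_on_mfd_mono)
  then have "slow_on_mfd X N (\<lambda>\<epsilon> p. \<Sum>A | A \<in> \<V> \<and> p \<in> A. g A \<epsilon> p)"
  proof (rule slow_on_mfd_cong)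
    fix \<epsilon> :: real and q assume "q \<in> N"
    then show "(\<Sum>A\<in>{A \<in> \<V>. A \<inter> N \<noteq> {}}. g A \<epsilon> q) = (\<Sum>A | A \<in> \<V> \<and> q \<in> A. g A \<epsilon> q)"
      using N(3) zero by (intro sum.mono_neutral_right) auto
  qed
  then show "\<exists>N. openin (mtop X) N \<and> p \<in> N \<and> slow_on_mfd X N (\<lambda>\<epsilon> p. \<Sum>A | A \<in> \<V> \<and> p \<in> A. g A \<epsilon> p)"
    using N by blast
qed

text \<open>
  The separating nets of the individual charts are averaged with the bumps as weights.  A member of
  the cover whose bump is supported away from the point contributes nothing near it; for each of the
  finitely many others the local net is eventually the constant $1$ (or $0$) near the point, and hence
  so is the average.
\<close>

lemma slow_on_mfd_separating_net:
  assumes Z: "closedin (mtop X) Z1" "closedin (mtop X) Z2"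
  obtains \<eta> :: "real \<Rightarrow> 'a \<Rightarrow> real" where "slow_on_mfd X (topspace (mtop X)) \<eta>"
    "\<And>p. p \<in> Z1 - Z2 \<Longrightarrow> \<exists>N. openin (mtop X) N \<and> p \<in> N \<and> (\<forall>\<^sub>F \<epsilon> in at_right 0. \<forall>q\<in>N. \<eta> \<epsilon> q = 1)"
    "\<And>p. p \<in> Z2 - Z1 \<Longrightarrow> \<exists>N. openin (mtop X) N \<and> p \<in> N \<and> (\<forall>\<^sub>F \<epsilon> in at_right 0. \<forall>q\<in>N. \<eta> \<epsilon> q = 0)"
proof -
  obtain \<V> f C and G :: "'a set \<Rightarrow> 'e \<Rightarrow> real" where V: "locally_finite_in (mtop X) \<V>"
    and f: "\<And>A. A \<in> \<V> \<Longrightarrow> (A, f A) \<in> atlas X" and G: "\<And>A. A \<in> \<V> \<Longrightarrow> smooth_fun Basis UNIV (G A)"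
    and C: "\<And>A. A \<in> \<V> \<Longrightarrow> compact (C A)" "\<And>A. A \<in> \<V> \<Longrightarrow> C A \<inter> span (dirs X) \<subseteq> f A ` A"
    and GC: "\<And>A x. A \<in> \<V> \<Longrightarrow> x \<notin> C A \<Longrightarrow> G A x = 0" and G0: "\<And>A x. A \<in> \<V> \<Longrightarrow> G A x \<ge> 0"
    and G1: "\<And>p. p \<in> topspace (mtop X) \<Longrightarrow> \<exists>A\<in>\<V>. p \<in> A \<and> G A (f A p) = 1"
    by (rule locally_finite_chart_bumps) blast
  define S where "S A = {q \<in> A. f A q \<in> C A}" for A
  have Sc: "compactin (mtop X) (S A)" if "A \<in> \<V>" for A
    unfolding S_def by (rule chart_compact_preimage[OF f[OF that] C(1)[OF that] C(2)[OF that]])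
  have cl: "closed (f A ` (Z \<inter> S A))" if A: "A \<in> \<V>" and Z: "closedin (mtop X) Z" for A Z
  proof -
    have "compactin (mtop X) (Z \<inter> S A)" using Z Sc[OF A] by (rule closed_Int_compactin)
    then have "compactin (subtopology (mtop X) A) (Z \<inter> S A)" by (simp add: compactin_subtopology S_def) blast
    then have "compactin (top_of_set (f A ` A)) (f A ` (Z \<inter> S A))"
      by (rule image_compactin[OF _ homeomorphic_imp_continuous_map[OF chart_homeomorphic[OF f[OF A]]]])
    then show ?thesis by (simp add: compactin_subtopology compact_imp_closed)
  qed
  define Q where "Q A h \<longleftrightarrow> slow Basis UNIV h \<and>
    (\<forall>x\<in>f A ` (Z1 \<inter> S A) - f A ` (Z2 \<inter> S A). \<exists>N. open N \<and> x \<in> N \<and> (\<forall>\<^sub>F \<epsilon> in at_right 0. \<forall>y\<in>N. h \<epsilon> y = 1)) \<and>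
    (\<forall>x\<in>f A ` (Z2 \<inter> S A) - f A ` (Z1 \<inter> S A). \<exists>N. open N \<and> x \<in> N \<and> (\<forall>\<^sub>F \<epsilon> in at_right 0. \<forall>y\<in>N. h \<epsilon> y = 0))"
    for A and h :: "real \<Rightarrow> 'e \<Rightarrow> real"
  have "\<forall>A\<in>\<V>. \<exists>h. Q A h"
    unfolding Q_def by (intro ballI slow_separating_net cl Z)
  from bchoice[OF this] obtain h where "\<forall>A\<in>\<V>. Q A (h A)" ..
  note hQ = this[rule_format, unfolded Q_def]
  note h = hQ[THEN conjunct1] and h1 = hQ[THEN conjunct2, THEN conjunct1, rule_format]
    and h2 = hQ[THEN conjunct2, THEN conjunct2, rule_format]
  define \<rho> where "\<rho> A p = (if p \<in> A then G A (f A p) else 0)" for A p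
  define g where "g A \<epsilon> p = (if p \<in> A then G A (f A p) *\<^sub>R h A \<epsilon> (f A p) else 0)" for A \<epsilon> p
  have \<rho>: "slow_on_mfd X (topspace (mtop X)) (\<lambda>\<epsilon>. \<rho> A)" if A: "A \<in> \<V>" for A
    unfolding \<rho>_def
    by (rule slow_on_mfd_extend_by_zero[OF f[OF A] _ C(1)[OF A] C(2)[OF A], of "\<lambda>\<epsilon>. G A"])
       (use G[OF A] GC[OF A] in \<open>auto simp: slow_const_iff\<close>)
  have g: "slow_on_mfd X (topspace (mtop X)) (g A)" if A: "A \<in> \<V>" for A
    unfolding g_def
  proof (rule slow_on_mfd_extend_by_zero[OF f[OF A] _ C(1)[OF A] C(2)[OF A], of "\<lambda>\<epsilon> x. G A x *\<^sub>R h A \<epsilon> x"])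
    show "slow Basis UNIV (\<lambda>\<epsilon> x. G A x *\<^sub>R h A \<epsilon> x)"
      using slow_scaleR[OF openin_span_Basis_UNIV _ h[OF A], of "\<lambda>\<epsilon>. G A"] G[OF A] by (simp add: slow_const_iff)
  qed (simp add: GC[OF A])
  define s where "s p = (\<Sum>A | A \<in> \<V> \<and> p \<in> A. \<rho> A p)" for p
  define \<eta> where "\<eta> \<epsilon> p = (\<Sum>A | A \<in> \<V> \<and> p \<in> A. g A \<epsilon> p) / s p" for \<epsilon> p
  have fin: "finite {A. A \<in> \<V> \<and> p \<in> A}" if p: "p \<in> topspace (mtop X)" for p
  proof -
    obtain N where "p \<in> N" "finite {A \<in> \<V>. A \<inter> N \<noteq> {}}"
      using V p unfolding locally_finite_in_def by blast
    then show ?thesis by (auto elim: finite_subset[rotated])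
  qed
  have spos: "s p > 0" if p: "p \<in> topspace (mtop X)" for p
  proof -
    from G1[OF p] obtain A where "A \<in> \<V>" "p \<in> A" "G A (f A p) = 1" by blast
    then show ?thesis unfolding s_def \<rho>_def using fin[OF p] G0 by (intro sum_pos2[of _ A]) auto
  qed
  have "slow_on_mfd X (topspace (mtop X)) (\<lambda>\<epsilon> p. \<Sum>A | A \<in> \<V> \<and> p \<in> A. g A \<epsilon> p)"
    by (rule slow_on_mfd_locally_finite_sum[OF V g]) (simp_all add: g_def)
  moreover have "slow_on_mfd X (topspace (mtop X)) (\<lambda>\<epsilon>. s)"
    unfolding s_def by (rule slow_on_mfd_locally_finite_sum[OF V \<rho>]) (simp_all add: \<rho>_def)
  ultimately have \<eta>: "slow_on_mfd X (topspace (mtop X)) \<eta>"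
    unfolding \<eta>_def using spos by (rule slow_on_mfd_divide)
  have value_near: "\<exists>N. openin (mtop X) N \<and> p \<in> N \<and> (\<forall>\<^sub>F \<epsilon> in at_right 0. \<forall>q\<in>N. \<eta> \<epsilon> q = c)"
    if p: "p \<in> topspace (mtop X)"
      and hc: "\<And>A. A \<in> \<V> \<Longrightarrow> p \<in> S A \<Longrightarrow> \<exists>N. open N \<and> f A p \<in> N \<and> (\<forall>\<^sub>F \<epsilon> in at_right 0. \<forall>y\<in>N. h A \<epsilon> y = c)"
    for p and c :: real
  proof -
    obtain N0 where N0: "openin (mtop X) N0" "p \<in> N0" "finite {A \<in> \<V>. A \<inter> N0 \<noteq> {}}"
      using V p unfolding locally_finite_in_def by blast
    define F where "F = {A \<in> \<V>. A \<inter> N0 \<noteq> {}}"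
    have "\<forall>A\<in>F. \<exists>N. openin (mtop X) N \<and> p \<in> N \<and> (\<forall>\<^sub>F \<epsilon> in at_right 0. \<forall>q\<in>N. g A \<epsilon> q = c * \<rho> A q)"
    proof
      fix A assume "A \<in> F"
      then have A: "A \<in> \<V>" by (simp add: F_def)
      show "\<exists>N. openin (mtop X) N \<and> p \<in> N \<and> (\<forall>\<^sub>F \<epsilon> in at_right 0. \<forall>q\<in>N. g A \<epsilon> q = c * \<rho> A q)"
      proof (cases "p \<in> S A")
        case True
        from hc[OF A True] obtain N where N: "open N" "f A p \<in> N" "\<forall>\<^sub>F \<epsilon> in at_right 0. \<forall>y\<in>N. h A \<epsilon> y = c"
          by blast
        have "\<forall>\<^sub>F \<epsilon> in at_right 0. \<forall>q\<in>{q \<in> A. f A q \<in> N}. g A \<epsilon> q = c * \<rho> A q"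
          using N(3) by eventually_elim (auto simp: g_def \<rho>_def)
        then show ?thesis
          using chart_open_preimage[OF f[OF A] N(1)] True N(2)
          by (intro exI[of _ "{q \<in> A. f A q \<in> N}"]) (auto simp: S_def)
      next
        case False
        have "openin (mtop X) (topspace (mtop X) - S A)"
          using compactin_imp_closedin[OF hausdorff Sc[OF A]] by blast
        moreover have "\<forall>\<^sub>F \<epsilon> in at_right (0::real). \<forall>q\<in>topspace (mtop X) - S A. g A \<epsilon> q = c * \<rho> A q"
          by (rule always_eventually) (auto simp: g_def \<rho>_def S_def GC[OF A])
        ultimately show ?thesis using p False by (intro exI[of _ "topspace (mtop X) - S A"]) auto
      qed
    qed
    from bchoice[OF this] obtain N where N: "\<And>A. A \<in> F \<Longrightarrow> openin (mtop X) (N A)" "\<And>A. A \<in> F \<Longrightarrow> p \<in> N A"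
      "\<And>A. A \<in> F \<Longrightarrow> \<forall>\<^sub>F \<epsilon> in at_right 0. \<forall>q\<in>N A. g A \<epsilon> q = c * \<rho> A q" by blast
    have finF: "finite F" using N0(3) by (simp add: F_def)
    define M where "M = \<Inter>(insert N0 (N ` F))"
    have "openin (mtop X) M" unfolding M_def using finF N0 N by (intro openin_Inter) auto
    moreover have "p \<in> M" using N0 N by (auto simp: M_def)
    moreover have "\<forall>\<^sub>F \<epsilon> in at_right 0. \<forall>A\<in>F. \<forall>q\<in>N A. g A \<epsilon> q = c * \<rho> A q"
      by (rule eventually_ball_finite[OF finF]) (use N(3) in blast)
    then have "\<forall>\<^sub>F \<epsilon> in at_right 0. \<forall>q\<in>M. \<eta> \<epsilon> q = c"
    proof eventually_elim
      case (elim \<epsilon>)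
      show ?case
      proof
        fix q assume q: "q \<in> M"
        then have qN0: "q \<in> N0" by (simp add: M_def)
        then have qX: "q \<in> topspace (mtop X)" using openin_subset[OF N0(1)] by blast
        have "g A \<epsilon> q = c * \<rho> A q" if "A \<in> \<V>" "q \<in> A" for A
        proof -
          have "A \<in> F" using that qN0 by (auto simp: F_def)
          then show ?thesis using elim q by (auto simp: M_def)
        qed
        then have "(\<Sum>A | A \<in> \<V> \<and> q \<in> A. g A \<epsilon> q) = c * s q"
          unfolding s_def sum_distrib_left by (intro sum.cong) auto
        then show "\<eta> \<epsilon> q = c" using spos[OF qX] by (simp add: \<eta>_def)
      qed
    qed
    ultimately show ?thesis by blast
  qed
  \<comment> \<open>Injectivity of the chart turns \<open>p \<in> Z - Z'\<close> into the same statement about the images.\<close>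
  have sep: "f A p \<in> f A ` (Z \<inter> S A) - f A ` (Z' \<inter> S A)"
    if "A \<in> \<V>" "p \<in> S A" "p \<in> Z - Z'" for A p Z Z'
  proof -
    have "p = q" if "q \<in> S A" "f A p = f A q" for q
      using inj_onD[OF chart_inj_on[OF f[OF \<open>A \<in> \<V>\<close>]] that(2)] that(1) \<open>p \<in> S A\<close> by (auto simp: S_def)
    then show ?thesis using that by blast
  qed
  show ?thesis
  proof (rule that[OF \<eta>])
    fix p assume p: "p \<in> Z1 - Z2"
    then have "p \<in> topspace (mtop X)" using closedin_subset[OF Z(1)] by blast
    then show "\<exists>N. openin (mtop X) N \<and> p \<in> N \<and> (\<forall>\<^sub>F \<epsilon> in at_right 0. \<forall>q\<in>N. \<eta> \<epsilon> q = 1)"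
    proof (rule value_near)
      fix A assume A: "A \<in> \<V>" "p \<in> S A"
      show "\<exists>N. open N \<and> f A p \<in> N \<and> (\<forall>\<^sub>F \<epsilon> in at_right 0. \<forall>y\<in>N. h A \<epsilon> y = 1)"
        by (rule h1[OF A(1) sep[OF A p]])
    qed
  next
    fix p assume p: "p \<in> Z2 - Z1"
    then have "p \<in> topspace (mtop X)" using closedin_subset[OF Z(2)] by blast
    then show "\<exists>N. openin (mtop X) N \<and> p \<in> N \<and> (\<forall>\<^sub>F \<epsilon> in at_right 0. \<forall>q\<in>N. \<eta> \<epsilon> q = 0)"
    proof (rule value_near)
      fix A assume A: "A \<in> \<V>" "p \<in> S A"
      show "\<exists>N. open N \<and> f A p \<in> N \<and> (\<forall>\<^sub>F \<epsilon> in at_right 0. \<forall>y\<in>N. h A \<epsilon> y = 0)"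
        by (rule h2[OF A(1) sep[OF A p]])
    qed
  qed
qed

end

section \<open>Sections, restrictions and supports\<close>

abbreviation net_class ::
  "('a, 'e::euclidean_space) manifold \<Rightarrow> 'a set \<Rightarrow> (real \<Rightarrow> 'a \<Rightarrow> 'k::{real_normed_field,euclidean_space}) \<Rightarrow>
     (real \<Rightarrow> 'a \<Rightarrow> 'k) set" where
  "net_class X \<Omega> u \<equiv> negligible_nets X \<Omega> +>\<^bsub>moderate_ring X \<Omega>\<^esub> u"

abbreviation supp_in ::
  "('a, 'e::euclidean_space) manifold \<Rightarrow> 'a set \<Rightarrow> (real \<Rightarrow> 'a \<Rightarrow> 'k::{real_normed_field,euclidean_space}) set \<Rightarrow> 'a set" where
  "supp_in X \<equiv> sheaf_supp (mtop X) (regular_gen_fun X) (gen_restrict X)"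

lemma mem_net_class_iff:
  fixes u w :: "real \<Rightarrow> 'a \<Rightarrow> 'k::{real_normed_field,euclidean_space}"
  shows "w \<in> net_class X \<Omega> u \<longleftrightarrow>
    (\<lambda>\<epsilon> p. w \<epsilon> p + (-1) *\<^sub>R u \<epsilon> p) \<in> negligible_nets X \<Omega>"
proof
  assume "w \<in> net_class X \<Omega> u"
  then obtain n where n: "n \<in> negligible_nets X \<Omega>" "w = (\<lambda>\<epsilon> p. n \<epsilon> p + u \<epsilon> p)"
    by (auto simp: a_r_coset_def' moderate_ring_def)
  then have "(\<lambda>\<epsilon> p. w \<epsilon> p + (-1) *\<^sub>R u \<epsilon> p) = n" by simp
  with n show "(\<lambda>\<epsilon> p. w \<epsilon> p + (-1) *\<^sub>R u \<epsilon> p) \<in> negligible_nets X \<Omega>" by simp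
next
  assume *: "(\<lambda>\<epsilon> p. w \<epsilon> p + (-1) *\<^sub>R u \<epsilon> p) \<in> negligible_nets X \<Omega>"
  have "\<exists>n\<in>negligible_nets X \<Omega>. w = (\<lambda>\<epsilon> p. n \<epsilon> p + u \<epsilon> p)"
    by (rule bexI[OF _ *]) simp
  then show "w \<in> net_class X \<Omega> u"
    by (auto simp: a_r_coset_def' moderate_ring_def)
qed

definition regular_rep ::
  "('a, 'e::euclidean_space) manifold \<Rightarrow> 'a set \<Rightarrow> (real \<Rightarrow> 'a \<Rightarrow> 'k::{real_normed_field,euclidean_space}) \<Rightarrow> bool" where
  "regular_rep X \<Omega> u \<longleftrightarrow>
     (\<forall>(V, \<phi>)\<in>charts_of X \<Omega>. (\<lambda>\<epsilon>. u \<epsilon> \<circ> inv_into V \<phi>) \<in> regular_nets (dirs X) (\<phi> ` V))"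

context smooth_mfd
begin

lemma zero_negligible: "(\<lambda>\<epsilon> p. 0) \<in> negligible_nets X \<Omega>" if "openin (mtop X) \<Omega>"
proof -
  have "(\<lambda>\<epsilon> x. 0) \<in> regular_nets (dirs X) W" for W
    unfolding regular_nets_iff_tame using slow_tame[OF slow_zero] by blast
  then have "(\<lambda>\<epsilon> p. 0) \<in> moderate_nets X \<Omega>"
    by (intro moderate_if_regular_in_charts[OF that]) (simp add: o_def)
  then show ?thesis by (simp add: negligible_nets_def)
qed

lemma rep_mem_net_class:
  assumes "openin (mtop X) \<Omega>"
  shows "u \<in> net_class X \<Omega> u"
  unfolding mem_net_class_iff using zero_negligible[OF assms] by simp

lemma net_class_eq:
  fixes u w :: "real \<Rightarrow> 'a \<Rightarrow> 'k::{real_normed_field,euclidean_space}"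
  assumes \<Omega>: "openin (mtop X) \<Omega>" and w: "w \<in> net_class X \<Omega> u"
  shows "net_class X \<Omega> w = net_class X \<Omega> u"
proof (rule Set.set_eqI, rule iffI)
  note w' = w[unfolded mem_net_class_iff]
  fix x :: "real \<Rightarrow> 'a \<Rightarrow> 'k"
  assume "x \<in> net_class X \<Omega> w"
  from negligible_add_scaleR[OF \<Omega> this[unfolded mem_net_class_iff] w', of 1]
  show "x \<in> net_class X \<Omega> u"
    unfolding mem_net_class_iff by (simp add: algebra_simps)
next
  note w' = w[unfolded mem_net_class_iff]
  fix x
  assume "x \<in> net_class X \<Omega> u"
  from negligible_add_scaleR[OF \<Omega> this[unfolded mem_net_class_iff] w', of "-1"]
  show "x \<in> net_class X \<Omega> w"
    unfolding mem_net_class_iff by (simp add: algebra_simps)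
qed

lemma net_class_negligible:
  assumes \<Omega>: "openin (mtop X) \<Omega>" and u: "u \<in> negligible_nets X \<Omega>"
  shows "net_class X \<Omega> u = negligible_nets X \<Omega>"
proof -
  have "u \<in> net_class X \<Omega> (\<lambda>\<epsilon> p. 0)"
    unfolding mem_net_class_iff using u by simp
  from net_class_eq[OF \<Omega> this] show ?thesis
    by (simp add: set_eq_iff mem_net_class_iff)
qed

lemma regular_rep_moderate:
  "openin (mtop X) \<Omega> \<Longrightarrow> regular_rep X \<Omega> u \<Longrightarrow> u \<in> moderate_nets X \<Omega>"
  unfolding regular_rep_def by (rule moderate_if_regular_in_charts) auto

lemma regular_section_cases:
  assumes \<Omega>: "openin (mtop X) \<Omega>" and f: "f \<in> carrier (regular_gen_fun X \<Omega>)"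
  obtains u where "regular_rep X \<Omega> u" "f = net_class X \<Omega> u"
proof -
  from f obtain u where u: "u \<in> f" "regular_rep X \<Omega> u" and f': "f \<in> carrier (gen_fun X \<Omega>)"
    unfolding regular_gen_fun_def regular_rep_def by auto
  from f' obtain u' where "f = net_class X \<Omega> u'"
    unfolding gen_fun_def FactRing_def A_RCOSETS_def' by auto
  then have "f = net_class X \<Omega> u"
    using net_class_eq[OF \<Omega>, of u u'] u(1) by simp
  then show ?thesis using that u(2) by blast
qed

lemma regular_rep_net_class_mem:
  assumes \<Omega>: "openin (mtop X) \<Omega>" and u: "regular_rep X \<Omega> u"
  shows "net_class X \<Omega> u \<in> carrier (regular_gen_fun X \<Omega>)"
proof -
  have "u \<in> carrier (moderate_ring X \<Omega>)"
    using regular_rep_moderate[OF assms] by (simp add: moderate_ring_def)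
  then have "net_class X \<Omega> u \<in> carrier (gen_fun X \<Omega>)"
    unfolding gen_fun_def FactRing_def A_RCOSETS_def' by auto
  moreover have "\<exists>w\<in>net_class X \<Omega> u. regular_rep X \<Omega> w"
    using rep_mem_net_class[OF \<Omega>] u by blast
  ultimately show ?thesis unfolding regular_gen_fun_def regular_rep_def by simp
qed

lemma net_class_add:
  fixes v1 v2 :: "real \<Rightarrow> 'a \<Rightarrow> 'k::{real_normed_field,euclidean_space}"
  assumes \<Omega>: "openin (mtop X) \<Omega>"
  shows "(net_class X \<Omega> v1) \<oplus>\<^bsub>regular_gen_fun X \<Omega>\<^esub>
      (net_class X \<Omega> v2)
    = net_class X \<Omega> (\<lambda>\<epsilon> p. v1 \<epsilon> p + v2 \<epsilon> p)"
    (is "?A \<oplus>\<^bsub>_\<^esub> ?B = ?C")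
proof -
  have add: "?A \<oplus>\<^bsub>regular_gen_fun X \<Omega>\<^esub> ?B = (\<Union>x\<in>?A. \<Union>y\<in>?B. {\<lambda>\<epsilon> p. x \<epsilon> p + y \<epsilon> p})"
    by (simp add: regular_gen_fun_def gen_fun_def FactRing_def set_add_def' moderate_ring_def)
  show ?thesis
    unfolding add
  proof (rule Set.set_eqI, rule iffI)
    fix z assume "z \<in> (\<Union>x\<in>?A. \<Union>y\<in>?B. {\<lambda>\<epsilon> p. x \<epsilon> p + y \<epsilon> p})"
    then obtain x y where xy: "x \<in> ?A" "y \<in> ?B" "z = (\<lambda>\<epsilon> p. x \<epsilon> p + y \<epsilon> p)" by blast
    from negligible_add_scaleR[OF \<Omega> xy(1,2)[unfolded mem_net_class_iff], of 1]
    show "z \<in> ?C" unfolding mem_net_class_iff xy(3) by (simp add: algebra_simps)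
  next
    fix z assume z: "z \<in> ?C"
    define x where "x = (\<lambda>\<epsilon> p. z \<epsilon> p + (-1) *\<^sub>R v2 \<epsilon> p)"
    have "x \<in> ?A" using z unfolding mem_net_class_iff x_def by (simp add: algebra_simps)
    moreover have "v2 \<in> ?B" by (rule rep_mem_net_class[OF \<Omega>])
    moreover have "z = (\<lambda>\<epsilon> p. x \<epsilon> p + v2 \<epsilon> p)" by (simp add: x_def)
    ultimately show "z \<in> (\<Union>x\<in>?A. \<Union>y\<in>?B. {\<lambda>\<epsilon> p. x \<epsilon> p + y \<epsilon> p})" by blast
  qed
qed

lemma slow_on_mfd_sup_bigo:
  assumes g: "slow_on_mfd X \<Omega> g" and \<Omega>: "openin (mtop X) \<Omega>" and K: "compactin (mtop X) K" "K \<subseteq> \<Omega>"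
    and a: "a < 0"
  shows "sup_bigo K g a"
proof (rule sup_bigo_compact_local[OF K(1)])
  fix p assume "p \<in> K"
  then have p: "p \<in> \<Omega>" using K(2) by blast
  obtain V \<phi> D N where c: "(V, \<phi>) \<in> atlas X" "V \<subseteq> \<Omega>" and D: "compact D" "D \<subseteq> \<phi> ` V"
    and N: "openin (mtop X) N" "p \<in> N" "N \<subseteq> {q \<in> V. \<phi> q \<in> D}" by (rule chart_ball_at[OF \<Omega> p])
  have "slow (dirs X) (\<phi> ` V) (\<lambda>\<epsilon> x. g \<epsilon> (inv_into V \<phi> x))"
    using g c unfolding slow_on_mfd_def by blast
  from tame_sup_bigo[OF slow_tame[OF this D] a]
  have "sup_bigo D (\<lambda>\<epsilon> x. g \<epsilon> (inv_into V \<phi> x)) a" .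
  then have "sup_bigo {q \<in> V. \<phi> q \<in> D} (\<lambda>\<epsilon> q. g \<epsilon> (inv_into V \<phi> (\<phi> q))) a"
    unfolding sup_bigo_def by (auto elim!: eventually_mono)
  then have "sup_bigo {q \<in> V. \<phi> q \<in> D} g a"
    by (rule sup_bigo_cong) (rule always_eventually, use chart_inj_on[OF c(1)] in auto)
  then have "sup_bigo (K \<inter> N) g a" by (rule sup_bigo_subset) (use N(3) in auto)
  then show "\<exists>N. openin (mtop X) N \<and> p \<in> N \<and> sup_bigo (K \<inter> N) g a" using N(1,2) by blast
qed

lemma regular_rep_slow_scaleR:
  assumes "slow_on_mfd X \<Omega> g" "regular_rep X \<Omega> u"
  shows "regular_rep X \<Omega> (\<lambda>\<epsilon> p. g \<epsilon> p *\<^sub>R u \<epsilon> p)"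
  unfolding regular_rep_def
proof (intro ballI, clarify)
  fix V \<phi> assume cc: "(V, \<phi>) \<in> charts_of X \<Omega>"
  then have c: "(V, \<phi>) \<in> atlas X" "V \<subseteq> \<Omega>" by (auto simp: charts_of_def)
  have "slow (dirs X) (\<phi> ` V) (\<lambda>\<epsilon> x. g \<epsilon> (inv_into V \<phi> x))"
    using assms(1) c unfolding slow_on_mfd_def by blast
  moreover have "(\<lambda>\<epsilon>. u \<epsilon> \<circ> inv_into V \<phi>) \<in> regular_nets (dirs X) (\<phi> ` V)"
    using assms(2) cc unfolding regular_rep_def by blast
  ultimately show "(\<lambda>\<epsilon>. (\<lambda>p. g \<epsilon> p *\<^sub>R u \<epsilon> p) \<circ> inv_into V \<phi>) \<in> regular_nets (dirs X) (\<phi> ` V)"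
    using regular_nets_slow_scaleR[OF chart_open_image[OF c(1)]] by (simp add: o_def)
qed

end

context hausdorff_mfd
begin

text \<open>
  All representatives over \<^term>\<open>\<Omega>\<close> differ by nets that are negligible over \<^term>\<open>\<Omega>\<close>, hence over \<^term>\<open>V\<close>, so the
  condition may be tested on any one of them.
\<close>

lemma gen_restrict_eq_zero_iff:
  fixes u :: "real \<Rightarrow> 'a \<Rightarrow> 'k::{real_normed_field,euclidean_space}"
  assumes \<Omega>: "openin (mtop X) \<Omega>" and V: "openin (mtop X) V" "V \<subseteq> \<Omega>"
  shows "gen_restrict X V (net_class X \<Omega> u) = \<zero>\<^bsub>regular_gen_fun X V\<^esub>
    \<longleftrightarrow> u \<in> negligible_nets X V"
proof -
  have z: "\<zero>\<^bsub>regular_gen_fun X V\<^esub> = (negligible_nets X V :: (real \<Rightarrow> 'a \<Rightarrow> 'k) set)"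
    by (simp add: regular_gen_fun_def gen_fun_def FactRing_def)
  show ?thesis
    unfolding z gen_restrict_def
  proof
    assume "(\<Union>w\<in>net_class X \<Omega> u.
        net_class X V w) = negligible_nets X V"
    then show "u \<in> negligible_nets X V"
      using rep_mem_net_class[OF \<Omega>, of u] rep_mem_net_class[OF V(1), of u] by blast
  next
    assume u: "u \<in> negligible_nets X V"
    have "net_class X V w = negligible_nets X V"
      if "w \<in> net_class X \<Omega> u" for w
    proof (rule net_class_negligible[OF V(1)])
      have "(\<lambda>\<epsilon> p. w \<epsilon> p + (-1) *\<^sub>R u \<epsilon> p) \<in> negligible_nets X V"
        by (rule negligible_restrict[OF that[unfolded mem_net_class_iff] V])
      from negligible_add_scaleR[OF V(1) this u, of 1] show "w \<in> negligible_nets X V" by simp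
    qed
    then have "(\<Union>w\<in>net_class X \<Omega> u.
        net_class X V w) =
      (\<Union>w\<in>net_class X \<Omega> u. negligible_nets X V)"
      by (rule SUP_cong[OF refl])
    also have "\<dots> = negligible_nets X V" using rep_mem_net_class[OF \<Omega>, of u] by auto
    finally show "(\<Union>w\<in>net_class X \<Omega> u.
        net_class X V w) = negligible_nets X V" .
  qed
qed

text \<open>
  A slow scale factor is $O(\varepsilon^{-1})$ on compact sets, so it suffices to use the negligibility
  estimate of the net with the next higher power.
\<close>

lemma negligible_slow_scaleR:
  fixes u :: "real \<Rightarrow> 'a \<Rightarrow> 'k::{real_normed_field,euclidean_space}"
  assumes V: "openin (mtop X) V" and g: "slow_on_mfd X V g" and u: "u \<in> negligible_nets X V"
    and m: "(\<lambda>\<epsilon> p. g \<epsilon> p *\<^sub>R u \<epsilon> p) \<in> moderate_nets X V"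
  shows "(\<lambda>\<epsilon> p. g \<epsilon> p *\<^sub>R u \<epsilon> p) \<in> negligible_nets X V"
  unfolding negligible_nets_def
proof (intro CollectI conjI m allI impI, elim conjE)
  fix K and n :: nat assume K: "compactin (mtop X) K" "K \<subseteq> V"
  have "sup_bigo K g (-1)" by (rule slow_on_mfd_sup_bigo[OF g V K]) simp
  moreover have "sup_bigo K u (real (n + 1))" using u K unfolding negligible_nets_def by blast
  ultimately have "sup_bigo K (\<lambda>\<epsilon> p. g \<epsilon> p *\<^sub>R u \<epsilon> p) (-1 + real (n + 1))"
    by (rule sup_bigo_prod_bound) simp
  then show "sup_bigo K (\<lambda>\<epsilon> p. g \<epsilon> p *\<^sub>R u \<epsilon> p) (real n)" by simp
qed

text \<open>
  A point outside \<^term>\<open>Z\<close> either lies outside the support of the class of \<^term>\<open>u\<close>, where \<^term>\<open>u\<close> and with it the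
  product is negligible on a neighbourhood, or it lies in \<^term>\<open>Z' - Z\<close>, where the product eventually
  vanishes on a neighbourhood.
\<close>

lemma supp_slow_scaleR_subset:
  fixes u :: "real \<Rightarrow> 'a \<Rightarrow> 'k::{real_normed_field,euclidean_space}"
  assumes U: "openin (mtop X) U" and u: "regular_rep X U u" and g: "slow_on_mfd X U g"
    and supp: "supp_in X U
        (net_class X U u) = Z \<union> Z'"
    and zero: "\<And>p. p \<in> Z' - Z \<Longrightarrow>
        \<exists>N. openin (mtop X) N \<and> p \<in> N \<and> (\<forall>\<^sub>F \<epsilon> in at_right 0. \<forall>q\<in>N. g \<epsilon> q = 0)"
  shows "supp_in X U
        (net_class X U (\<lambda>\<epsilon> p. g \<epsilon> p *\<^sub>R u \<epsilon> p)) \<subseteq> Z"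
proof -
  let ?v = "\<lambda>\<epsilon> p. g \<epsilon> p *\<^sub>R u \<epsilon> p"
  have vm: "?v \<in> moderate_nets X V" if "openin (mtop X) V" "V \<subseteq> U" for V
    by (rule moderate_restrict[OF regular_rep_moderate[OF U regular_rep_slow_scaleR[OF g u]] that])
  have "\<exists>V. openin (mtop X) V \<and> V \<subseteq> U \<and> p \<in> V \<and> ?v \<in> negligible_nets X V"
    if p: "p \<in> U" "p \<notin> Z" for p
  proof (cases "p \<in> Z'")
    case True
    then obtain N where N: "openin (mtop X) N" "p \<in> N" "\<forall>\<^sub>F \<epsilon> in at_right 0. \<forall>q\<in>N. g \<epsilon> q = 0"
      using zero p by blast
    have V: "openin (mtop X) (N \<inter> U)" using N U by blast
    have "sup_bigo K ?v a" if "K \<subseteq> N" for K a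
    proof (rule sup_bigo_cong[OF sup_bigo_zero])
      show "\<forall>\<^sub>F \<epsilon> in at_right 0. \<forall>q\<in>K. ?v \<epsilon> q = 0"
        using N(3) by eventually_elim (use that in auto)
    qed
    then have "?v \<in> negligible_nets X (N \<inter> U)"
      using vm[OF V] unfolding negligible_nets_def by simp
    then show ?thesis using V N p by (intro exI[of _ "N \<inter> U"]) auto
  next
    case False
    with p have "p \<notin> supp_in X U
        (net_class X U u)" unfolding supp by blast
    then obtain V where V: "openin (mtop X) V" "V \<subseteq> U" "p \<in> V"
      "gen_restrict X V (net_class X U u) = \<zero>\<^bsub>regular_gen_fun X V\<^esub>"
      using p(1) unfolding sheaf_supp_def by blast
    then have "u \<in> negligible_nets X V" using gen_restrict_eq_zero_iff[OF U V(1,2)] by blast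
    then have "?v \<in> negligible_nets X V"
      by (rule negligible_slow_scaleR[OF V(1) slow_on_mfd_mono[OF g V(2)] _ vm[OF V(1,2)]])
    then show ?thesis using V by blast
  qed
  note vanish = this
  show ?thesis
  proof
    fix p assume p: "p \<in> supp_in X U
        (net_class X U ?v)"
    show "p \<in> Z"
    proof (rule ccontr)
      assume "p \<notin> Z"
      moreover have "p \<in> U" using p by (simp add: sheaf_supp_def)
      ultimately obtain V where V: "openin (mtop X) V" "V \<subseteq> U" "p \<in> V" "?v \<in> negligible_nets X V"
        using vanish by blast
      then have "gen_restrict X V (net_class X U ?v) = \<zero>\<^bsub>regular_gen_fun X V\<^esub>"
        using gen_restrict_eq_zero_iff[OF U V(1,2)] by blast
      with V p show False unfolding sheaf_supp_def by blast
    qed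
  qed
qed

end

theorem theorem2p4:
  fixes X :: "('a, 'e::euclidean_space) manifold"
  assumes "smooth_manifold X"
    and "Hausdorff_space (mtop X)"
    and "paracompact_space (mtop X)"
  shows "supple (mtop X)
    (regular_gen_fun X ::
      'a set \<Rightarrow> (real \<Rightarrow> 'a \<Rightarrow> 'k::{real_normed_field,euclidean_space}) set ring)
    (gen_restrict X)"
proof -
  interpret paracompact_mfd X
    by unfold_locales (fact assms)+
  show ?thesis
    unfolding supple_def
  proof (intro allI impI, elim conjE)
    fix U :: "'a set" and f :: "(real \<Rightarrow> 'a \<Rightarrow> 'k) set" and Z1 Z2
    assume U: "openin (mtop X) U" and f: "f \<in> carrier (regular_gen_fun X U)"
      and Z: "closedin (mtop X) Z1" "closedin (mtop X) Z2"
      and supp: "supp_in X U f = Z1 \<union> Z2"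
    obtain u where u: "regular_rep X U u" "f = net_class X U u"
      by (rule regular_section_cases[OF U f])
    obtain \<eta> :: "real \<Rightarrow> 'a \<Rightarrow> real" where \<eta>: "slow_on_mfd X (topspace (mtop X)) \<eta>"
      and \<eta>1: "\<And>p. p \<in> Z1 - Z2 \<Longrightarrow> \<exists>N. openin (mtop X) N \<and> p \<in> N \<and> (\<forall>\<^sub>F \<epsilon> in at_right 0. \<forall>q\<in>N. \<eta> \<epsilon> q = 1)"
      and \<eta>2: "\<And>p. p \<in> Z2 - Z1 \<Longrightarrow> \<exists>N. openin (mtop X) N \<and> p \<in> N \<and> (\<forall>\<^sub>F \<epsilon> in at_right 0. \<forall>q\<in>N. \<eta> \<epsilon> q = 0)"
      by (rule slow_on_mfd_separating_net[OF Z]) blast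
    define \<eta>' where "\<eta>' \<epsilon> p = 1 + (-1) *\<^sub>R \<eta> \<epsilon> p" for \<epsilon> p
    have \<eta>U: "slow_on_mfd X U \<eta>" using \<eta> openin_subset[OF U] by (rule slow_on_mfd_mono)
    have \<eta>'U: "slow_on_mfd X U \<eta>'"
      unfolding \<eta>'_def by (intro slow_on_mfd_add slow_on_mfd_const slow_on_mfd_scaleR[OF slow_on_mfd_const \<eta>U])
    let ?f1 = "net_class X U (\<lambda>\<epsilon> p. \<eta> \<epsilon> p *\<^sub>R u \<epsilon> p)"
    let ?f2 = "net_class X U (\<lambda>\<epsilon> p. \<eta>' \<epsilon> p *\<^sub>R u \<epsilon> p)"
    have "?f1 \<in> carrier (regular_gen_fun X U)" "?f2 \<in> carrier (regular_gen_fun X U)"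
      by (rule regular_rep_net_class_mem[OF U regular_rep_slow_scaleR[OF \<eta>U u(1)]],
          rule regular_rep_net_class_mem[OF U regular_rep_slow_scaleR[OF \<eta>'U u(1)]])
    moreover have "supp_in X U ?f1 \<subseteq> Z1"
      by (rule supp_slow_scaleR_subset[OF U u(1) \<eta>U supp[unfolded u(2)] \<eta>2])
    moreover have "supp_in X U ?f2 \<subseteq> Z2"
    proof (rule supp_slow_scaleR_subset[OF U u(1) \<eta>'U])
      show "supp_in X U
          (net_class X U u) = Z2 \<union> Z1"
        using supp u(2) by (simp add: Un_commute)
      show "\<exists>N. openin (mtop X) N \<and> p \<in> N \<and> (\<forall>\<^sub>F \<epsilon> in at_right 0. \<forall>q\<in>N. \<eta>' \<epsilon> q = 0)"
        if "p \<in> Z1 - Z2" for p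
      proof -
        from \<eta>1[OF that] obtain N where N: "openin (mtop X) N" "p \<in> N"
          "\<forall>\<^sub>F \<epsilon> in at_right 0. \<forall>q\<in>N. \<eta> \<epsilon> q = 1" by blast
        from N(3) have "\<forall>\<^sub>F \<epsilon> in at_right 0. \<forall>q\<in>N. \<eta>' \<epsilon> q = 0"
          by eventually_elim (simp add: \<eta>'_def)
        with N show ?thesis by blast
      qed
    qed
    moreover have "f = ?f1 \<oplus>\<^bsub>regular_gen_fun X U\<^esub> ?f2"
      unfolding net_class_add[OF U] u(2) by (simp add: \<eta>'_def algebra_simps)
    ultimately show "\<exists>f1\<in>carrier (regular_gen_fun X U). \<exists>f2\<in>carrier (regular_gen_fun X U).
        supp_in X U f1 \<subseteq> Z1 \<and>
        supp_in X U f2 \<subseteq> Z2 \<and>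
        f = f1 \<oplus>\<^bsub>regular_gen_fun X U\<^esub> f2"
      by blast
  qed
qed

end
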